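(* Let $G$ be a connected permutation graph. If $G$ is Cohen-Macaulay, then its complement $G^{c}$ is a uniquely partially orderable (UPO) graph.
   Context: All graphs are finite and simple. For permutations $\pi_1,\pi_2$ of $[n]=\{1,\ldots,n\}$, draw two horizontal lines $L_1,L_2$, labeled from left to right by $\pi_1$ and $\pi_2$ respectively, and for each $i\in[n]$ let $f_i$ be the line segment joining $i$ on $L_1$ to $i$ on $L_2$. The graph $G_{\pi_1,\pi_2}$ has vertex set $[n]$, and $\{i,j\}$ ($i\ne j$) is an edge if and only if $f_i$ intersects $f_j$ (i.e. $i$ and $j$ appear in opposite relative orders in the words $\pi_1$ and $\pi_2$). A simple graph $G$ on $n$ vertices is a permutation graph if (after labeling its vertices by $[n]$) $G=G_{\pi_1,\pi_2}$ for some permutations $\pi_1,\pi_2$ of $[n]$. For a simple graph $G$ on $[n]$ and a field $K$, let $S=K[x_1,\ldots,x_n]$ and let $I_G=(x_ix_j : \{i,j\}\in E(G))$ be the edge ideal of $G$. $G$ is Cohen-Macaulay over $K$ if $S/I_G$ is a Cohen-Macaulay ring; $G$ is Cohen-Macaulay if it is Cohen-Macaulay over every field $K$. The comparability graph $\operatorname{comp}(P)$ of a poset $P$ is the simple graph on the underlying set of $P$ in which $\{x,y\}$ is an edge iff $x\neq y$ and $x,y$ are comparable in $P$. A graph is a comparability graph if it equals $\operatorname{comp}(P)$ for some poset $P$; the complement of a permutation graph is known to be a comparability graph. The dual poset $Q^{\partial}$ of $Q$ is the poset on the same set with the opposite order. A comparability graph $H$ is a uniquely partially orderable (UPO) graph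 if $H=\operatorname{comp}(P)=\operatorname{comp}(Q)$ for posets $P,Q$ implies $P=Q$ or $P=Q^{\partial}$. *)

theory Defs
  imports
    "HOL-Algebra.Indexed_Polynomials"
    "HOL-Algebra.QuotRing"
    "HOL-Algebra.Ring_Divisibility"
    "HOL-Combinatorics.Permutations"
    "HOL-Library.Extended_Nat"
    "Graph_Theory.Graph_Theory"
begin

text \<open>
  Finite simple graphs are the \<^locale>\<open>pair_graph\<close>s of the Graph Theory entry: finite, loop-free
  digraphs with a symmetric set of arcs, an edge \<open>{u,v}\<close> being the two arcs \<open>(u,v)\<close> and \<open>(v,u)\<close>.
\<close>

definition complement_graph :: "'v pair_pre_digraph \<Rightarrow> 'v pair_pre_digraph" where
  "complement_graph G =
     \<lparr>pverts = pverts G,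
      parcs = {(u, v). u \<in> pverts G \<and> v \<in> pverts G \<and> u \<noteq> v \<and> (u, v) \<notin> parcs G}\<rparr>"


section \<open>Permutation graphs\<close>

text \<open>
  A permutation \<open>p\<close> is read as the word \<open>p 1, \<dots>, p n\<close>, so that \<open>i\<close> stands at position
  \<open>inv_into {1..n} p i\<close>.  The segments of \<open>i\<close> and \<open>j\<close> cross iff \<open>i\<close> and \<open>j\<close> occur in
  opposite orders in the two words.
\<close>

definition perm_graph :: "nat \<Rightarrow> (nat \<Rightarrow> nat) \<Rightarrow> (nat \<Rightarrow> nat) \<Rightarrow> nat pair_pre_digraph" where
  "perm_graph n p1 p2 =
     \<lparr>pverts = {1..n},
      parcs = {(i, j). i \<in> {1..n} \<and> j \<in> {1..n} \<and>
        (inv_into {1..n} p1 i < inv_into {1..n} p1 j \<and> inv_into {1..n} p2 j < inv_into {1..n} p2 i \<or>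
         inv_into {1..n} p1 j < inv_into {1..n} p1 i \<and> inv_into {1..n} p2 i < inv_into {1..n} p2 j)}\<rparr>"

definition permutation_graph :: "'v pair_pre_digraph \<Rightarrow> bool" where
  "permutation_graph G \<longleftrightarrow>
     (\<exists>n p1 p2 f. p1 permutes {1..n} \<and> p2 permutes {1..n} \<and>
        bij_betw f {1..n} (pverts G) \<and>
        parcs G = map_prod f f ` parcs (perm_graph n p1 p2))"


section \<open>Comparability graphs\<close>

text \<open>
  A poset is a relation \<open>P\<close> with \<^term>\<open>Partial_order P\<close>; by reflexivity its underlying set is
  \<^term>\<open>Field P\<close>.
\<close>

definition comp_graph :: "'v rel \<Rightarrow> 'v pair_pre_digraph" where
  "comp_graph P =
     \<lparr>pverts = Field P, parcs = {(x, y). x \<noteq> y \<and> ((x, y) \<in> P \<or> (y, x) \<in> P)}\<rparr>"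

definition comparability_graph :: "'v pair_pre_digraph \<Rightarrow> bool" where
  "comparability_graph H \<longleftrightarrow> (\<exists>P. Partial_order P \<and> H = comp_graph P)"

definition UPO :: "'v pair_pre_digraph \<Rightarrow> bool" where
  "UPO H \<longleftrightarrow> comparability_graph H \<and>
     (\<forall>P Q. Partial_order P \<and> Partial_order Q \<and> H = comp_graph P \<and> H = comp_graph Q \<longrightarrow>
        P = Q \<or> P = Q\<inverse>)"


section \<open>Cohen--Macaulay rings\<close>

definition height :: "('a, 'b) ring_scheme \<Rightarrow> 'a set \<Rightarrow> enat" where
  "height R P = Sup {enat n | n Q.
     (\<forall>i\<le>n. primeideal (Q i) R) \<and> (\<forall>i<n. Q i \<subset> Q (Suc i)) \<and> Q n = P}"

definition regular_sequence :: "('a, 'b) ring_scheme \<Rightarrow> 'a list \<Rightarrow> bool" where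
  "regular_sequence R xs \<longleftrightarrow> set xs \<subseteq> carrier R \<and> genideal R (set xs) \<noteq> carrier R \<and>
     (\<forall>i<length xs. \<forall>a\<in>carrier R.
        xs ! i \<otimes>\<^bsub>R\<^esub> a \<in> genideal R (set (take i xs)) \<longrightarrow> a \<in> genideal R (set (take i xs)))"

definition depth :: "('a, 'b) ring_scheme \<Rightarrow> 'a set \<Rightarrow> enat" where
  "depth R I = Sup {enat (length xs) | xs. set xs \<subseteq> I \<and> regular_sequence R xs}"

text \<open>
  This is the definition of Eisenbud, \<^emph>\<open>Commutative Algebra\<close>, Section 18.2; it is stated in the
  ring itself, without localizing at the maximal ideals.
\<close>

definition cohen_macaulay_ring :: "('a, 'b) ring_scheme \<Rightarrow> bool" where
  "cohen_macaulay_ring R \<longleftrightarrow> cring R \<and> noetherian_ring R \<and>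
     (\<forall>P. maximalideal P R \<longrightarrow> depth R P = height R P)"


section \<open>Edge ideals and Cohen--Macaulay graphs\<close>

text \<open>
  The polynomial ring over \<open>K\<close> in variables indexed by \<open>V\<close>.  Polynomials are those of
  \<^theory>\<open>HOL-Algebra.Indexed_Polynomials\<close>: functions from monomials (multisets of variables)
  to coefficients.  That theory only multiplies by single variables, so the general product is
  given here as a convolution.
\<close>

definition mpoly_ring :: "('k, 'b) ring_scheme \<Rightarrow> 'v set \<Rightarrow> ('v multiset \<Rightarrow> 'k) ring" where
  "mpoly_ring K V =
     \<lparr>carrier = ring.indexed_pset K V (carrier K),
      monoid.mult = (\<lambda>p q m. \<Oplus>\<^bsub>K\<^esub>a\<in>{a. a \<subseteq># m}. p a \<otimes>\<^bsub>K\<^esub> q (m - a)),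
      one = ring.indexed_const K \<one>\<^bsub>K\<^esub>,
      zero = ring.indexed_const K \<zero>\<^bsub>K\<^esub>,
      add = ring.indexed_padd K\<rparr>"

definition edge_ideal ::
    "('k, 'b) ring_scheme \<Rightarrow> 'v pair_pre_digraph \<Rightarrow> ('v multiset \<Rightarrow> 'k) set" where
  "edge_ideal K G = genideal (mpoly_ring K (pverts G))
     {ring.indexed_var K u \<otimes>\<^bsub>mpoly_ring K (pverts G)\<^esub> ring.indexed_var K v | u v.
        (u, v) \<in> parcs G}"

definition cohen_macaulay_over :: "('k, 'b) ring_scheme \<Rightarrow> 'v pair_pre_digraph \<Rightarrow> bool" where
  "cohen_macaulay_over K G \<longleftrightarrow>
     cohen_macaulay_ring (mpoly_ring K (pverts G) Quot edge_ideal K G)"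

text \<open>
  HOL cannot quantify over all fields at once, so the quantifier ranges over the fields whose
  elements are taken from a type \<open>'k\<close>.  If \<open>'k\<close> is infinite, this includes fields of every
  characteristic; over a finite type it could be vacuous.
\<close>

definition cohen_macaulay_graph :: "'k itself \<Rightarrow> 'v pair_pre_digraph \<Rightarrow> bool" where
  "cohen_macaulay_graph (_ :: 'k itself) G \<longleftrightarrow>
     (\<forall>K :: 'k ring. field K \<longrightarrow> cohen_macaulay_over K G)"

end

theory Submission
  imports
    Defs
    "HOL-Library.Countable_Set"
    "HOL-Library.Poly_Mapping"
    "HOL-Library.Z2"
begin

text \<open>
  \<^bold>\<open>Orientations.\<close> Comparing the positions of two vertices in both words orders the complement of a
  permutation graph. Suppose that the complement \<open>H\<close> of \<open>G\<close> is the comparability graph of two posets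
  \<open>P\<close> and \<open>Q\<close> that are neither equal nor dual. Colour the pairs of vertices with three colours: the
  edges of \<open>H\<close> on which \<open>P\<close> and \<open>Q\<close> agree, those on which they disagree, and the edges of \<open>G\<close>.
  Transitivity of \<open>P\<close> and \<open>Q\<close> excludes triangles with three different colours, so by Gallai's theorem
  (\<open>rainbow_free_colour_disconnected\<close>) one of the colours is disconnected. It is not the colour of
  \<open>G\<close>, as \<open>G\<close> is connected; hence it is one of the other two, which both occur. A
  nontrivial component of such a disconnected colour is a proper subset \<open>M\<close> of the vertices that contains
  two vertices not adjacent in \<open>G\<close>, and it is a module: a vertex outside \<open>M\<close> is adjacent in \<open>G\<close> to all
  of \<open>M\<close> or to none of it (\<open>two_orientations_module\<close>).

  \<^bold>\<open>Links.\<close> Such a module disconnects a link of the independence complex of \<open>G\<close>. Let \<open>N\<close> be the set of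
  vertices outside \<open>M\<close> that are adjacent to \<open>M\<close>; it is not empty, as \<open>G\<close> is connected. Among the
  independent sets of vertices outside \<open>M \<union> N\<close> that have a common non-neighbour in \<open>N\<close>, let \<open>A\<close> be a maximal one.
  The vertices that can be added to \<open>A\<close> form two nonempty classes, those in \<open>N\<close> and the others,
  and maximality of \<open>A\<close> says that every vertex of the first class is adjacent to every vertex of
  the second (\<open>module_disconnects_link\<close>). The second class contains \<open>M\<close>, hence two nonadjacent vertices
  \<open>i\<close> and \<open>j\<close>, so the link of \<open>A\<close> has positive dimension.

  \<^bold>\<open>Depth.\<close> A Cohen--Macaulay complex has no disconnected link of positive dimension. One field is
  enough to see this, and over \<open>\<bbbF>\<^sub>2\<close> it has a short proof. In the edge ring \<open>R\<close> consider the maximal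
  ideal \<open>\<mm>\<close> of the point where the variables of \<open>A\<close> are \<open>1\<close> and all others are \<open>0\<close>. The
  variables outside \<open>A \<union> {i, j}\<close> generate a prime; adding \<open>x\<^sub>i\<close> and \<open>x\<^sub>j\<close>, and then the \<open>x\<^sub>a - 1\<close> with
  \<open>a \<in> A\<close>, one at a time, gives a chain of primes of length \<open>card A + 2\<close> that ends in \<open>\<mm>\<close>; hence \<open>\<mm>\<close>
  contains a regular sequence of this length. On the other hand the elements \<open>x\<^sub>a - 1\<close> with \<open>a \<in> A\<close>, followed by the sum \<open>w\<close>
  of the variables of the link, form a regular sequence of length \<open>card A + 1\<close>, because modulo the \<open>x\<^sub>a - 1\<close> the
  ring becomes the edge ring of the link. If the vertices of the link split into \<open>W1\<close> and \<open>W2\<close> and every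
  vertex of \<open>W1\<close> is adjacent to every vertex of \<open>W2\<close>, then the sum \<open>u\<close> of the variables in \<open>W1\<close> satisfies \<open>x\<^sub>v u = x\<^sub>v w\<close> for
  \<open>v \<in> W1\<close> and \<open>x\<^sub>v u = 0\<close> for \<open>v \<in> W2\<close>. So \<open>u\<close> is a nonzero element, killed by \<open>\<mm>\<close>, of the
  quotient by this sequence. The quotient by the first \<open>card A + 1\<close> entries of the longer sequence has no such
  element, as the next entry is not a zero divisor there. But by a theorem of Rees, whether such an element
  exists depends only on the length of the regular sequence in \<open>\<mm>\<close> (\<open>socle_free_regular_mod\<close>).
\<close>

(* the same symbol denotes ring addition below *)
no_notation vwalk_join (infixr "\<oplus>" 65)

section \<open>Maximal regular sequences and socles\<close>

text \<open>
  The following notions are relative to an ideal given by generators, so that dividing out one element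
  after another takes place in a single ring.
\<close>
definition (in cring) nonzerodivisor_mod :: "'a \<Rightarrow> 'a set \<Rightarrow> bool" where
  "nonzerodivisor_mod x J \<longleftrightarrow> (\<forall>a\<in>carrier R. x \<otimes> a \<in> J \<longrightarrow> a \<in> J)"

definition (in cring) regular_mod :: "'a set \<Rightarrow> 'a list \<Rightarrow> bool" where
  "regular_mod J xs \<longleftrightarrow>
     (\<forall>i<length xs. nonzerodivisor_mod (xs ! i) (Idl (J \<union> set (take i xs))))"

text \<open>
  The quotient by the ideal generated by \<open>J\<close> has no nonzero element annihilated by \<open>I\<close>, that is,
  \<open>Hom(R/I, R/(J)) = 0\<close>.
\<close>
definition (in cring) socle_free :: "'a set \<Rightarrow> 'a set \<Rightarrow> bool" where
  "socle_free I J \<longleftrightarrow> (\<forall>u\<in>carrier R. (\<forall>i\<in>I. i \<otimes> u \<in> Idl J) \<longrightarrow> u \<in> Idl J)"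

context cring
begin

lemma regular_mod_Nil [simp]: "regular_mod J []"
  by (simp add: regular_mod_def)

lemma regular_mod_Cons:
  "regular_mod J (x # xs) \<longleftrightarrow> nonzerodivisor_mod x (Idl J) \<and> regular_mod (insert x J) xs"
  by (simp add: regular_mod_def All_less_Suc2)

lemma regular_mod_snoc:
  "regular_mod J (xs @ [x]) \<longleftrightarrow>
     regular_mod J xs \<and> nonzerodivisor_mod x (Idl (J \<union> set xs))"
  by (auto simp: regular_mod_def nth_append less_Suc_eq)

lemma Idl_insert:
  assumes "x \<in> carrier R" "J \<subseteq> carrier R"
  shows "Idl (insert x J) = {j \<oplus> x \<otimes> v | j v. j \<in> Idl J \<and> v \<in> carrier R}"
proof -
  interpret J: ideal "Idl J" R using assms(2) by (rule genideal_ideal)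
  have "Idl (insert x J) = Idl (Idl J \<union> PIdl x)"
  proof (intro equalityI genideal_minimal)
    have "J \<subseteq> Idl J" using assms(2) by (rule genideal_self)
    moreover have "x \<in> PIdl x" using assms(1) by (rule cgenideal_self)
    moreover have *: "Idl J \<union> PIdl x \<subseteq> carrier R"
      using J.a_subset cgenideal_ideal[OF assms(1)]
      by (meson Un_least additive_subgroup.a_subset ideal.axioms(1))
    ultimately show "insert x J \<subseteq> Idl (Idl J \<union> PIdl x)"
      using genideal_self[OF *] by blast
    show "ideal (Idl (Idl J \<union> PIdl x)) R" by (rule genideal_ideal[OF *])
    have c: "insert x J \<subseteq> carrier R" using assms by auto
    show i: "ideal (Idl (insert x J)) R" by (rule genideal_ideal[OF c])
    have "Idl J \<subseteq> Idl (insert x J)" by (rule subset_Idl_subset[OF c]) auto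
    moreover have "PIdl x \<subseteq> Idl (insert x J)"
      by (rule cgenideal_minimal[OF i]) (use genideal_self[OF c] in auto)
    ultimately show "Idl J \<union> PIdl x \<subseteq> Idl (insert x J)" by simp
  qed
  also have "\<dots> = Idl J <+> PIdl x"
    by (rule union_genideal[OF J.is_ideal cgenideal_ideal[OF assms(1)]])
  also have "\<dots> = {j \<oplus> x \<otimes> v | j v. j \<in> Idl J \<and> v \<in> carrier R}"
    using assms(1) m_comm by (fastforce simp: set_add_defs cgenideal_def)
  finally show ?thesis .
qed

lemma nonzerodivisor_modD:
  "nonzerodivisor_mod x J \<Longrightarrow> a \<in> carrier R \<Longrightarrow> x \<otimes> a \<in> J \<Longrightarrow> a \<in> J"
  by (simp add: nonzerodivisor_mod_def)

lemma ideal_minus_closed: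
  assumes "ideal J R" "a \<in> J" "b \<in> J" shows "a \<ominus> b \<in> J"
proof -
  interpret ideal J R by fact
  show ?thesis using assms(2,3) by (simp add: a_minus_def)
qed

text \<open>
  If \<open>x u = w v\<close> modulo \<open>J\<close>, then \<open>w\<close> being regular modulo \<open>x\<close> makes \<open>v\<close> a multiple \<open>x t\<close> of \<open>x\<close>,
  and cancelling \<open>x\<close> gives \<open>u = w t\<close>.
\<close>
lemma nonzerodivisor_mod_swap:
  assumes J: "J \<subseteq> carrier R" and x: "x \<in> carrier R" and w: "w \<in> carrier R"
    and "nonzerodivisor_mod x (Idl J)" "nonzerodivisor_mod w (Idl (insert x J))"
    and wJ: "nonzerodivisor_mod w (Idl J)"
  shows "nonzerodivisor_mod x (Idl (insert w J))"
  unfolding nonzerodivisor_mod_def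
proof (intro ballI impI)
  interpret J: ideal "Idl J" R using J by (rule genideal_ideal)
  fix u assume u: "u \<in> carrier R" and "x \<otimes> u \<in> Idl (insert w J)"
  then obtain j v where j: "j \<in> Idl J" and v: "v \<in> carrier R" and xu: "x \<otimes> u = j \<oplus> w \<otimes> v"
    using Idl_insert[OF w J] by auto
  note jc = J.Icarr[OF j]
  have "w \<otimes> v = \<ominus> j \<oplus> x \<otimes> u" using xu jc u v x w by algebra
  moreover have "\<ominus> j \<in> Idl J" using j by simp
  ultimately have "w \<otimes> v \<in> Idl (insert x J)" using Idl_insert[OF x J] u by blast
  then have "v \<in> Idl (insert x J)" using nonzerodivisor_modD assms(5) v by blast
  then obtain k t where k: "k \<in> Idl J" and t: "t \<in> carrier R" and vk: "v = k \<oplus> x \<otimes> t"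
    using Idl_insert[OF x J] by auto
  note kc = J.Icarr[OF k]
  have "x \<otimes> (u \<ominus> w \<otimes> t) = j \<oplus> w \<otimes> k"
  proof -
    have "x \<otimes> (u \<ominus> w \<otimes> t) = x \<otimes> u \<ominus> x \<otimes> w \<otimes> t" using x u w t by algebra
    also have "\<dots> = j \<oplus> w \<otimes> k" unfolding xu vk using x u w t jc kc by algebra
    finally show ?thesis .
  qed
  moreover have "j \<oplus> w \<otimes> k \<in> Idl J" using j k w by (simp add: J.I_l_closed)
  ultimately have "u \<ominus> w \<otimes> t \<in> Idl J" using nonzerodivisor_modD assms(4) u w t by simp
  moreover have "u = (u \<ominus> w \<otimes> t) \<oplus> w \<otimes> t" using u w t by algebra
  ultimately show "u \<in> Idl (insert w J)" using Idl_insert[OF w J] t by blast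
qed

lemma regular_mod_swap:
  assumes "J \<subseteq> carrier R" "set xs \<subseteq> carrier R" "w \<in> carrier R"
    and "regular_mod J xs"
    and "\<And>k. k \<le> length xs \<Longrightarrow> nonzerodivisor_mod w (Idl (J \<union> set (take k xs)))"
  shows "regular_mod (insert w J) xs"
  using assms
proof (induction xs arbitrary: J)
  case Nil
  then show ?case by simp
next
  case (Cons x xs)
  have "nonzerodivisor_mod x (Idl (insert w J))"
  proof (rule nonzerodivisor_mod_swap)
    show "nonzerodivisor_mod w (Idl (insert x J))" using Cons.prems(5)[of 1] by simp
    show "nonzerodivisor_mod w (Idl J)" using Cons.prems(5)[of 0] by simp
  qed (use Cons.prems in \<open>auto simp: regular_mod_Cons\<close>)
  moreover have "regular_mod (insert w (insert x J)) xs"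
  proof (rule Cons.IH)
    show "nonzerodivisor_mod w (Idl (insert x J \<union> set (take k xs)))" if "k \<le> length xs" for k
      using Cons.prems(5)[of "Suc k"] that by simp
  qed (use Cons.prems in \<open>auto simp: regular_mod_Cons\<close>)
  ultimately show ?case by (simp add: regular_mod_Cons insert_commute)
qed

text \<open>
  For regular elements \<open>x\<close> and \<open>y\<close> of \<open>I\<close>, the relation \<open>y u = x v\<close> modulo \<open>J\<close> matches the elements
  \<open>u\<close> annihilated by \<open>I\<close> modulo \<open>x\<close> with the elements \<open>v\<close> annihilated by \<open>I\<close> modulo \<open>y\<close>; both sides
  represent \<open>Ext\<^sup>1(R/I, R/(J))\<close>.
\<close>
lemma socle_free_exchange:
  assumes J: "J \<subseteq> carrier R" and I: "I \<subseteq> carrier R" and x: "x \<in> I" and y: "y \<in> I"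
    and nx: "nonzerodivisor_mod x (Idl J)" and ny: "nonzerodivisor_mod y (Idl J)"
    and sy: "socle_free I (insert y J)"
  shows "socle_free I (insert x J)"
  unfolding socle_free_def
proof (intro ballI impI)
  interpret J: ideal "Idl J" R using J by (rule genideal_ideal)
  have xc: "x \<in> carrier R" and yc: "y \<in> carrier R" using x y I by auto
  fix u assume u: "u \<in> carrier R" and soc: "\<forall>i\<in>I. i \<otimes> u \<in> Idl (insert x J)"
  then obtain j v where j: "j \<in> Idl J" and v: "v \<in> carrier R" and yu: "y \<otimes> u = j \<oplus> x \<otimes> v"
    using Idl_insert[OF xc J] y by blast
  note jc = J.Icarr[OF j]
  have "i \<otimes> v \<in> Idl (insert y J)" if i: "i \<in> I" for i
  proof -
    have ic: "i \<in> carrier R" using i I by auto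
    obtain k s where k: "k \<in> Idl J" and s: "s \<in> carrier R" and iu: "i \<otimes> u = k \<oplus> x \<otimes> s"
      using soc i Idl_insert[OF xc J] by blast
    note kc = J.Icarr[OF k]
    have "x \<otimes> (i \<otimes> v \<ominus> y \<otimes> s) = i \<otimes> (j \<oplus> x \<otimes> v) \<ominus> i \<otimes> j \<ominus> y \<otimes> (x \<otimes> s)"
      using ic v s xc yc jc by algebra
    also have "\<dots> = y \<otimes> (i \<otimes> u) \<ominus> i \<otimes> j \<ominus> y \<otimes> (x \<otimes> s)"
      unfolding yu[symmetric] using ic u yc s xc jc by algebra
    also have "\<dots> = y \<otimes> k \<ominus> i \<otimes> j"
      unfolding iu using ic u yc s xc jc kc by algebra
    also have "\<dots> \<in> Idl J"
      using j k ic yc by (intro ideal_minus_closed J.is_ideal J.I_l_closed)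
    finally have "i \<otimes> v \<ominus> y \<otimes> s \<in> Idl J"
      using nonzerodivisor_modD[OF nx] ic v s yc by simp
    moreover have "i \<otimes> v = (i \<otimes> v \<ominus> y \<otimes> s) \<oplus> y \<otimes> s" using ic v s yc by algebra
    ultimately show ?thesis using Idl_insert[OF yc J] s by blast
  qed
  then have "v \<in> Idl (insert y J)" using sy v by (simp add: socle_free_def)
  then obtain k t where k: "k \<in> Idl J" and t: "t \<in> carrier R" and vk: "v = k \<oplus> y \<otimes> t"
    using Idl_insert[OF yc J] by blast
  note kc = J.Icarr[OF k]
  have "y \<otimes> (u \<ominus> x \<otimes> t) = y \<otimes> u \<ominus> x \<otimes> (y \<otimes> t)" using u xc yc t by algebra
  also have "\<dots> = j \<oplus> x \<otimes> k" unfolding yu vk using xc yc t kc jc by algebra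
  also have "\<dots> \<in> Idl J" using j k xc by (simp add: J.I_l_closed)
  finally have "u \<ominus> x \<otimes> t \<in> Idl J" using nonzerodivisor_modD[OF ny] u xc t by simp
  moreover have "u = (u \<ominus> x \<otimes> t) \<oplus> x \<otimes> t" using u xc t by algebra
  ultimately show "u \<in> Idl (insert x J)" using Idl_insert[OF xc J] t by blast
qed

lemma prime_avoids_common_element:
  assumes "primeideal P R" "finite \<Q>" "\<And>Q. Q \<in> \<Q> \<Longrightarrow> ideal Q R \<and> \<not> Q \<subseteq> P"
  shows "\<exists>s\<in>carrier R. s \<notin> P \<and> (\<forall>Q\<in>\<Q>. s \<in> Q)"
  using assms(2,3)
proof (induction \<Q>)
  case empty
  interpret primeideal P R by fact
  show ?case using I_notcarr Icarr by blast
next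
  case (insert Q \<Q>)
  interpret primeideal P R by fact
  obtain s where s: "s \<in> carrier R" "s \<notin> P" "\<forall>Q\<in>\<Q>. s \<in> Q" using insert by blast
  interpret Q: ideal Q R using insert by blast
  obtain t where t: "t \<in> Q" "t \<notin> P" using insert by blast
  note tc = Q.Icarr[OF t(1)]
  have "s \<otimes> t \<in> Q'" if "Q' \<in> insert Q \<Q>" for Q'
  proof -
    interpret Q': ideal Q' R using that insert by blast
    from that show ?thesis using s t tc Q'.I_l_closed Q'.I_r_closed by auto
  qed
  moreover have "s \<otimes> t \<notin> P" using I_prime s t tc by blast
  ultimately show ?case using s tc by blast
qed

text \<open>
  After discarding the primes that contain another one, an element \<open>w\<close> that lies in just one prime \<open>P\<close> is
  corrected by an element of \<open>I\<close> and all the other primes that lies outside \<open>P\<close>.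
\<close>
lemma prime_avoidance:
  assumes "finite \<P>" "\<And>P. P \<in> \<P> \<Longrightarrow> primeideal P R" "ideal I R" "\<And>P. P \<in> \<P> \<Longrightarrow> \<not> I \<subseteq> P"
  shows "\<exists>w\<in>I. \<forall>P\<in>\<P>. w \<notin> P"
  using assms(1,2,4)
proof (induction \<P> rule: finite_psubset_induct)
  case (psubset \<P>)
  interpret I: ideal I R by fact
  show ?case
  proof (cases "\<exists>P\<in>\<P>. \<exists>Q\<in>\<P>. Q \<noteq> P \<and> Q \<subseteq> P")
    case True
    then obtain P Q where PQ: "P \<in> \<P>" "Q \<in> \<P>" "Q \<noteq> P" "Q \<subseteq> P" by blast
    have "\<P> - {Q} \<subset> \<P>" using PQ by auto
    then obtain w where w: "w \<in> I" "\<forall>P\<in>\<P> - {Q}. w \<notin> P"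
      using psubset.IH[of "\<P> - {Q}"] psubset.prems by auto
    then show ?thesis using PQ by blast
  next
    case incomparable: False
    show ?thesis
    proof (cases "\<P> = {}")
      case True
      then show ?thesis using I.zero_closed by blast
    next
      case False
      then obtain P where P: "P \<in> \<P>" by blast
      interpret P: primeideal P R using psubset P by blast
      have "\<P> - {P} \<subset> \<P>" using P by auto
      then obtain w where w: "w \<in> I" "\<forall>Q\<in>\<P> - {P}. w \<notin> Q"
        using psubset.IH[of "\<P> - {P}"] psubset.prems by auto
      show ?thesis
      proof (cases "w \<in> P")
        case False
        then show ?thesis using w by blast
      next
        case True
        have "finite (insert I (\<P> - {P}))" using psubset by simp
        moreover have "ideal Q R \<and> \<not> Q \<subseteq> P" if "Q \<in> insert I (\<P> - {P})" for Q
          using that psubset.prems P incomparable assms(3) by (auto dest: primeideal.axioms(1))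
        ultimately obtain s where s: "s \<in> carrier R" "s \<notin> P" "\<forall>Q\<in>insert I (\<P> - {P}). s \<in> Q"
          using prime_avoids_common_element[OF P.primeideal, of "insert I (\<P> - {P})"] by blast
        have wc: "w \<in> carrier R" using w I.Icarr by blast
        have "w \<oplus> s \<in> I" using w s by simp
        moreover have "w \<oplus> s \<notin> P"
        proof
          assume "w \<oplus> s \<in> P"
          then have "(w \<oplus> s) \<ominus> w \<in> P" using ideal_minus_closed[OF P.is_ideal] True by blast
          moreover have "(w \<oplus> s) \<ominus> w = s" using wc s by algebra
          ultimately show False using s by simp
        qed
        moreover have "w \<oplus> s \<notin> Q" if Q: "Q \<in> \<P> - {P}" for Q
        proof
          interpret Q: primeideal Q R using psubset Q by blast
          assume "w \<oplus> s \<in> Q"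
          then have "(w \<oplus> s) \<ominus> s \<in> Q" using ideal_minus_closed[OF Q.is_ideal] s Q by blast
          moreover have "(w \<oplus> s) \<ominus> s = w" using wc s by algebra
          ultimately show False using w Q by simp
        qed
        ultimately show ?thesis by blast
      qed
    qed
  qed
qed

lemma colon_ideal:
  assumes "ideal J R" "u \<in> carrier R"
  shows "ideal {a \<in> carrier R. a \<otimes> u \<in> J} R"
proof -
  interpret J: ideal J R by fact
  show ?thesis
  proof (rule idealI)
    show "subgroup {a \<in> carrier R. a \<otimes> u \<in> J} (add_monoid R)"
    proof (rule add.subgroupI)
      show "{a \<in> carrier R. a \<otimes> u \<in> J} \<noteq> {}" using assms(2) by (auto intro!: exI[of _ \<zero>])
      fix a assume "a \<in> {a \<in> carrier R. a \<otimes> u \<in> J}"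
      then show "\<ominus> a \<in> {a \<in> carrier R. a \<otimes> u \<in> J}"
        using assms(2) by (simp add: l_minus)
      fix b assume "b \<in> {a \<in> carrier R. a \<otimes> u \<in> J}"
      then show "a \<oplus> b \<in> {a \<in> carrier R. a \<otimes> u \<in> J}"
        using assms(2) \<open>a \<in> _\<close> by (simp add: l_distr)
    qed auto
  next
    fix a x assume "a \<in> {a \<in> carrier R. a \<otimes> u \<in> J}" "x \<in> carrier R"
    then show *: "x \<otimes> a \<in> {a \<in> carrier R. a \<otimes> u \<in> J}"
      using assms(2) by (simp add: m_assoc J.I_l_closed)
    then show "a \<otimes> x \<in> {a \<in> carrier R. a \<otimes> u \<in> J}"
      using \<open>a \<in> _\<close> \<open>x \<in> _\<close> by (simp add: m_comm)
  qed (rule ring_axioms)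
qed

end

lemma (in noetherian_ring) ideals_maximal_element:
  assumes "\<A> \<noteq> {}" "\<And>I. I \<in> \<A> \<Longrightarrow> ideal I R"
  shows "\<exists>M\<in>\<A>. \<forall>I\<in>\<A>. M \<subseteq> I \<longrightarrow> I = M"
proof (rule subset_Zorn_nonempty[OF assms(1)])
  fix C assume C: "C \<noteq> {}" "subset.chain \<A> C"
  then have "C \<subseteq> \<A>" by (simp add: subset_chain_def)
  moreover have "subset.chain {I. ideal I R} C"
    using C(2) assms(2) unfolding subset_chain_def by (simp add: subset_iff)
  ultimately show "\<Union>C \<in> \<A>" using ideal_chain_is_trivial[OF C(1)] by (simp add: subset_iff)
qed

context cring
begin

text \<open>
  The maximal members of the family of colon ideals \<open>(J : u)\<close> with \<open>u \<notin> J\<close> are prime. There are only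
  finitely many: an ideal generated by finitely many of the corresponding elements \<open>u\<close>, chosen maximal,
  contains all such \<open>u\<close>, so every one of these primes contains the intersection of the finitely many
  primes that belong to the generators, and by maximality it equals one of them.
\<close>
lemma finite_associated_primes:
  assumes "noetherian_ring R" "ideal J R"
  shows "\<exists>\<P>. finite \<P> \<and>
    (\<forall>P\<in>\<P>. primeideal P R \<and> (\<exists>u\<in>carrier R - J. \<forall>p\<in>P. p \<otimes> u \<in> J)) \<and>
    (\<forall>a\<in>carrier R. \<not> nonzerodivisor_mod a J \<longrightarrow> (\<exists>P\<in>\<P>. a \<in> P))"
proof -
  interpret noetherian_ring R by fact
  interpret J: ideal J R by fact
  define ann where "ann u = {a \<in> carrier R. a \<otimes> u \<in> J}" for u
  define U where "U = {u \<in> carrier R - J. \<forall>v\<in>carrier R - J. ann u \<subseteq> ann v \<longrightarrow> ann v = ann u}"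
  have ann_ideal: "ideal (ann u) R" if "u \<in> carrier R" for u
    unfolding ann_def using colon_ideal[OF assms(2) that] .
  have prime: "primeideal (ann u) R" if u: "u \<in> U" for u
  proof (rule primeidealI)
    have uc: "u \<in> carrier R" "u \<notin> J" using u by (auto simp: U_def)
    show "ideal (ann u) R" using ann_ideal uc by blast
    show "carrier R \<noteq> ann u"
    proof
      assume "carrier R = ann u"
      then have "\<one> \<otimes> u \<in> J" unfolding ann_def by blast
      then show False using uc by simp
    qed
    fix a b assume ab: "a \<in> carrier R" "b \<in> carrier R" "a \<otimes> b \<in> ann u"
    show "a \<in> ann u \<or> b \<in> ann u"
    proof (rule disjCI)
      assume "b \<notin> ann u"
      then have bu: "b \<otimes> u \<in> carrier R - J" using ab uc by (simp add: ann_def)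
      have "ann u \<subseteq> ann (b \<otimes> u)"
      proof
        fix c assume c: "c \<in> ann u"
        then have "b \<otimes> (c \<otimes> u) \<in> J" using ab by (simp add: ann_def J.I_l_closed)
        moreover have "b \<otimes> (c \<otimes> u) = c \<otimes> (b \<otimes> u)"
          using c ab uc by (simp add: ann_def m_lcomm)
        ultimately show "c \<in> ann (b \<otimes> u)" using c by (simp add: ann_def)
      qed
      then have "ann (b \<otimes> u) = ann u" using u bu by (simp add: U_def)
      moreover have "a \<in> ann (b \<otimes> u)" using ab uc by (simp add: ann_def m_assoc)
      ultimately show "a \<in> ann u" by simp
    qed
  qed (rule is_cring)
  have cover: "\<exists>v\<in>U. ann u \<subseteq> ann v" if u: "u \<in> carrier R - J" for u
  proof -
    let ?A = "{ann v | v. v \<in> carrier R - J \<and> ann u \<subseteq> ann v}"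
    have "?A \<noteq> {}" "\<And>I. I \<in> ?A \<Longrightarrow> ideal I R" using u ann_ideal by auto
    then obtain M where M: "M \<in> ?A" "\<forall>I\<in>?A. M \<subseteq> I \<longrightarrow> I = M"
      using ideals_maximal_element[of ?A] by auto
    then obtain v where v: "v \<in> carrier R - J" "ann u \<subseteq> ann v" "M = ann v" by blast
    have "v \<in> U" unfolding U_def using v M by blast
    then show ?thesis using v by blast
  qed
  have "finite (ann ` U)"
  proof -
    let ?A = "{Idl F | F. finite F \<and> F \<subseteq> U}"
    have Uc: "F \<subseteq> carrier R" if "F \<subseteq> U" for F using that by (auto simp: U_def)
    have "?A \<noteq> {}" by blast
    moreover have "ideal I R" if "I \<in> ?A" for I using that genideal_ideal Uc by blast
    ultimately obtain M where M: "M \<in> ?A" "\<forall>I\<in>?A. M \<subseteq> I \<longrightarrow> I = M"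
      using ideals_maximal_element[of ?A] by auto
    then obtain F where F: "finite F" "F \<subseteq> U" "M = Idl F" by blast
    have "ann u \<in> ann ` F" if u: "u \<in> U" for u
    proof (rule ccontr)
      \<comment> \<open>otherwise some element annihilates all of \<open>F\<close> modulo \<open>J\<close>, but not \<open>u\<close>\<close>
      assume no: "ann u \<notin> ann ` F"
      have "\<exists>F'. Idl (insert u F) = Idl F' \<and> finite F' \<and> F' \<subseteq> U"
        using F u by (intro exI[of _ "insert u F"]) auto
      moreover have "Idl F \<subseteq> Idl (insert u F)"
        using F u by (intro subset_Idl_subset Uc) auto
      ultimately have "Idl (insert u F) = Idl F" using M(2) unfolding F(3) by simp
      then have uF: "u \<in> Idl F" using genideal_self[OF Uc, of "insert u F"] F u by auto
      have "ideal Q R \<and> \<not> Q \<subseteq> ann u" if Q: "Q \<in> ann ` F" for Q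
      proof -
        obtain v where v: "v \<in> F" "Q = ann v" using Q by blast
        then have "v \<in> carrier R - J" "ann u \<noteq> ann v" "\<forall>w\<in>carrier R - J. ann v \<subseteq> ann w \<longrightarrow> ann w = ann v"
          using F no unfolding U_def by auto
        moreover have "u \<in> carrier R - J" using u unfolding U_def by simp
        ultimately show ?thesis using ann_ideal v by auto
      qed
      then obtain s where s: "s \<in> carrier R" "s \<notin> ann u" "\<forall>Q\<in>ann ` F. s \<in> Q"
        using prime_avoids_common_element[OF prime[OF u], of "ann ` F"] F by blast
      have "Idl F \<subseteq> {a \<in> carrier R. a \<otimes> s \<in> J}"
      proof (rule genideal_minimal[OF colon_ideal[OF assms(2) s(1)]])
        show "F \<subseteq> {a \<in> carrier R. a \<otimes> s \<in> J}"
          using s(1,3) Uc[OF F(2)] m_comm unfolding ann_def by force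
      qed
      then have "s \<in> ann u" using uF s(1) m_comm unfolding ann_def by force
      then show False using s by simp
    qed
    then have "ann ` U \<subseteq> ann ` F" by blast
    then show ?thesis using F finite_subset by blast
  qed
  moreover have "primeideal P R \<and> (\<exists>u\<in>carrier R - J. \<forall>p\<in>P. p \<otimes> u \<in> J)" if "P \<in> ann ` U" for P
    using that prime unfolding U_def ann_def by blast
  moreover have "\<exists>P\<in>ann ` U. a \<in> P" if a: "a \<in> carrier R" "\<not> nonzerodivisor_mod a J" for a
  proof -
    obtain u where "u \<in> carrier R - J" "a \<otimes> u \<in> J" using a by (auto simp: nonzerodivisor_mod_def)
    then show ?thesis using cover[of u] a unfolding ann_def by blast
  qed
  ultimately show ?thesis by (intro exI[of _ "ann ` U"]) simp
qed

text \<open>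
  If no single element of \<open>I\<close> were regular modulo all members of \<open>\<J>\<close>, then by prime avoidance \<open>I\<close> would lie
  in one of the associated primes, and would consist of zero divisors modulo some member of \<open>\<J>\<close>.
\<close>
lemma common_nonzerodivisor:
  assumes "noetherian_ring R" "ideal I R" "finite \<J>"
    and "\<And>J. J \<in> \<J> \<Longrightarrow> ideal J R \<and> (\<exists>x\<in>I. nonzerodivisor_mod x J)"
  shows "\<exists>w\<in>I. \<forall>J\<in>\<J>. nonzerodivisor_mod w J"
proof -
  interpret I: ideal I R by fact
  define covers where "covers J \<P> \<longleftrightarrow> finite \<P> \<and>
    (\<forall>P\<in>\<P>. primeideal P R \<and> (\<exists>u\<in>carrier R - J. \<forall>p\<in>P. p \<otimes> u \<in> J)) \<and>
    (\<forall>a\<in>carrier R. \<not> nonzerodivisor_mod a J \<longrightarrow> (\<exists>P\<in>\<P>. a \<in> P))" for J \<P>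
  have "\<forall>J\<in>\<J>. \<exists>\<P>. covers J \<P>"
    unfolding covers_def using finite_associated_primes[OF assms(1)] assms(4) by simp
  then obtain \<P> where "\<And>J. J \<in> \<J> \<Longrightarrow> covers J (\<P> J)" by metis
  then have \<P>: "finite (\<P> J)" "\<And>P. P \<in> \<P> J \<Longrightarrow> primeideal P R"
    "\<And>P. P \<in> \<P> J \<Longrightarrow> \<exists>u\<in>carrier R - J. \<forall>p\<in>P. p \<otimes> u \<in> J"
    "\<And>a. a \<in> carrier R \<Longrightarrow> \<not> nonzerodivisor_mod a J \<Longrightarrow> \<exists>P\<in>\<P> J. a \<in> P"
    if "J \<in> \<J>" for J using that unfolding covers_def by simp_all
  have "\<not> I \<subseteq> P" if P: "P \<in> \<P> J" and J: "J \<in> \<J>" for P J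
  proof
    assume "I \<subseteq> P"
    moreover obtain u where "u \<in> carrier R - J" "\<forall>p\<in>P. p \<otimes> u \<in> J" using \<P>(3)[OF J P] by blast
    moreover obtain x where "x \<in> I" "nonzerodivisor_mod x J" using assms(4)[OF J] by blast
    ultimately show False by (auto simp: nonzerodivisor_mod_def)
  qed
  then have "\<exists>w\<in>I. \<forall>P\<in>(\<Union>J\<in>\<J>. \<P> J). w \<notin> P"
    using \<P>(1,2) assms(2,3) by (intro prime_avoidance) auto
  then obtain w where w: "w \<in> I" "\<And>J P. J \<in> \<J> \<Longrightarrow> P \<in> \<P> J \<Longrightarrow> w \<notin> P" by blast
  then have "nonzerodivisor_mod w J" if "J \<in> \<J>" for J
    using \<P>(4)[OF that I.Icarr[OF w(1)]] that by blast
  then show ?thesis using w(1) by blast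
qed

text \<open>
  The theorem of Rees that \<open>Hom(R/I, R/(xs))\<close> depends on the length of the regular sequence \<open>xs\<close> only.
  To compare \<open>xs\<close> with \<open>ys\<close>, take an element \<open>w\<close> of \<open>I\<close> that is regular modulo all the proper initial
  segments. It can replace the last entries of both sequences (\<open>socle_free_exchange\<close>), and then move to
  the front (\<open>regular_mod_swap\<close>), where both sequences share it.
\<close>
theorem socle_free_regular_mod:
  assumes "noetherian_ring R" "ideal I R"
    and "J \<subseteq> carrier R" "length xs = length ys" "set xs \<subseteq> I" "set ys \<subseteq> I"
    and "regular_mod J xs" "regular_mod J ys" "socle_free I (J \<union> set ys)"
  shows "socle_free I (J \<union> set xs)"
  using assms(3-)
proof (induction "length xs" arbitrary: xs ys J)
  case 0
  have "xs = []" using 0(1) by simp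
  moreover have "ys = []" using 0(3) \<open>xs = []\<close> by simp
  ultimately show ?case using 0(8) by metis
next
  case (Suc n)
  interpret I: ideal I R by fact
  have Ic: "I \<subseteq> carrier R" using I.Icarr by blast
  obtain xs' x ys' y where xs: "xs = xs' @ [x]" and ys: "ys = ys' @ [y]"
    using Suc.hyps(2) Suc.prems(2) by (metis length_0_conv nat.distinct(1) rev_exhaust)
  have len: "length xs' = n" "length ys' = n" using Suc.hyps(2) Suc.prems(2) xs ys by auto
  have carr: "J \<union> set (take k zs) \<subseteq> carrier R" if "set zs \<subseteq> I" for k zs
    using that Suc.prems(1) Ic set_take_subset[of k zs] by blast
  define \<J> where "\<J> = (\<lambda>(k, zs). Idl (J \<union> set (take k zs))) ` ({..n} \<times> {xs, ys})"
  have "finite \<J>" by (simp add: \<J>_def)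
  moreover have "ideal K R \<and> (\<exists>z\<in>I. nonzerodivisor_mod z K)" if "K \<in> \<J>" for K
  proof -
    obtain k zs where k: "k \<le> n" "zs = xs \<or> zs = ys" "K = Idl (J \<union> set (take k zs))"
      using \<open>K \<in> \<J>\<close> by (auto simp: \<J>_def)
    have "regular_mod J zs" "k < length zs" "set zs \<subseteq> I" using k Suc.prems len xs ys by auto
    then show ?thesis using k genideal_ideal[OF carr, of zs k]
      by (auto simp: regular_mod_def intro!: bexI[of _ "zs ! k"])
  qed
  ultimately obtain w where w: "w \<in> I" "\<forall>K\<in>\<J>. nonzerodivisor_mod w K"
    using common_nonzerodivisor[OF assms(1,2)] by blast
  have wk: "nonzerodivisor_mod w (Idl (J \<union> set (take k zs)))"
    if "k \<le> n" "zs = xs' \<or> zs = ys'" for k zs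
  proof -
    have "nonzerodivisor_mod w (Idl (J \<union> set (take k xs)))"
      "nonzerodivisor_mod w (Idl (J \<union> set (take k ys)))" using w that(1) by (auto simp: \<J>_def)
    then show ?thesis using that len xs ys by auto
  qed
  have reg: "regular_mod J xs'" "regular_mod J ys'"
    "nonzerodivisor_mod x (Idl (J \<union> set xs'))" "nonzerodivisor_mod y (Idl (J \<union> set ys'))"
    using Suc.prems(5,6) xs ys by (auto simp: regular_mod_snoc)
  have sub: "J \<union> set xs' \<subseteq> carrier R" "J \<union> set ys' \<subseteq> carrier R" "x \<in> I" "y \<in> I"
    "set xs' \<subseteq> I" "set ys' \<subseteq> I" "w \<in> carrier R" "insert w J \<subseteq> carrier R"
    using Suc.prems xs ys Ic w by auto
  have wx: "nonzerodivisor_mod w (Idl (J \<union> set xs'))"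
    and wy: "nonzerodivisor_mod w (Idl (J \<union> set ys'))"
    using wk[of n xs'] wk[of n ys'] len by auto
  have "socle_free I (insert w (J \<union> set ys'))"
    by (rule socle_free_exchange[OF sub(2) Ic w(1) sub(4) wy reg(4)])
      (use Suc.prems(7) ys in simp)
  moreover have "regular_mod (insert w J) xs'" "regular_mod (insert w J) ys'"
    using sub reg wk len Suc.prems(1) Ic by (auto intro!: regular_mod_swap)
  ultimately have "socle_free I (insert w J \<union> set xs')"
    using sub len by (intro Suc.hyps(1)[of xs' "insert w J" ys']) auto
  then have "socle_free I (insert x (J \<union> set xs'))"
    by (intro socle_free_exchange[OF sub(1) Ic sub(3) w(1) reg(3) wx]) simp
  then show ?case by (simp add: xs)
qed

end

section \<open>Transitive orientations, modules and links\<close>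

text \<open>
  The edges of colour \<open>k\<close> form a connected graph on \<open>V\<close>.
\<close>
definition cut_connected :: "('a \<Rightarrow> 'a \<Rightarrow> 'c) \<Rightarrow> 'c \<Rightarrow> 'a set \<Rightarrow> bool" where
  "cut_connected c k V \<longleftrightarrow>
     (\<forall>S\<subseteq>V. S \<noteq> {} \<longrightarrow> S \<noteq> V \<longrightarrow> (\<exists>x\<in>S. \<exists>y\<in>V - S. c x y = k))"

definition rainbow_free :: "('a \<Rightarrow> 'a \<Rightarrow> 'c) \<Rightarrow> 'a set \<Rightarrow> bool" where
  "rainbow_free c V \<longleftrightarrow>
     (\<forall>x\<in>V. \<forall>y\<in>V. c x y = c y x) \<and>
     (\<forall>x\<in>V. \<forall>y\<in>V. \<forall>z\<in>V. x \<noteq> y \<longrightarrow> y \<noteq> z \<longrightarrow> x \<noteq> z \<longrightarrow>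
        c x y = c y z \<or> c y z = c x z \<or> c x y = c x z)"

lemma rainbow_freeD:
  assumes "rainbow_free c V" "x \<in> V" "y \<in> V" "z \<in> V" "x \<noteq> y" "y \<noteq> z" "x \<noteq> z"
  shows "c x y = c y z \<or> c y z = c x z \<or> c x y = c x z"
  using assms unfolding rainbow_free_def by simp

definition colour_component :: "('a \<Rightarrow> 'a \<Rightarrow> 'c) \<Rightarrow> 'c \<Rightarrow> 'a set \<Rightarrow> 'a \<Rightarrow> 'a set" where
  "colour_component c k V x = {(a, b). a \<in> V \<and> b \<in> V \<and> a \<noteq> b \<and> c a b = k}\<^sup>* `` {x}"

lemma colour_component_refl: "x \<in> colour_component c k V x"
  by (simp add: colour_component_def)

lemma colour_component_subset:
  assumes "x \<in> V" "S \<subseteq> V" "x \<in> S" "\<And>a b. a \<in> S \<Longrightarrow> b \<in> V - S \<Longrightarrow> c a b \<noteq> k"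
  shows "colour_component c k V x \<subseteq> S"
proof
  fix y assume "y \<in> colour_component c k V x"
  then have "(x, y) \<in> {(a, b). a \<in> V \<and> b \<in> V \<and> a \<noteq> b \<and> c a b = k}\<^sup>*"
    by (simp add: colour_component_def)
  then show "y \<in> S" by induction (use assms in auto)
qed

lemma colour_component_not_crossed:
  assumes "x \<in> V" "y \<in> colour_component c k V x" "z \<in> V - colour_component c k V x"
  shows "c y z \<noteq> k"
proof
  assume "c y z = k"
  have "colour_component c k V x \<subseteq> V" by (rule colour_component_subset) (use assms in auto)
  then have "(y, z) \<in> {(a, b). a \<in> V \<and> b \<in> V \<and> a \<noteq> b \<and> c a b = k}"
    using assms \<open>c y z = k\<close> by auto
  then show False
    using assms unfolding colour_component_def by (meson DiffD2 Image_singleton_iff rtrancl.rtrancl_into_rtrancl)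
qed

text \<open>
  Along an edge of colour \<open>k\<close> inside the component, the colour seen from \<open>z\<close> cannot change, since the two edges
  to \<open>z\<close> do not have colour \<open>k\<close> and a change would make the triangle rainbow.
\<close>
lemma colour_component_uniform:
  assumes "rainbow_free c V" "x \<in> V" "y \<in> colour_component c k V x"
    and z: "z \<in> V - colour_component c k V x"
  shows "c z y = c z x"
proof -
  have "(x, y) \<in> {(a, b). a \<in> V \<and> b \<in> V \<and> a \<noteq> b \<and> c a b = k}\<^sup>*"
    using assms by (simp add: colour_component_def)
  then show ?thesis
  proof induction
    case base
    show ?case ..
  next
    case (step a b)
    have a: "a \<in> colour_component c k V x" using step by (simp add: colour_component_def)
    have b: "b \<in> colour_component c k V x"
      unfolding colour_component_def using step by (meson Image_singleton_iff rtrancl.rtrancl_into_rtrancl)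
    have "c a z \<noteq> k" "c b z \<noteq> k"
      using colour_component_not_crossed[OF assms(2) _ z] a b by auto
    moreover have "a \<noteq> z" "b \<noteq> z" using a b z by auto
    moreover have "c a b = c b z \<or> c b z = c a z \<or> c a b = c a z"
      using rainbow_freeD[OF assms(1), of a b z] z step calculation by auto
    moreover have "c a z = c z a" "c b z = c z b"
      using assms(1) z step unfolding rainbow_free_def by auto
    ultimately show ?case using step by auto
  qed
qed

text \<open>
  Suppose that deleting \<open>v\<close> disconnects colour \<open>p\<close>. Then every \<open>p\<close>-component of the rest is joined to \<open>v\<close> by
  an edge of colour \<open>p\<close>. If \<open>v\<close> is joined to \<open>x\<close> by colour \<open>q\<close>, rainbow-freeness forces colour \<open>q\<close> between \<open>x\<close>
  and the \<open>p\<close>-neighbours of \<open>v\<close> in the other components; likewise for a neighbour \<open>x'\<close> by colour \<open>r\<close>.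
  As all edges from a vertex to another component have the same colour, these two demands collide.
\<close>
lemma colour_disconnected_after_deletion:
  assumes rf: "rainbow_free c (insert v V)" and v: "v \<notin> V"
    and "p \<noteq> q" "p \<noteq> r" "q \<noteq> r"
    and cp: "cut_connected c p (insert v V)" and cq: "cut_connected c q (insert v V)"
    and cr: "cut_connected c r (insert v V)"
  shows "cut_connected c p V"
proof (rule ccontr)
  assume "\<not> cut_connected c p V"
  then obtain S where S: "S \<subseteq> V" "S \<noteq> {}" "S \<noteq> V" "\<And>x y. x \<in> S \<Longrightarrow> y \<in> V - S \<Longrightarrow> c x y \<noteq> p"
    unfolding cut_connected_def by blast
  define C where "C = colour_component c p V"
  have rfV: "rainbow_free c V" using rf unfolding rainbow_free_def by auto
  have sym: "c x y = c y x" if "x \<in> insert v V" "y \<in> insert v V" for x y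
    using rf that unfolding rainbow_free_def by blast
  have self: "x \<in> C x" for x by (simp add: C_def colour_component_refl)
  have CV: "C x \<subseteq> V" if "x \<in> V" for x
    unfolding C_def by (rule colour_component_subset) (use that in auto)
  have proper: "C x \<noteq> V" if x: "x \<in> V" for x
  proof (cases "x \<in> S")
    case True
    have "C x \<subseteq> S" unfolding C_def by (rule colour_component_subset) (use x True S in auto)
    then show ?thesis using S by auto
  next
    case False
    have "C x \<subseteq> V - S" unfolding C_def
    proof (rule colour_component_subset)
      show "c a b \<noteq> p" if "a \<in> V - S" "b \<in> V - (V - S)" for a b
      proof -
        have "b \<in> S" "a \<in> V - S" using that by auto
        moreover have "c a b = c b a" using sym that by auto
        ultimately show ?thesis using S(4)[of b a] by simp
      qed
    qed (use x False in auto)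
    then show ?thesis using S by auto
  qed
  have attached: "\<exists>y\<in>C x. c v y = p" if x: "x \<in> V" for x
  proof -
    have "C x \<subseteq> insert v V" "C x \<noteq> {}" "C x \<noteq> insert v V" using CV[OF x] self v by blast+
    then obtain y w where yw: "y \<in> C x" "w \<in> insert v V - C x" "c y w = p"
      using cp unfolding cut_connected_def by meson
    have "w = v"
      using colour_component_not_crossed[OF x, of y c p w] yw by (auto simp: C_def)
    then have "c v y = p" using yw sym[of v y] CV[OF x] by auto
    then show ?thesis using yw by blast
  qed
  have "\<exists>x\<in>V. c v x = k" if "cut_connected c k (insert v V)" for k
  proof -
    have "{v} \<noteq> insert v V" using S v by auto
    then have "\<exists>x\<in>{v}. \<exists>y\<in>insert v V - {v}. c x y = k"
      using that unfolding cut_connected_def by auto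
    then show ?thesis by auto
  qed
  then obtain x x' where x: "x \<in> V" "c v x = q" and x': "x' \<in> V" "c v x' = r"
    using cq cr by metis
  \<comment> \<open>the triangle \<open>v\<close>, \<open>a\<close>, \<open>y\<close> has the colours \<open>k\<close> and \<open>p\<close>, and its third edge does not have colour \<open>p\<close>\<close>
  have forced: "c a y = k" if "a \<in> V" "c v a = k" "y \<in> V" "y \<notin> C a" "c v y = p" "k \<noteq> p" for a y k
  proof -
    have "a \<noteq> y" using that by auto
    then have "c v a = c a y \<or> c a y = c v y \<or> c v a = c v y"
      using rainbow_freeD[OF rf, of v a y] that v by auto
    moreover have "c a y \<noteq> p"
      using colour_component_not_crossed[of a V a c p y] that self by (auto simp: C_def)
    ultimately show ?thesis using that by auto
  qed
  have uniform: "c z y = c z a" if "a \<in> V" "y \<in> C a" "z \<in> V" "z \<notin> C a" for a y z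
    using colour_component_uniform[OF rfV, of a y p z] that by (simp add: C_def)
  show False
  proof (cases "x' \<in> C x")
    case True
    obtain z where z: "z \<in> V" "z \<notin> C x" using proper[OF x(1)] CV[OF x(1)] by auto
    obtain y where y: "y \<in> C z" "c v y = p" using attached[OF z(1)] by blast
    have yV: "y \<in> V" using CV z y by blast
    have yx: "y \<notin> C x"
    proof
      assume "y \<in> C x"
      have "C z \<subseteq> V - C x" unfolding C_def
      proof (rule colour_component_subset)
        show "c a b \<noteq> p" if "a \<in> V - colour_component c p V x"
          "b \<in> V - (V - colour_component c p V x)" for a b
          using colour_component_not_crossed[OF x(1), of b c p a] that sym[of a b] by auto
      qed (use z C_def in auto)
      then show False using y \<open>y \<in> C x\<close> by auto
    qed
    have "x' \<in> V" "c x' y \<noteq> p"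
      using x' True colour_component_not_crossed[OF x(1), of x' c p y] yx yV by (auto simp: C_def)
    moreover have "x' \<noteq> y" "v \<noteq> x'" "v \<noteq> y" using True yx x' yV v by auto
    ultimately have "c x' y = r"
      using rainbow_freeD[OF rf, of v x' y] x' yV y v \<open>p \<noteq> r\<close> by auto
    moreover have "c x y = q" by (rule forced) (use x y yV yx \<open>p \<noteq> q\<close> in auto)
    moreover have "c y x' = c y x" by (rule uniform) (use x True yV yx in auto)
    ultimately show False using sym[of x y] sym[of x' y] x x' yV \<open>q \<noteq> r\<close> by simp
  next
    case False
    obtain y where y: "y \<in> C x" "c v y = p" using attached[OF x(1)] by blast
    obtain y' where y': "y' \<in> C x'" "c v y' = p" using attached[OF x'(1)] by blast
    have "C x' \<subseteq> V - C x" unfolding C_def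
    proof (rule colour_component_subset)
      show "c a b \<noteq> p" if "a \<in> V - colour_component c p V x"
        "b \<in> V - (V - colour_component c p V x)" for a b
        using colour_component_not_crossed[OF x(1), of b c p a] that sym[of a b] by auto
    qed (use x' False C_def in auto)
    then have disj: "y' \<in> V" "y' \<notin> C x" "y \<notin> C x'" "y \<in> V" "x \<notin> C x'"
      using y y' CV[OF x(1)] self[of x] by auto
    have "c x y' = q" by (rule forced) (use x y' disj \<open>p \<noteq> q\<close> in auto)
    moreover have "c x' y = r" by (rule forced) (use x' y disj \<open>p \<noteq> r\<close> in auto)
    moreover have "c y' y = c y' x" by (rule uniform) (use x y disj in auto)
    moreover have "c y y' = c y x'" by (rule uniform) (use x' y' disj in auto)
    ultimately show False
      using sym[of y y'] sym[of x y'] sym[of x' y] x x' disj \<open>q \<noteq> r\<close> by auto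
  qed
qed

text \<open>
  Gallai's theorem. By induction some colour is disconnected after the deletion of a vertex, and
  \<open>colour_disconnected_after_deletion\<close> rules out that all three were connected before.
\<close>
theorem rainbow_free_colour_disconnected:
  assumes "finite V" "card V \<ge> 2" "rainbow_free c V" "p \<noteq> q" "p \<noteq> r" "q \<noteq> r"
  shows "\<not> (cut_connected c p V \<and> cut_connected c q V \<and> cut_connected c r V)"
  using assms(1-3)
proof (induction V rule: finite_induct)
  case empty
  then show ?case by simp
next
  case (insert v V)
  have rf: "rainbow_free c V" using insert.prems unfolding rainbow_free_def by auto
  show ?case
  proof (cases "card V \<ge> 2")
    case True
    then have "\<not> (cut_connected c p V \<and> cut_connected c q V \<and> cut_connected c r V)"
      using insert.IH rf by blast
    then show ?thesis
      using colour_disconnected_after_deletion[OF insert.prems(2) insert.hyps(2)] assms(4-6) by metis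
  next
    case False
    then have "card V = 1" using insert by auto
    then obtain x where V: "V = {x}" using card_1_singletonE by blast
    have "{v} \<noteq> insert v V" "insert v V - {v} = {x}" using V insert.hyps(2) by auto
    have "c v x = k" if "cut_connected c k (insert v V)" for k
    proof -
      have "\<exists>a\<in>{v}. \<exists>b\<in>insert v V - {v}. c a b = k"
        using that \<open>{v} \<noteq> insert v V\<close> unfolding cut_connected_def by auto
      then show ?thesis using \<open>insert v V - {v} = {x}\<close> by auto
    qed
    then show ?thesis using assms(4) by blast
  qed
qed

definition graph_module :: "'a set \<Rightarrow> 'a rel \<Rightarrow> 'a set \<Rightarrow> bool" where
  "graph_module V E M \<longleftrightarrow>
     M \<subseteq> V \<and> (\<forall>z\<in>V - M. \<forall>x\<in>M. \<forall>y\<in>M. (z, x) \<in> E \<longleftrightarrow> (z, y) \<in> E)"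

text \<open>
  The components of the colours ``both orders agree'' and ``the orders disagree'' are modules of the graph by
  \<open>colour_component_uniform\<close>. Both colours occur: otherwise the two orders would be dual or equal.
\<close>
lemma two_orientations_module:
  assumes fin: "finite V"
    and conn: "\<And>S. S \<subseteq> V \<Longrightarrow> S \<noteq> {} \<Longrightarrow> S \<noteq> V \<Longrightarrow> \<exists>x\<in>S. \<exists>y\<in>V - S. (x, y) \<in> E"
    and E: "sym E"
    and P: "Partial_order P" "Field P = V" and Q: "Partial_order Q" "Field Q = V"
    and compP: "\<And>x y. x \<in> V \<Longrightarrow> y \<in> V \<Longrightarrow> x \<noteq> y \<Longrightarrow> (x, y) \<in> P \<or> (y, x) \<in> P \<longleftrightarrow> (x, y) \<notin> E"
    and compQ: "\<And>x y. x \<in> V \<Longrightarrow> y \<in> V \<Longrightarrow> x \<noteq> y \<Longrightarrow> (x, y) \<in> Q \<or> (y, x) \<in> Q \<longleftrightarrow> (x, y) \<notin> E"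
    and ne: "P \<noteq> Q" "P \<noteq> Q\<inverse>"
  obtains M x y where "graph_module V E M" "M \<noteq> V" "x \<in> M" "y \<in> M" "x \<noteq> y" "(x, y) \<notin> E"
proof -
  have transP: "trans P" and antiP: "antisym P" and reflP: "refl_on V P"
    and transQ: "trans Q" and antiQ: "antisym Q" and reflQ: "refl_on V Q"
    using P Q by (auto simp: partial_order_on_def preorder_on_def)
  have PV: "P \<subseteq> V \<times> V" and QV: "Q \<subseteq> V \<times> V" using P Q by (auto intro: FieldI1 FieldI2)
  define agree where "agree x y \<longleftrightarrow> (x, y) \<in> P \<inter> Q \<or> (y, x) \<in> P \<inter> Q" for x y
  define c :: "'a \<Rightarrow> 'a \<Rightarrow> nat"
    where "c x y = (if (x, y) \<in> E then 0 else if agree x y then 1 else 2)" for x y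
  have c_sym: "c x y = c y x" for x y
    using E by (auto simp: c_def agree_def sym_def)
  \<comment> \<open>if \<open>x\<close> and \<open>z\<close> are incomparable, then in both orders \<open>y\<close> lies above both of them or below both\<close>
  have key: "c x z \<noteq> 0"
    if "x \<in> V" "y \<in> V" "z \<in> V" "x \<noteq> y" "y \<noteq> z" "x \<noteq> z" "c x y = 1" "c y z = 2" for x y z
  proof
    assume "c x z = 0"
    then have "(x, z) \<in> E" by (auto simp: c_def split: if_splits)
    then have no: "(x, z) \<notin> P" "(z, x) \<notin> P" "(x, z) \<notin> Q" "(z, x) \<notin> Q"
      using compP[of x z] compQ[of x z] that by auto
    have xy: "agree x y" and yz: "(y, z) \<notin> E" "\<not> agree y z"
      using that by (auto simp: c_def split: if_splits)
    have "(y, z) \<in> P \<or> (z, y) \<in> P" "(y, z) \<in> Q \<or> (z, y) \<in> Q"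
      using compP[of y z] compQ[of y z] that yz by auto
    then show False
      using xy yz(2) no transD[OF transP] transD[OF transQ] unfolding agree_def by blast
  qed
  have c3: "c x y \<in> {0, 1, 2}" for x y by (auto simp: c_def)
  have rf: "rainbow_free c V"
    unfolding rainbow_free_def
  proof (intro conjI ballI impI)
    show "c x y = c y x" for x y by (rule c_sym)
    fix x y z assume xyz: "x \<in> V" "y \<in> V" "z \<in> V" "x \<noteq> y" "y \<noteq> z" "x \<noteq> z"
    show "c x y = c y z \<or> c y z = c x z \<or> c x y = c x z"
    proof -
      have "c x y = 1 \<Longrightarrow> c y z = 2 \<Longrightarrow> c x z \<noteq> 0" using key[of x y z] xyz by simp
      moreover have "c y z = 1 \<Longrightarrow> c x y = 2 \<Longrightarrow> c x z \<noteq> 0"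
        using key[of z y x] xyz c_sym[of x y] c_sym[of y z] c_sym[of x z] by simp
      moreover have "c x y = 1 \<Longrightarrow> c x z = 2 \<Longrightarrow> c y z \<noteq> 0"
        using key[of y x z] xyz c_sym[of x y] by simp
      moreover have "c x z = 1 \<Longrightarrow> c x y = 2 \<Longrightarrow> c y z \<noteq> 0"
        using key[of z x y] xyz c_sym[of y z] c_sym[of x z] by simp
      moreover have "c x z = 1 \<Longrightarrow> c y z = 2 \<Longrightarrow> c x y \<noteq> 0"
        using key[of x z y] xyz c_sym[of y z] by simp
      moreover have "c y z = 1 \<Longrightarrow> c x z = 2 \<Longrightarrow> c x y \<noteq> 0"
        using key[of y z x] xyz c_sym[of x y] c_sym[of x z] by simp
      moreover have "c x y = 0 \<or> c x y = 1 \<or> c x y = 2" "c y z = 0 \<or> c y z = 1 \<or> c y z = 2"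
        "c x z = 0 \<or> c x z = 1 \<or> c x z = 2" using c3 by auto
      ultimately show ?thesis by presburger
    qed
  qed
  have ex1: "\<exists>x\<in>V. \<exists>y\<in>V. x \<noteq> y \<and> c x y = 1"
  proof (rule ccontr)
    assume "\<not> ?thesis"
    then have no: "c x y \<noteq> 1" if "x \<in> V" "y \<in> V" "x \<noteq> y" for x y using that by blast
    have "(x, y) \<in> P \<longleftrightarrow> (x, y) \<in> Q\<inverse>" for x y
    proof (cases "x \<in> V \<and> y \<in> V")
      case True
      show ?thesis
      proof (cases "x = y")
        case True
        then show ?thesis using \<open>x \<in> V \<and> y \<in> V\<close> reflP reflQ by (auto simp: refl_on_def)
      next
        case False
        then have "c x y \<noteq> 1" using no True by blast
        then show ?thesis
          using compP[of x y] compQ[of x y] True False antisymD[OF antiP] antisymD[OF antiQ]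
          by (auto simp: c_def agree_def split: if_splits)
      qed
    next
      case False
      then show ?thesis using PV QV by auto
    qed
    then show False using ne by auto
  qed
  have ex2: "\<exists>x\<in>V. \<exists>y\<in>V. x \<noteq> y \<and> c x y = 2"
  proof (rule ccontr)
    assume "\<not> ?thesis"
    then have no: "c x y \<noteq> 2" if "x \<in> V" "y \<in> V" "x \<noteq> y" for x y using that by blast
    have "(x, y) \<in> P \<longleftrightarrow> (x, y) \<in> Q" for x y
    proof (cases "x \<in> V \<and> y \<in> V")
      case True
      show ?thesis
      proof (cases "x = y")
        case True
        then show ?thesis using \<open>x \<in> V \<and> y \<in> V\<close> reflP reflQ by (auto simp: refl_on_def)
      next
        case False
        then have "c x y \<noteq> 2" using no True by blast
        then show ?thesis
          using compP[of x y] compQ[of x y] True False antisymD[OF antiP] antisymD[OF antiQ]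
          by (auto simp: c_def agree_def split: if_splits)
      qed
    next
      case False
      then show ?thesis using PV QV by auto
    qed
    then show False using ne by auto
  qed
  have "cut_connected c 0 V"
    unfolding cut_connected_def c_def using conn by (metis (full_types))
  moreover have "card V \<ge> 2"
  proof -
    obtain x y where "x \<in> V" "y \<in> V" "x \<noteq> y" using ex1 by blast
    then show ?thesis using card_mono[OF fin, of "{x, y}"] by auto
  qed
  ultimately obtain k where k: "k = 1 \<or> k = 2" "\<not> cut_connected c k V"
    using rainbow_free_colour_disconnected[OF fin _ rf, of 0 1 2] by auto
  then obtain x y where xy: "x \<in> V" "y \<in> V" "x \<noteq> y" "c x y = k" using ex1 ex2 by blast
  define C where "C = colour_component c k V x"
  have CV: "C \<subseteq> V" unfolding C_def by (rule colour_component_subset) (use xy in auto)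
  obtain S where S: "S \<subseteq> V" "S \<noteq> {}" "S \<noteq> V" "\<And>x y. x \<in> S \<Longrightarrow> y \<in> V - S \<Longrightarrow> c x y \<noteq> k"
    using k unfolding cut_connected_def by blast
  have "C \<noteq> V"
  proof (cases "x \<in> S")
    case True
    have "C \<subseteq> S" unfolding C_def by (rule colour_component_subset) (use xy True S in auto)
    then show ?thesis using S by auto
  next
    case False
    have "C \<subseteq> V - S" unfolding C_def
    proof (rule colour_component_subset)
      show "c a b \<noteq> k" if "a \<in> V - S" "b \<in> V - (V - S)" for a b
        using S(4)[of b a] c_sym[of a b] that by auto
    qed (use xy False in auto)
    then show ?thesis using S by auto
  qed
  moreover have "graph_module V E C"
    unfolding graph_module_def
  proof (intro conjI CV ballI)
    fix z a b assume "z \<in> V - C" "a \<in> C" "b \<in> C"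
    then have "c z a = c z b"
      using colour_component_uniform[OF rf xy(1)] unfolding C_def by metis
    then show "(z, a) \<in> E \<longleftrightarrow> (z, b) \<in> E" by (auto simp: c_def split: if_splits)
  qed
  moreover have "x \<in> C" by (simp add: C_def colour_component_refl)
  moreover have "y \<in> C"
    unfolding C_def colour_component_def using xy by blast
  moreover have "(x, y) \<notin> E" using k xy by (auto simp: c_def split: if_splits)
  ultimately show thesis using that xy by blast
qed

definition independent_set :: "'a set \<Rightarrow> 'a rel \<Rightarrow> 'a set \<Rightarrow> bool" where
  "independent_set V E A \<longleftrightarrow> A \<subseteq> V \<and> (\<forall>u\<in>A. \<forall>v\<in>A. (u, v) \<notin> E)"

text \<open>
  The vertices of the link of the face \<open>A\<close> in the independence complex.
\<close>
definition link_vertices :: "'a set \<Rightarrow> 'a rel \<Rightarrow> 'a set \<Rightarrow> 'a set" where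
  "link_vertices V E A = {v \<in> V - A. \<forall>a\<in>A. (a, v) \<notin> E}"

text \<open>
  Maximality of \<open>A\<close> among the independent sets away from \<open>M\<close> and its neighbours that still leave some
  neighbour \<open>z\<close> of \<open>M\<close> in the link: another vertex \<open>v\<close> of the link that is not adjacent to such a \<open>z\<close> could be added to \<open>A\<close>,
  unless \<open>v\<close> lies in \<open>M\<close>, where it is adjacent to \<open>z\<close> anyway.
\<close>
lemma module_disconnects_link:
  assumes fin: "finite V" and E: "sym E" "irrefl E"
    and M: "graph_module V E M" "x \<in> M"
    and w: "w \<in> V - M" "(w, x) \<in> E"
  obtains A W1 W2 where "independent_set V E A" "link_vertices V E A = W1 \<union> W2"
    "W1 \<noteq> {}" "M \<subseteq> W2" "W1 \<times> W2 \<subseteq> E"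
proof -
  define N where "N = {z \<in> V - M. (z, x) \<in> E}"
  have MV: "M \<subseteq> V" using M by (simp add: graph_module_def)
  have N_adj: "(z, y) \<in> E" if "z \<in> N" "y \<in> M" for z y
    using that M unfolding graph_module_def N_def by blast
  have nonadj: "(z, y) \<notin> E" if "z \<in> V - M - N" "y \<in> M" for z y
    using that M unfolding graph_module_def N_def by blast
  \<comment> \<open>the empty set is a member, with \<open>w\<close> as the remaining neighbour\<close>
  define \<A> where "\<A> = {A. independent_set V E A \<and> A \<subseteq> V - M - N \<and> (\<exists>z\<in>N. \<forall>a\<in>A. (a, z) \<notin> E)}"
  have "finite \<A>" by (rule finite_subset[of _ "Pow V"]) (use fin in \<open>auto simp: \<A>_def\<close>)
  moreover have "{} \<in> \<A>" using w by (auto simp: \<A>_def N_def independent_set_def)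
  ultimately obtain A where A: "A \<in> \<A>" "\<forall>B\<in>\<A>. A \<subseteq> B \<longrightarrow> A = B"
    using finite_has_maximal[of \<A>] by blast
  define W1 where "W1 = link_vertices V E A \<inter> N"
  define W2 where "W2 = link_vertices V E A - N"
  have ind: "independent_set V E A" and AR: "A \<subseteq> V - M - N" and ex: "\<exists>z\<in>N. \<forall>a\<in>A. (a, z) \<notin> E"
    using A by (auto simp: \<A>_def)
  have "W1 \<noteq> {}" using ex AR by (auto simp: W1_def link_vertices_def N_def)
  moreover have "M \<subseteq> W2"
  proof
    fix y assume y: "y \<in> M"
    then have "y \<notin> A" "y \<notin> N" using AR by (auto simp: N_def)
    moreover have "(a, y) \<notin> E" if "a \<in> A" for a using nonadj[of a y] AR that y by blast
    ultimately show "y \<in> W2" using y MV by (auto simp: W2_def link_vertices_def)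
  qed
  moreover have "(z, v) \<in> E" if z: "z \<in> W1" and v: "v \<in> W2" for z v
  proof (rule ccontr)
    assume zv: "(z, v) \<notin> E"
    then have "v \<notin> M" using N_adj z by (auto simp: W1_def)
    have v': "v \<in> V - M - N" "(v, v) \<notin> E" "\<And>a. a \<in> A \<Longrightarrow> (a, v) \<notin> E"
      using v \<open>v \<notin> M\<close> E(2) by (auto simp: W2_def link_vertices_def irrefl_def)
    then have v'': "\<And>a. a \<in> A \<Longrightarrow> (v, a) \<notin> E" using E(1) by (meson symD)
    have "independent_set V E (insert v A)"
      using ind v' v'' unfolding independent_set_def by blast
    moreover have "z \<in> N" "\<forall>a\<in>insert v A. (a, z) \<notin> E"
      using z zv E(1) by (auto simp: W1_def link_vertices_def dest: symD)
    ultimately have "insert v A \<in> \<A>" using AR v'(1) unfolding \<A>_def by blast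
    then have "v \<in> A" using A(2) by blast
    then show False using v by (simp add: W2_def link_vertices_def)
  qed
  ultimately show thesis
    using that[of A W1 W2] ind by (auto simp: W1_def W2_def)
qed

section \<open>Edge rings over the field with two elements\<close>

text \<open>
  Polynomials over the field with two elements in countably many indeterminates. They form an integral
  domain, in which distinct monomials are linearly independent; prime ideals of edge rings arise below
  as kernels of homomorphisms into this ring.
\<close>
type_synonym f2_poly = "(nat \<Rightarrow>\<^sub>0 nat) \<Rightarrow>\<^sub>0 bit"

lemma f2_poly_add_self: "(p :: f2_poly) + p = 0"
  by (rule poly_mapping_eqI, subst lookup_add) simp

lemma f2_poly_add_eq_0_iff: "(p :: f2_poly) + q = 0 \<longleftrightarrow> p = q"
  by (metis add_right_cancel f2_poly_add_self)

definition exponent :: "'v set \<Rightarrow> 'v multiset \<Rightarrow> nat \<Rightarrow>\<^sub>0 nat" where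
  "exponent V m = (\<Sum>v\<in>#m. Poly_Mapping.single (to_nat_on V v) 1)"

definition indeterminate :: "'v set \<Rightarrow> 'v \<Rightarrow> f2_poly" where
  "indeterminate V v = Poly_Mapping.single (exponent V {#v#}) 1"

lemma lookup_exponent:
  assumes "finite V" "set_mset m \<subseteq> V" "v \<in> V"
  shows "Poly_Mapping.lookup (exponent V m) (to_nat_on V v) = count m v"
  using assms(2)
proof (induction m)
  case empty
  show ?case by (simp add: exponent_def)
next
  case (add u m)
  have "to_nat_on V u = to_nat_on V v \<longleftrightarrow> u = v"
    using inj_on_to_nat_on[OF countable_finite[OF assms(1)]] add.prems assms(3)
    by (auto simp: inj_on_def)
  then show ?case using add by (simp add: exponent_def lookup_add lookup_single when_def)
qed

lemma exponent_inject:
  assumes "finite V" "set_mset m \<subseteq> V" "set_mset n \<subseteq> V"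
  shows "exponent V m = exponent V n \<longleftrightarrow> m = n"
proof
  assume eq: "exponent V m = exponent V n"
  show "m = n"
  proof (rule multiset_eqI)
    fix v
    show "count m v = count n v"
    proof (cases "v \<in> V")
      case True
      then show ?thesis using lookup_exponent[OF assms(1)] assms eq by metis
    next
      case False
      then show ?thesis using assms by (metis count_eq_zero_iff subsetD)
    qed
  qed
qed simp

lemma prod_indeterminate:
  "(\<Prod>v\<in>#m. indeterminate V v) = Poly_Mapping.single (exponent V m) 1"
  by (induction m) (simp_all add: indeterminate_def exponent_def mult_single)

text \<open>
  The generic point of the face \<open>F\<close>, specialised to \<open>1\<close> on the variables in \<open>B\<close>.
\<close>
definition evaluation_point :: "'v set \<Rightarrow> 'v set \<Rightarrow> 'v set \<Rightarrow> 'v \<Rightarrow> f2_poly" where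
  "evaluation_point V F B v = (if v \<notin> F then 0 else if v \<in> B then 1 else indeterminate V v)"

text \<open>
  An axiomatic description of the edge ring over the field with two elements: it is generated by the
  variables, and every assignment of polynomials to the vertices that respects the edge relations extends to
  a homomorphism \<open>ev \<alpha>\<close>. In this way no argument about edge rings has to refer to cosets of polynomials.
\<close>
locale edge_ring = cring R for R (structure) +
  fixes V :: "'v set" and E :: "'v rel" and mon :: "'v multiset \<Rightarrow> 'a"
    and ev :: "('v \<Rightarrow> f2_poly) \<Rightarrow> 'a \<Rightarrow> f2_poly"
  assumes finite_V: "finite V" and sym_E: "sym E" and irrefl_E: "irrefl E" and E_sub: "E \<subseteq> V \<times> V"
    and mon_closed: "\<And>m. set_mset m \<subseteq> V \<Longrightarrow> mon m \<in> carrier R"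
    and mon_empty: "mon {#} = \<one>"
    and mon_add: "\<And>m n. set_mset m \<subseteq> V \<Longrightarrow> set_mset n \<subseteq> V \<Longrightarrow> mon (m + n) = mon m \<otimes> mon n"
    and mon_edge: "\<And>u v. (u, v) \<in> E \<Longrightarrow> mon {#u, v#} = \<zero>"
    and char_2: "\<one> \<oplus> \<one> = \<zero>"
    and generated: "\<And>A. A \<subseteq> carrier R \<Longrightarrow> \<zero> \<in> A \<Longrightarrow> \<one> \<in> A \<Longrightarrow>
        (\<And>a b. a \<in> A \<Longrightarrow> b \<in> A \<Longrightarrow> a \<oplus> b \<in> A) \<Longrightarrow>
        (\<And>a v. a \<in> A \<Longrightarrow> v \<in> V \<Longrightarrow> a \<otimes> mon {#v#} \<in> A) \<Longrightarrow> A = carrier R"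
    and ev_one: "\<And>\<alpha>. \<forall>(u, v)\<in>E. \<alpha> u * \<alpha> v = 0 \<Longrightarrow> ev \<alpha> \<one> = 1"
    and ev_add: "\<And>\<alpha> a b. \<forall>(u, v)\<in>E. \<alpha> u * \<alpha> v = 0 \<Longrightarrow> a \<in> carrier R \<Longrightarrow> b \<in> carrier R \<Longrightarrow>
        ev \<alpha> (a \<oplus> b) = ev \<alpha> a + ev \<alpha> b"
    and ev_mult: "\<And>\<alpha> a b. \<forall>(u, v)\<in>E. \<alpha> u * \<alpha> v = 0 \<Longrightarrow> a \<in> carrier R \<Longrightarrow> b \<in> carrier R \<Longrightarrow>
        ev \<alpha> (a \<otimes> b) = ev \<alpha> a * ev \<alpha> b"
    and ev_var: "\<And>\<alpha> v. \<forall>(u, v)\<in>E. \<alpha> u * \<alpha> v = 0 \<Longrightarrow> v \<in> V \<Longrightarrow> ev \<alpha> (mon {#v#}) = \<alpha> v"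
begin

abbreviation gen :: "'v \<Rightarrow> 'a" where "gen v \<equiv> mon {#v#}"

abbreviation indep :: "'v set \<Rightarrow> bool" where "indep \<equiv> independent_set V E"

lemma gen_closed: "v \<in> V \<Longrightarrow> gen v \<in> carrier R"
  by (rule mon_closed) simp

lemma mon_add_mset: "v \<in> V \<Longrightarrow> set_mset m \<subseteq> V \<Longrightarrow> mon (add_mset v m) = gen v \<otimes> mon m"
  using mon_add[of "{#v#}" m] by simp

lemma gen_edge: "(u, v) \<in> E \<Longrightarrow> gen u \<otimes> gen v = \<zero>"
  using mon_edge[of u v] mon_add_mset[of u "{#v#}"] E_sub by auto

lemma add_self: "a \<in> carrier R \<Longrightarrow> a \<oplus> a = \<zero>"
proof -
  assume a: "a \<in> carrier R"
  have "a \<oplus> a = a \<otimes> (\<one> \<oplus> \<one>)" using a by (simp add: r_distr)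
  then show ?thesis using a by (simp add: char_2)
qed

lemma add_self_cancel:
  assumes "a \<in> carrier R" "b \<in> carrier R"
  shows "a \<oplus> (a \<oplus> b) = b"
  using assms a_assoc[of a a b] add_self by simp

lemma finsum_add_sym_diff:
  assumes "finite S" "finite T" "f \<in> S \<union> T \<rightarrow> carrier R"
  shows "finsum R f S \<oplus> finsum R f T = finsum R f ((S - T) \<union> (T - S))"
proof -
  have split: "finsum R f S' = finsum R f (S' - T') \<oplus> finsum R f (S' \<inter> T')"
    if "finite S'" "f \<in> S' \<rightarrow> carrier R" for S' T'
  proof -
    have "S' = (S' - T') \<union> (S' \<inter> T')" by auto
    then show ?thesis using that finsum_Un_disjoint[of "S' - T'" "S' \<inter> T'" f] by (auto simp: Pi_iff)
  qed
  have c: "finsum R f (S - T) \<in> carrier R" "finsum R f (T - S) \<in> carrier R" "finsum R f (S \<inter> T) \<in> carrier R"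
    using assms(3) by (auto intro!: finsum_closed)
  have "finsum R f S \<oplus> finsum R f T
      = (finsum R f (S - T) \<oplus> finsum R f (S \<inter> T)) \<oplus> (finsum R f (T - S) \<oplus> finsum R f (S \<inter> T))"
    using split[of S T] split[of T S] assms by (auto simp: Int_commute)
  also have "\<dots> = (finsum R f (S - T) \<oplus> finsum R f (T - S)) \<oplus> (finsum R f (S \<inter> T) \<oplus> finsum R f (S \<inter> T))"
    using c by algebra
  also have "\<dots> = finsum R f (S - T) \<oplus> finsum R f (T - S)" using c add_self by simp
  also have "\<dots> = finsum R f ((S - T) \<union> (T - S))"
    using assms by (intro finsum_Un_disjoint[symmetric]) auto
  finally show ?thesis .
qed

lemma finsum_mem_ideal:
  assumes "ideal J R" "finite S" "\<And>s. s \<in> S \<Longrightarrow> f s \<in> J"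
  shows "finsum R f S \<in> J"
proof -
  interpret ideal J R by fact
  show ?thesis using assms(2,3)
  proof (induction S rule: finite_induct)
    case (insert s S)
    then have "f \<in> S \<rightarrow> carrier R" "f s \<in> carrier R" using Icarr by auto
    then show ?case using insert by (simp add: finsum_insert)
  qed simp
qed

text \<open>
  Modulo an ideal that identifies the variables in \<open>B\<close> with \<open>1\<close>, every element is a sum of distinct
  monomials without these variables that do not lie in the ideal. Sums with coefficients in a two-element
  field are just finite sets, and addition is the symmetric difference.
\<close>
lemma normal_form:
  assumes J: "ideal J R" and B: "B \<subseteq> V" "\<And>b. b \<in> B \<Longrightarrow> gen b \<oplus> \<one> \<in> J" and r: "r \<in> carrier R"
  obtains U where "finite U" "\<And>m. m \<in> U \<Longrightarrow> set_mset m \<subseteq> V - B" "\<And>m. m \<in> U \<Longrightarrow> mon m \<notin> J"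
    "r \<oplus> finsum R mon U \<in> J"
proof -
  interpret J: ideal J R by fact
  define mons where "mons U \<longleftrightarrow> finite U \<and> (\<forall>m\<in>U. set_mset m \<subseteq> V - B \<and> mon m \<notin> J)" for U
  have mons_carr: "mon \<in> U \<rightarrow> carrier R" if "\<forall>m\<in>U. set_mset m \<subseteq> V - B" for U
    using that by (auto intro!: mon_closed)
  define A where "A = {r \<in> carrier R. \<exists>U. mons U \<and> r \<oplus> finsum R mon U \<in> J}"
  have "A = carrier R"
  proof (rule generated)
    show "A \<subseteq> carrier R" by (auto simp: A_def)
    show "\<zero> \<in> A" by (auto simp: A_def mons_def intro!: exI[of _ "{}"])
    show "\<one> \<in> A"
    proof (cases "\<one> \<in> J")
      case True
      then show ?thesis by (auto simp: A_def mons_def intro!: exI[of _ "{}"])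
    next
      case False
      then have "mons {{#}}" by (simp add: mons_def mon_empty)
      moreover have "\<one> \<oplus> finsum R mon {{#}} \<in> J"
        using finsum_insert[of "{}" "{#}" mon] by (simp add: mon_empty char_2)
      ultimately show ?thesis unfolding A_def by blast
    qed
  next
    fix a b assume "a \<in> A" "b \<in> A"
    then obtain S T where a: "a \<in> carrier R" "mons S" "a \<oplus> finsum R mon S \<in> J"
      and b: "b \<in> carrier R" "mons T" "b \<oplus> finsum R mon T \<in> J" by (auto simp: A_def)
    have c: "mon \<in> S \<union> T \<rightarrow> carrier R" by (rule mons_carr) (use a b in \<open>auto simp: mons_def\<close>)
    then have c': "finsum R mon S \<in> carrier R" "finsum R mon T \<in> carrier R"
      by (auto intro!: finsum_closed)
    have "(a \<oplus> finsum R mon S) \<oplus> (b \<oplus> finsum R mon T) \<in> J" using a b by simp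
    moreover have "(a \<oplus> finsum R mon S) \<oplus> (b \<oplus> finsum R mon T)
        = (a \<oplus> b) \<oplus> (finsum R mon S \<oplus> finsum R mon T)" using a b c' by algebra
    moreover have "finsum R mon S \<oplus> finsum R mon T = finsum R mon ((S - T) \<union> (T - S))"
      using a b c by (intro finsum_add_sym_diff) (auto simp: mons_def)
    moreover have "mons ((S - T) \<union> (T - S))" using a b by (auto simp: mons_def)
    ultimately show "a \<oplus> b \<in> A" using a b by (auto simp: A_def)
  next
    fix a v assume "a \<in> A" and v: "v \<in> V"
    then obtain S where a: "a \<in> carrier R" "mons S" "a \<oplus> finsum R mon S \<in> J" by (auto simp: A_def)
    have fin: "finite S" and S: "\<forall>m\<in>S. set_mset m \<subseteq> V - B" using a by (auto simp: mons_def)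
    note c = mons_carr[OF S]
    have c': "finsum R mon S \<in> carrier R" using c by (rule finsum_closed)
    note gv = gen_closed[OF v]
    have av: "gen v \<otimes> (a \<oplus> finsum R mon S) \<in> J" using a gv by (simp add: J.I_l_closed)
    show "a \<otimes> gen v \<in> A"
    proof (cases "v \<in> B")
      case True
      \<comment> \<open>a variable that equals \<open>1\<close> modulo \<open>J\<close> leaves the set of monomials unchanged\<close>
      have "gen v \<otimes> (a \<oplus> finsum R mon S) \<oplus> (gen v \<oplus> \<one>) \<otimes> finsum R mon S \<in> J"
        using av B(2)[OF True] c' by (simp add: J.I_r_closed)
      moreover have "gen v \<otimes> (a \<oplus> finsum R mon S) \<oplus> (gen v \<oplus> \<one>) \<otimes> finsum R mon S
          = (a \<otimes> gen v \<oplus> finsum R mon S) \<oplus> (gen v \<otimes> finsum R mon S \<oplus> gen v \<otimes> finsum R mon S)"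
        using a gv c' by algebra
      ultimately have "a \<otimes> gen v \<oplus> finsum R mon S \<in> J"
        using a gv c' add_self by simp
      then show ?thesis using a gv by (auto simp: A_def)
    next
      case False
      define S' where "S' = add_mset v ` S"
      \<comment> \<open>the monomials that vanish modulo \<open>J\<close> after multiplication by the variable\<close>
      define T where "T = {m \<in> S'. mon m \<in> J}"
      have fin': "finite S'" using fin by (simp add: S'_def)
      have S': "\<forall>m\<in>S'. set_mset m \<subseteq> V - B" using S v False by (auto simp: S'_def)
      note cS' = mons_carr[OF S']
      have cS'': "mon \<in> S' - T \<rightarrow> carrier R" "mon \<in> T \<rightarrow> carrier R"
        using cS' by (auto simp: T_def)
      note cc = cS''[THEN finsum_closed]
      have "gen v \<otimes> finsum R mon S = finsum R (\<lambda>m. gen v \<otimes> mon m) S"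
        using fin gv c by (rule finsum_rdistr)
      also have "\<dots> = finsum R (\<lambda>m. mon (add_mset v m)) S"
      proof (rule finsum_cong')
        show "gen v \<otimes> mon m = mon (add_mset v m)" if "m \<in> S" for m
          using that S v by (subst mon_add_mset) auto
        show "(\<lambda>m. mon (add_mset v m)) \<in> S \<rightarrow> carrier R" using cS' by (auto simp: S'_def)
      qed simp
      also have "\<dots> = finsum R mon S'"
        unfolding S'_def by (rule finsum_reindex[symmetric]) (use cS' in \<open>auto simp: S'_def inj_on_def\<close>)
      also have "\<dots> = finsum R mon ((S' - T) \<union> T)"
        by (rule arg_cong[where f = "finsum R mon"]) (auto simp: T_def)
      also have "\<dots> = finsum R mon (S' - T) \<oplus> finsum R mon T"
        using fin' cS'' by (intro finsum_Un_disjoint) (auto simp: T_def)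
      finally have eq: "gen v \<otimes> finsum R mon S = finsum R mon (S' - T) \<oplus> finsum R mon T" .
      have TJ: "finsum R mon T \<in> J" using fin' by (intro finsum_mem_ideal J) (auto simp: T_def)
      have "gen v \<otimes> (a \<oplus> finsum R mon S) \<oplus> finsum R mon T \<in> J" using av TJ by simp
      moreover have "gen v \<otimes> (a \<oplus> finsum R mon S) \<oplus> finsum R mon T
          = (a \<otimes> gen v \<oplus> finsum R mon (S' - T)) \<oplus> (finsum R mon T \<oplus> finsum R mon T)"
      proof -
        have "gen v \<otimes> (a \<oplus> finsum R mon S) = a \<otimes> gen v \<oplus> gen v \<otimes> finsum R mon S"
          using a gv c' by algebra
        then show ?thesis unfolding eq using a gv cc by algebra
      qed
      ultimately have "a \<otimes> gen v \<oplus> finsum R mon (S' - T) \<in> J"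
        using a gv cc add_self by simp
      moreover have "mons (S' - T)" using fin' S' by (auto simp: mons_def T_def)
      ultimately show ?thesis using a gv by (auto simp: A_def)
    qed
  qed
  then obtain U where "mons U" "r \<oplus> finsum R mon U \<in> J" using r by (auto simp: A_def)
  then show thesis using that by (auto simp: mons_def)
qed

text \<open>
  \<open>spec F B\<close> is the homomorphism to the coordinate ring of the face \<open>F\<close> with the variables in \<open>B\<close> set to \<open>1\<close>.
  For an independent set \<open>F\<close> its kernel is the prime ideal generated by the variables outside \<open>F\<close>
  and the elements \<open>x\<^sub>b - 1\<close> with \<open>b \<in> B\<close> (\<open>spec_ker_eq_Idl\<close>).
\<close>
definition spec :: "'v set \<Rightarrow> 'v set \<Rightarrow> 'a \<Rightarrow> f2_poly" where
  "spec F B = ev (evaluation_point V F B)"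

definition spec_ker :: "'v set \<Rightarrow> 'v set \<Rightarrow> 'a set" where
  "spec_ker F B = {r \<in> carrier R. spec F B r = 0}"

lemma point_admissible:
  "indep F \<Longrightarrow> \<forall>(u, v)\<in>E. evaluation_point V F B u * evaluation_point V F B v = 0"
  by (auto simp: independent_set_def evaluation_point_def)

lemma spec_one: "indep F \<Longrightarrow> spec F B \<one> = 1"
  unfolding spec_def by (intro ev_one point_admissible)

lemma spec_add: "indep F \<Longrightarrow> a \<in> carrier R \<Longrightarrow> b \<in> carrier R \<Longrightarrow> spec F B (a \<oplus> b) = spec F B a + spec F B b"
  unfolding spec_def by (intro ev_add point_admissible)

lemma spec_mult: "indep F \<Longrightarrow> a \<in> carrier R \<Longrightarrow> b \<in> carrier R \<Longrightarrow> spec F B (a \<otimes> b) = spec F B a * spec F B b"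
  unfolding spec_def by (intro ev_mult point_admissible)

lemma spec_gen: "indep F \<Longrightarrow> v \<in> V \<Longrightarrow> spec F B (gen v) = evaluation_point V F B v"
  unfolding spec_def by (intro ev_var point_admissible)

lemma spec_zero: assumes "indep F" shows "spec F B \<zero> = 0"
proof -
  have "spec F B \<zero> = spec F B \<zero> + spec F B \<zero>" using spec_add[OF assms, of \<zero> \<zero> B] by simp
  then show ?thesis by (simp only: f2_poly_add_self)
qed

lemma spec_finsum:
  assumes "indep F" "finite S" "f \<in> S \<rightarrow> carrier R"
  shows "spec F B (finsum R f S) = (\<Sum>s\<in>S. spec F B (f s))"
  using assms(2,3)
proof (induction S rule: finite_induct)
  case empty
  then show ?case by (simp add: spec_zero assms)
next
  case (insert s S)
  then show ?case by (simp add: finsum_insert spec_add assms)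
qed

lemma spec_mon:
  assumes "indep F" "set_mset m \<subseteq> V - B"
  shows "spec F B (mon m)
    = (if set_mset m \<subseteq> F then Poly_Mapping.single (exponent V m) 1 else 0)"
proof -
  have "spec F B (mon m) = (\<Prod>v\<in>#m. evaluation_point V F B v)"
    using assms(2)
  proof (induction m)
    case empty
    then show ?case by (simp add: mon_empty spec_one assms)
  next
    case (add v m)
    then have m: "v \<in> V" "set_mset m \<subseteq> V" by auto
    then have "spec F B (mon (add_mset v m)) = spec F B (gen v) * spec F B (mon m)"
      using spec_mult[OF assms(1) gen_closed[OF m(1)] mon_closed[OF m(2)], of B]
      by (simp only: mon_add_mset[OF m])
    then show ?case using add by (simp add: spec_gen assms)
  qed
  also have "\<dots> = (if set_mset m \<subseteq> F then \<Prod>v\<in>#m. indeterminate V v else 0)"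
    using assms(2) by (induction m) (auto simp: evaluation_point_def)
  finally show ?thesis by (simp add: prod_indeterminate)
qed

lemma spec_ker_ideal:
  assumes "indep F" shows "ideal (spec_ker F B) R"
proof (rule idealI)
  show "subgroup (spec_ker F B) (add_monoid R)"
  proof (rule add.subgroupI)
    show "spec_ker F B \<noteq> {}" using spec_zero[OF assms, of B] by (auto simp: spec_ker_def)
    fix a assume a: "a \<in> spec_ker F B"
    have "spec F B (\<ominus> a) = spec F B (\<ominus> a) + spec F B a" using a by (simp add: spec_ker_def)
    also have "\<dots> = spec F B (\<ominus> a \<oplus> a)" using a assms by (simp add: spec_add spec_ker_def)
    also have "\<dots> = 0" using a assms by (simp add: spec_ker_def l_neg spec_zero)
    finally show "\<ominus> a \<in> spec_ker F B" using a by (simp add: spec_ker_def)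
    fix b assume "b \<in> spec_ker F B"
    then show "a \<oplus> b \<in> spec_ker F B" using a assms by (simp add: spec_ker_def spec_add)
  qed (auto simp: spec_ker_def)
qed (use assms in \<open>auto simp: spec_ker_def spec_mult ring_axioms\<close>)

lemma spec_ker_prime:
  assumes "indep F" shows "primeideal (spec_ker F B) R"
proof (rule primeidealI)
  have "\<one> \<notin> spec_ker F B" by (simp add: spec_ker_def spec_one assms)
  then show "carrier R \<noteq> spec_ker F B" by auto
  fix a b assume "a \<in> carrier R" "b \<in> carrier R" "a \<otimes> b \<in> spec_ker F B"
  then show "a \<in> spec_ker F B \<or> b \<in> spec_ker F B" by (simp add: spec_ker_def spec_mult assms)
qed (use spec_ker_ideal[OF assms] is_cring in auto)

text \<open>
  A sum of monomials in normal form that is not empty is detected by \<open>spec F B\<close> for any face \<open>F\<close> that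
  supports one of its monomials, because the monomials supported by \<open>F\<close> have linearly independent images.
\<close>
lemma mem_ideal_by_evaluation:
  assumes J: "ideal J R" and B: "B \<subseteq> V" "\<And>b. b \<in> B \<Longrightarrow> gen b \<oplus> \<one> \<in> J" and r: "r \<in> carrier R"
    and detect: "\<And>m. set_mset m \<subseteq> V - B \<Longrightarrow> mon m \<notin> J \<Longrightarrow>
      \<exists>F. indep F \<and> set_mset m \<subseteq> F \<and> J \<subseteq> spec_ker F B \<and> spec F B r = 0"
  shows "r \<in> J"
proof -
  interpret J: ideal J R by fact
  obtain U where U: "finite U" "\<And>m. m \<in> U \<Longrightarrow> set_mset m \<subseteq> V - B" "\<And>m. m \<in> U \<Longrightarrow> mon m \<notin> J"
    "r \<oplus> finsum R mon U \<in> J"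
    using normal_form[OF J B r] by blast
  have carr: "mon \<in> U \<rightarrow> carrier R" using U(2) by (auto intro!: mon_closed)
  have "U = {}"
  proof (rule ccontr)
    assume "U \<noteq> {}"
    then obtain m0 where m0: "m0 \<in> U" by blast
    then obtain F where F: "indep F" "set_mset m0 \<subseteq> F" "J \<subseteq> spec_ker F B" "spec F B r = 0"
      using detect U by meson
    have "spec F B (r \<oplus> finsum R mon U) = 0" using U(4) F(3) by (auto simp: spec_ker_def)
    then have "0 = spec F B (finsum R mon U)"
      using F r carr by (simp add: spec_add finsum_closed)
    also have "\<dots> = (\<Sum>m\<in>U. spec F B (mon m))" using F U carr by (intro spec_finsum)
    also have "\<dots> = (\<Sum>m\<in>U. if set_mset m \<subseteq> F then Poly_Mapping.single (exponent V m) 1 else 0)"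
      using F U by (intro sum.cong refl spec_mon)
    finally have "0 = Poly_Mapping.lookup (\<Sum>m\<in>U. if set_mset m \<subseteq> F then Poly_Mapping.single (exponent V m) (1 :: bit) else 0)
        (exponent V m0)" by (metis lookup_zero)
    also have "\<dots> = (\<Sum>m\<in>U. if m = m0 then 1 else 0)"
      unfolding lookup_sum
    proof (rule sum.cong)
      fix m assume m: "m \<in> U"
      have "exponent V m = exponent V m0 \<longleftrightarrow> m = m0"
        using U(2)[OF m] U(2)[OF m0] by (intro exponent_inject finite_V) auto
      then show "Poly_Mapping.lookup (if set_mset m \<subseteq> F then Poly_Mapping.single (exponent V m) (1 :: bit) else 0)
          (exponent V m0) = (if m = m0 then 1 else 0)"
        using F(2) by (auto simp: lookup_single when_def)
    qed simp
    also have "\<dots> = (1 :: bit)" using U(1) m0 by simp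
    finally show False by simp
  qed
  then show ?thesis using U(4) r by simp
qed

text \<open>
  The elements \<open>x\<^sub>b - 1\<close>, written with a plus sign because \<open>1 + 1 = 0\<close>.
\<close>
definition unit_gens :: "'v set \<Rightarrow> 'a set" where
  "unit_gens B = (\<lambda>b. gen b \<oplus> \<one>) ` B"

lemma unit_gens_closed: "B \<subseteq> V \<Longrightarrow> unit_gens B \<subseteq> carrier R"
  by (auto simp: unit_gens_def intro!: gen_closed)

lemma indep_sub: "indep F \<Longrightarrow> F \<subseteq> V"
  by (simp add: independent_set_def)

lemma indep_mono: "indep F \<Longrightarrow> B \<subseteq> F \<Longrightarrow> indep B"
  by (auto simp: independent_set_def)

lemma unit_gens_sub_spec_ker: "indep F \<Longrightarrow> B' \<subseteq> B \<Longrightarrow> B \<subseteq> F \<Longrightarrow> unit_gens B' \<subseteq> spec_ker F B"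
proof
  fix r assume F: "indep F" "B' \<subseteq> B" "B \<subseteq> F" and "r \<in> unit_gens B'"
  then obtain b where b: "b \<in> B'" "r = gen b \<oplus> \<one>" by (auto simp: unit_gens_def)
  then have bV: "b \<in> V" using F indep_sub[OF F(1)] by auto
  have "spec F B r = evaluation_point V F B b + 1"
    using F(1) bV b gen_closed[OF bV] by (simp add: spec_add spec_gen spec_one)
  also have "\<dots> = 1 + 1" using F b by (auto simp: evaluation_point_def)
  also have "\<dots> = 0" by (rule f2_poly_add_self)
  finally show "r \<in> spec_ker F B" using b gen_closed[OF bV] by (simp add: spec_ker_def)
qed

lemma vars_sub_spec_ker: "indep F \<Longrightarrow> gen ` (V - F) \<subseteq> spec_ker F B"
  by (auto simp: spec_ker_def spec_gen evaluation_point_def gen_closed)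

lemma spec_ker_eq_Idl:
  assumes "indep F" "B \<subseteq> F"
  shows "spec_ker F B = Idl (unit_gens B \<union> gen ` (V - F))"
proof
  let ?G = "unit_gens B \<union> gen ` (V - F)"
  have FV: "F \<subseteq> V" "B \<subseteq> V" using assms indep_sub by blast+
  have G: "?G \<subseteq> carrier R" using unit_gens_closed[OF FV(2)] gen_closed by auto
  note GI = genideal_self[OF G]
  interpret J: ideal "Idl ?G" R by (rule genideal_ideal[OF G])
  show sub: "Idl ?G \<subseteq> spec_ker F B"
    using unit_gens_sub_spec_ker[OF assms(1) subset_refl assms(2)] vars_sub_spec_ker[OF assms(1)]
    by (intro genideal_minimal spec_ker_ideal assms) simp
  show "spec_ker F B \<subseteq> Idl ?G"
  proof
    fix r assume r: "r \<in> spec_ker F B"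
    show "r \<in> Idl ?G"
    proof (rule mem_ideal_by_evaluation[OF J.is_ideal FV(2)])
      show "gen b \<oplus> \<one> \<in> Idl ?G" if "b \<in> B" for b using that GI by (auto simp: unit_gens_def)
      show "r \<in> carrier R" using r by (simp add: spec_ker_def)
      fix m assume m: "set_mset m \<subseteq> V - B" "mon m \<notin> Idl ?G"
      have "set_mset m \<subseteq> F"
      proof (rule ccontr)
        assume "\<not> set_mset m \<subseteq> F"
        then obtain v where v: "v \<in># m" "v \<in> V - F" using m by auto
        then obtain n where n: "m = add_mset v n" by (metis multi_member_split)
        have "mon m = gen v \<otimes> mon n" unfolding n using v m n by (intro mon_add_mset) auto
        moreover have "gen v \<in> Idl ?G" using GI v by auto
        moreover have "mon n \<in> carrier R" using m n by (intro mon_closed) auto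
        ultimately show False using m(2) J.I_r_closed by simp
      qed
      then show "\<exists>F'. indep F' \<and> set_mset m \<subseteq> F' \<and> Idl ?G \<subseteq> spec_ker F' B \<and> spec F' B r = 0"
        using assms sub r by (auto simp: spec_ker_def)
    qed
  qed
qed

lemma spec_ker_mono:
  assumes "indep F" "B \<subseteq> B'" "B' \<subseteq> F'" "F' \<subseteq> F"
  shows "spec_ker F B \<subseteq> spec_ker F' B'"
proof -
  have F': "indep F'" using assms indep_mono by blast
  have "gen ` (V - F) \<subseteq> gen ` (V - F')" using assms by auto
  then have "unit_gens B \<union> gen ` (V - F) \<subseteq> spec_ker F' B'"
    using unit_gens_sub_spec_ker[OF F' assms(2,3)] vars_sub_spec_ker[OF F'] by blast
  then have "Idl (unit_gens B \<union> gen ` (V - F)) \<subseteq> spec_ker F' B'"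
    by (intro genideal_minimal spec_ker_ideal F')
  then show ?thesis using spec_ker_eq_Idl[of F B] assms by auto
qed

text \<open>
  Setting \<open>x\<^sub>a = 1\<close> turns the relation \<open>x\<^sub>a x\<^sub>v = 0\<close> into \<open>x\<^sub>v = 0\<close>; this is how dividing out the \<open>x\<^sub>a - 1\<close>
  passes to the link.
\<close>
lemma neighbour_in_unit_ideal:
  assumes "a \<in> A" "A \<subseteq> V" "(a, v) \<in> E"
  shows "gen v \<in> Idl (unit_gens A)"
proof -
  interpret J: ideal "Idl (unit_gens A)" R by (rule genideal_ideal[OF unit_gens_closed[OF assms(2)]])
  have v: "v \<in> V" "a \<in> V" using assms E_sub by auto
  have "gen v = (gen a \<oplus> \<one>) \<otimes> gen v \<oplus> gen a \<otimes> gen v \<oplus> (\<zero> \<oplus> \<zero>)"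
  proof -
    have "(gen a \<oplus> \<one>) \<otimes> gen v \<oplus> gen a \<otimes> gen v \<oplus> (\<zero> \<oplus> \<zero>) = gen v \<oplus> (gen a \<otimes> gen v \<oplus> gen a \<otimes> gen v)"
      using gen_closed v by algebra
    then show ?thesis using gen_closed v add_self by simp
  qed
  also have "\<dots> = (gen a \<oplus> \<one>) \<otimes> gen v" using gen_edge[OF assms(3)] gen_closed v by simp
  also have "\<dots> \<in> Idl (unit_gens A)"
    using genideal_self[OF unit_gens_closed[OF assms(2)]] assms(1) v gen_closed
    by (intro J.I_r_closed) (auto simp: unit_gens_def)
  finally show ?thesis .
qed

text \<open>
  The quotient by the \<open>x\<^sub>b - 1\<close> is the edge ring of the link of \<open>B\<close>, which is reduced with minimal primes
  given by faces: a monomial survives in it only if its support together with \<open>B\<close> is independent, and then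
  it is visible on that face.
\<close>
lemma unit_ideal_by_evaluation:
  assumes B: "indep B" and r: "r \<in> carrier R" and ev: "\<And>F. indep F \<Longrightarrow> B \<subseteq> F \<Longrightarrow> spec F B r = 0"
  shows "r \<in> Idl (unit_gens B)"
proof (rule mem_ideal_by_evaluation)
  have BV: "B \<subseteq> V" using B indep_sub by blast
  then show "B \<subseteq> V" .
  have G: "unit_gens B \<subseteq> carrier R" by (rule unit_gens_closed[OF BV])
  show J: "ideal (Idl (unit_gens B)) R" by (rule genideal_ideal[OF G])
  then interpret J: ideal "Idl (unit_gens B)" R .
  show "gen b \<oplus> \<one> \<in> Idl (unit_gens B)" if "b \<in> B" for b
    using that genideal_self[OF G] by (auto simp: unit_gens_def)
  fix m assume m: "set_mset m \<subseteq> V - B" "mon m \<notin> Idl (unit_gens B)"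
  have edge_absorbed: "gen u \<notin> Idl (unit_gens B)" if u: "u \<in># m" for u
  proof
    assume "gen u \<in> Idl (unit_gens B)"
    moreover obtain n where n: "m = add_mset u n" using u by (metis multi_member_split)
    moreover have "mon m = gen u \<otimes> mon n" unfolding n using m n by (intro mon_add_mset) auto
    moreover have "mon n \<in> carrier R" using m n by (intro mon_closed) auto
    ultimately show False using m(2) J.I_r_closed by simp
  qed
  have "indep (B \<union> set_mset m)"
    unfolding independent_set_def
  proof (intro conjI ballI notI)
    show "B \<union> set_mset m \<subseteq> V" using m BV by auto
    fix u v assume uv: "u \<in> B \<union> set_mset m" "v \<in> B \<union> set_mset m" "(u, v) \<in> E"
    then have vu: "(v, u) \<in> E" using sym_E by (meson symD)
    have no: "\<not> (u \<in> B \<and> v \<in># m)" "\<not> (v \<in> B \<and> u \<in># m)"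
      using neighbour_in_unit_ideal[OF _ BV] uv(3) vu edge_absorbed by blast+
    moreover have "\<not> (u \<in> B \<and> v \<in> B)" using B uv by (auto simp: independent_set_def)
    ultimately have "u \<in># m" "v \<in># m" using uv by auto
    then obtain n where n: "m = add_mset u n" by (metis multi_member_split)
    moreover have "u \<noteq> v" using uv irrefl_E by (auto simp: irrefl_def)
    ultimately obtain k where k: "n = add_mset v k"
      using \<open>v \<in># m\<close> by (metis insert_noteq_member multi_member_split)
    have c: "gen u \<in> carrier R" "gen v \<in> carrier R" "mon k \<in> carrier R"
      using m n k by (auto intro!: gen_closed mon_closed)
    have uvk: "u \<in> V" "v \<in> V" "set_mset k \<subseteq> V" "set_mset (add_mset v k) \<subseteq> V"
      using m(1) n k by auto
    have "mon m = gen u \<otimes> (gen v \<otimes> mon k)"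
      unfolding n k mon_add_mset[OF uvk(1,4)] mon_add_mset[OF uvk(2,3)] ..
    also have "\<dots> = (gen u \<otimes> gen v) \<otimes> mon k" using c by (simp add: m_assoc)
    also have "\<dots> = \<zero>" using gen_edge[OF uv(3)] c by simp
    finally show False using m(2) J.zero_closed by simp
  qed
  moreover have "Idl (unit_gens B) \<subseteq> spec_ker (B \<union> set_mset m) B"
    using unit_gens_sub_spec_ker[OF calculation] by (intro genideal_minimal spec_ker_ideal calculation) auto
  ultimately show "\<exists>F. indep F \<and> set_mset m \<subseteq> F \<and> Idl (unit_gens B) \<subseteq> spec_ker F B \<and> spec F B r = 0"
    using ev[of "B \<union> set_mset m"] by blast
qed (rule r)

end

section \<open>Links in Cohen--Macaulay edge rings\<close>

lemma indeterminate_neq_0: "indeterminate V v \<noteq> 0"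
  by (metis indeterminate_def lookup_single_eq lookup_zero zero_neq_one)

lemma indeterminate_neq_1:
  assumes "finite V" "v \<in> V" shows "indeterminate V v \<noteq> 1"
proof
  assume "indeterminate V v = 1"
  then have "exponent V {#v#} = 0"
    by (metis indeterminate_def lookup_single_not_eq lookup_one_zero lookup_single_eq single_one zero_neq_one)
  then have "exponent V {#v#} = exponent V {#}" by (simp add: exponent_def)
  then show False using assms by (simp add: exponent_inject)
qed

lemma lookup_indeterminate:
  assumes "finite V" "v \<in> V" "w \<in> V"
  shows "Poly_Mapping.lookup (indeterminate V v) (exponent V {#w#}) = (if v = w then 1 else 0)"
  using exponent_inject[OF assms(1), of "{#v#}" "{#w#}"] assms
  by (auto simp: indeterminate_def lookup_single when_def)

definition prime_chain :: "('a, 'b) ring_scheme \<Rightarrow> 'a set \<Rightarrow> nat \<Rightarrow> bool" where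
  "prime_chain R P n \<longleftrightarrow> (\<exists>Q. (\<forall>i\<le>n. primeideal (Q i) R) \<and> (\<forall>i<n. Q i \<subset> Q (Suc i)) \<and> Q n = P)"

lemma prime_chain_0: "primeideal P R \<Longrightarrow> prime_chain R P 0"
  by (auto simp: prime_chain_def)

lemma prime_chain_Suc:
  assumes "prime_chain R P n" "primeideal P' R" "P \<subset> P'"
  shows "prime_chain R P' (Suc n)"
proof -
  obtain Q where Q: "\<forall>i\<le>n. primeideal (Q i) R" "\<forall>i<n. Q i \<subset> Q (Suc i)" "Q n = P"
    using assms(1) unfolding prime_chain_def by blast
  have "\<forall>i<Suc n. (Q(Suc n := P')) i \<subset> (Q(Suc n := P')) (Suc i)"
    using Q assms(3) by (auto simp: less_Suc_eq)
  moreover have "\<forall>i\<le>Suc n. primeideal ((Q(Suc n := P')) i) R"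
    using Q assms(2) by (auto simp: le_Suc_eq)
  ultimately show ?thesis unfolding prime_chain_def by (intro exI[of _ "Q(Suc n := P')"]) simp
qed

lemma prime_chain_le_height: "prime_chain R P n \<Longrightarrow> enat n \<le> height R P"
  unfolding height_def prime_chain_def by (rule Sup_upper) blast

lemma le_depth_imp_regular_sequence:
  assumes "enat n \<le> depth R I"
  shows "\<exists>xs. length xs = n \<and> set xs \<subseteq> I \<and> set xs \<subseteq> carrier R \<and>
    (\<forall>i<n. \<forall>a\<in>carrier R.
      xs ! i \<otimes>\<^bsub>R\<^esub> a \<in> genideal R (set (take i xs)) \<longrightarrow> a \<in> genideal R (set (take i xs)))"
proof -
  have "\<exists>xs. n \<le> length xs \<and> set xs \<subseteq> I \<and> set xs \<subseteq> carrier R \<and>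
     (\<forall>i<length xs. \<forall>a\<in>carrier R.
        xs ! i \<otimes>\<^bsub>R\<^esub> a \<in> genideal R (set (take i xs)) \<longrightarrow> a \<in> genideal R (set (take i xs)))"
  proof (cases n)
    case 0
    then show ?thesis by (intro exI[of _ "[]"]) simp
  next
    case (Suc k)
    then have "enat k < depth R I" using assms by (metis enat_ord_simps(2) lessI less_le_trans)
    then obtain xs where "set xs \<subseteq> I" "regular_sequence R xs" "enat k < enat (length xs)"
      unfolding depth_def less_Sup_iff by blast
    then show ?thesis using Suc by (intro exI[of _ xs]) (auto simp: regular_sequence_def)
  qed
  then obtain xs where xs: "n \<le> length xs" "set xs \<subseteq> I" "set xs \<subseteq> carrier R"
     "\<forall>i<length xs. \<forall>a\<in>carrier R.
        xs ! i \<otimes>\<^bsub>R\<^esub> a \<in> genideal R (set (take i xs)) \<longrightarrow> a \<in> genideal R (set (take i xs))" by blast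
  show ?thesis
  proof (intro exI[of _ "take n xs"] conjI allI impI ballI)
    show "length (take n xs) = n" using xs(1) by simp
    show "set (take n xs) \<subseteq> I" "set (take n xs) \<subseteq> carrier R"
      using xs(2,3) set_take_subset[of n xs] by blast+
    show "a \<in> genideal R (set (take i (take n xs)))"
      if "i < n" "a \<in> carrier R" "take n xs ! i \<otimes>\<^bsub>R\<^esub> a \<in> genideal R (set (take i (take n xs)))" for i a
      using xs(1,4) that by (simp add: min_def)
  qed
qed

context edge_ring
begin

lemma spec_ker_maximal:
  assumes A: "indep A" shows "maximalideal (spec_ker A A) R"
proof (rule maximalidealI)
  show "ideal (spec_ker A A) R" by (rule spec_ker_ideal[OF A])
  show "carrier R \<noteq> spec_ker A A"
  proof
    assume "carrier R = spec_ker A A"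
    then have "\<one> \<in> spec_ker A A" by blast
    then show False using spec_one[OF A, of A] by (simp add: spec_ker_def)
  qed
  define S where "S = {r \<in> carrier R. spec A A r = 0 \<or> spec A A r = 1}"
  have "S = carrier R"
  proof (rule generated)
    show "S \<subseteq> carrier R" "\<zero> \<in> S" "\<one> \<in> S" using A by (auto simp: S_def spec_zero spec_one)
    show "a \<oplus> b \<in> S" if "a \<in> S" "b \<in> S" for a b
      using that A f2_poly_add_self[of 1] by (auto simp: S_def spec_add)
    show "a \<otimes> gen v \<in> S" if "a \<in> S" "v \<in> V" for a v
      using that A by (auto simp: S_def spec_mult spec_gen gen_closed evaluation_point_def)
  qed
  fix J assume J: "ideal J R" "spec_ker A A \<subseteq> J" "J \<subseteq> carrier R"
  interpret J: ideal J R by fact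
  show "J = spec_ker A A \<or> J = carrier R"
  proof (cases "J = spec_ker A A")
    case True
    then show ?thesis ..
  next
    case False
    then obtain r where r: "r \<in> J" "r \<notin> spec_ker A A" using J by blast
    then have rc: "r \<in> carrier R" using J by blast
    then have "r \<in> S" using \<open>S = carrier R\<close> by simp
    then have "spec A A r = 1" using r(2) rc by (simp add: S_def spec_ker_def)
    then have "r \<oplus> \<one> \<in> spec_ker A A" using rc A f2_poly_add_self[of 1] by (simp add: spec_ker_def spec_add spec_one)
    then have "r \<oplus> (r \<oplus> \<one>) \<in> J" using r(1) J(2) J.a_closed by blast
    then have "\<one> \<in> J" using add_self_cancel rc by simp
    then show ?thesis using J.one_imp_carrier by blast
  qed
qed

text \<open>
  The chain first adds the variables \<open>i\<close> and \<open>j\<close>, and then \<open>x\<^sub>a - 1\<close> for one \<open>a \<in> A\<close> after the other.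
\<close>
lemma prime_chain_to_maximal:
  assumes F: "indep (insert i (insert j A))" and ij: "i \<noteq> j" "i \<notin> A" "j \<notin> A"
  shows "prime_chain R (spec_ker A A) (2 + card A)"
proof -
  have FV: "insert i (insert j A) \<subseteq> V" by (rule indep_sub[OF F])
  have A: "indep A" and jA: "indep (insert j A)" using indep_mono[OF F] by blast+
  have var_step: "spec_ker (insert v C) {} \<subset> spec_ker C {}" if v: "indep (insert v C)" "v \<notin> C" for v C
  proof -
    have C: "indep C" using indep_mono[OF v(1)] by blast
    have vV: "v \<in> V" using indep_sub[OF v(1)] by blast
    have "gen v \<in> spec_ker C {}" using v vV C by (auto simp: spec_ker_def spec_gen gen_closed evaluation_point_def)
    moreover have "gen v \<notin> spec_ker (insert v C) {}"
      using v vV by (auto simp: spec_ker_def spec_gen evaluation_point_def indeterminate_neq_0)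
    moreover have "spec_ker (insert v C) {} \<subseteq> spec_ker C {}" by (rule spec_ker_mono[OF v(1)]) auto
    ultimately show ?thesis by blast
  qed
  have "prime_chain R (spec_ker (insert i (insert j A)) {}) 0" by (intro prime_chain_0 spec_ker_prime F)
  then have "prime_chain R (spec_ker (insert j A) {}) (Suc 0)"
    by (rule prime_chain_Suc) (use var_step F jA ij in \<open>auto intro: spec_ker_prime\<close>)
  then have base: "prime_chain R (spec_ker A {}) (Suc (Suc 0))"
    by (rule prime_chain_Suc) (use var_step jA A ij in \<open>auto intro: spec_ker_prime\<close>)
  have "finite A" by (rule finite_subset[OF _ finite_V]) (use FV in auto)
  have chain: "prime_chain R (spec_ker A B) (2 + card B)" if "finite B" "B \<subseteq> A" for B
    using that
  proof (induction B rule: finite_induct)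
    case empty
    then show ?case using base by (simp add: numeral_2_eq_2)
  next
    case (insert a B)
    then have a: "a \<in> A" "a \<in> V" "B \<subseteq> A" using FV by auto
    have "spec_ker A B \<subseteq> spec_ker A (insert a B)" by (rule spec_ker_mono[OF A]) (use insert in auto)
    moreover have "gen a \<oplus> \<one> \<in> spec_ker A (insert a B)"
      using unit_gens_sub_spec_ker[OF A, of "insert a B" "insert a B"] insert.prems by (auto simp: unit_gens_def)
    moreover have "gen a \<oplus> \<one> \<notin> spec_ker A B"
      using a A insert.hyps indeterminate_neq_1[OF finite_V, of a]
      by (auto simp: spec_ker_def spec_add spec_gen spec_one gen_closed evaluation_point_def f2_poly_add_eq_0_iff)
    ultimately have "spec_ker A B \<subset> spec_ker A (insert a B)" by blast
    then have "prime_chain R (spec_ker A (insert a B)) (Suc (2 + card B))"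
      using insert.IH a by (intro prime_chain_Suc[of R "spec_ker A B"] spec_ker_prime A) auto
    then show ?case using insert.hyps by simp
  qed
  show ?thesis by (rule chain[OF \<open>finite A\<close> subset_refl])
qed

text \<open>
  Modulo \<open>unit_gens B\<close> an element is determined by its values on the faces \<open>F\<close> containing \<open>B\<close>. These values lie in a
  domain, so it suffices that on sufficiently many faces \<open>z\<close> does not vanish.
\<close>
lemma nonzerodivisor_mod_unit_gens:
  assumes B: "indep B" and z: "z \<in> carrier R"
    and nz: "\<And>F r. indep F \<Longrightarrow> B \<subseteq> F \<Longrightarrow> r \<in> carrier R \<Longrightarrow>
      (\<And>F'. indep F' \<Longrightarrow> B \<subseteq> F' \<Longrightarrow> spec F' B z = 0 \<or> spec F' B r = 0) \<Longrightarrow> spec F B r = 0"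
  shows "nonzerodivisor_mod z (Idl (unit_gens B))"
  unfolding nonzerodivisor_mod_def
proof (intro ballI impI)
  fix r assume r: "r \<in> carrier R" "z \<otimes> r \<in> Idl (unit_gens B)"
  have "spec F B z = 0 \<or> spec F B r = 0" if F: "indep F" "B \<subseteq> F" for F
  proof -
    have "Idl (unit_gens B) \<subseteq> spec_ker F B"
      using unit_gens_sub_spec_ker[OF F(1) subset_refl F(2)] by (intro genideal_minimal spec_ker_ideal F)
    then have "spec F B (z \<otimes> r) = 0" using r by (auto simp: spec_ker_def)
    then show ?thesis using r z F by (simp add: spec_mult)
  qed
  then show "r \<in> Idl (unit_gens B)" using nz r by (intro unit_ideal_by_evaluation B) auto
qed

lemma unit_gens_regular:
  assumes A: "indep (set as)" "distinct as"
  shows "regular_mod {} (map (\<lambda>a. gen a \<oplus> \<one>) as)"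
  unfolding regular_mod_def
proof (intro allI impI)
  fix i assume i: "i < length (map (\<lambda>a. gen a \<oplus> \<one>) as)"
  define B where "B = set (take i as)"
  have B: "indep B" unfolding B_def by (rule indep_mono[OF A(1) set_take_subset])
  have a: "as ! i \<in> V" using i indep_sub[OF A(1)] by auto
  have aB: "as ! i \<notin> B"
    using A(2) i by (auto simp: B_def in_set_conv_nth nth_eq_iff_index_eq)
  have "nonzerodivisor_mod (gen (as ! i) \<oplus> \<one>) (Idl (unit_gens B))"
  proof (rule nonzerodivisor_mod_unit_gens[OF B])
    show "gen (as ! i) \<oplus> \<one> \<in> carrier R" using gen_closed[OF a] by simp
    fix F r assume F: "indep F" "B \<subseteq> F" and
      zero: "\<And>F'. indep F' \<Longrightarrow> B \<subseteq> F' \<Longrightarrow> spec F' B (gen (as ! i) \<oplus> \<one>) = 0 \<or> spec F' B r = 0"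
    have "spec F B (gen (as ! i) \<oplus> \<one>) = evaluation_point V F B (as ! i) + 1"
      using gen_closed[OF a] F a by (simp add: spec_add spec_gen spec_one)
    also have "\<dots> \<noteq> 0"
      using aB indeterminate_neq_1[OF finite_V a] by (auto simp: evaluation_point_def f2_poly_add_eq_0_iff)
    finally show "spec F B r = 0" using zero F by blast
  qed
  moreover have "set (take i (map (\<lambda>a. gen a \<oplus> \<one>) as)) = unit_gens B"
    by (simp add: B_def unit_gens_def take_map)
  ultimately show "nonzerodivisor_mod (map (\<lambda>a. gen a \<oplus> \<one>) as ! i)
      (Idl ({} \<union> set (take i (map (\<lambda>a. gen a \<oplus> \<one>) as))))" using i by simp
qed

definition linear_form :: "'v set \<Rightarrow> 'a" where
  "linear_form W = finsum R gen W"

lemma gens_Pi: "W \<subseteq> V \<Longrightarrow> gen \<in> W \<rightarrow> carrier R"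
  using gen_closed by auto

lemma linear_form_closed: "W \<subseteq> V \<Longrightarrow> linear_form W \<in> carrier R"
  unfolding linear_form_def by (intro finsum_closed gens_Pi)

lemma spec_linear_form:
  assumes "indep F" "W \<subseteq> V"
  shows "spec F B (linear_form W) = (\<Sum>v\<in>W. evaluation_point V F B v)"
proof -
  have "spec F B (linear_form W) = (\<Sum>v\<in>W. spec F B (gen v))"
    unfolding linear_form_def
    by (rule spec_finsum[OF assms(1) finite_subset[OF assms(2) finite_V] gens_Pi[OF assms(2)]])
  also have "\<dots> = (\<Sum>v\<in>W. evaluation_point V F B v)"
    using assms by (intro sum.cong spec_gen) auto
  finally show ?thesis .
qed

lemma indep_insert_link:
  assumes "indep A" "v \<in> link_vertices V E A"
  shows "indep (insert v A)"
  using assms sym_E irrefl_E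
  by (auto simp: independent_set_def link_vertices_def irrefl_def dest: symD)

lemma link_vertices_sub: "link_vertices V E A \<subseteq> V - A"
  by (auto simp: link_vertices_def)

text \<open>
  On a face that strictly contains \<open>A\<close> the form restricts to a nonempty sum of indeterminates. On \<open>A\<close> itself it
  vanishes, but an element that vanishes on a larger face vanishes there as well.
\<close>
lemma linear_form_regular:
  assumes A: "indep A" and W: "W = link_vertices V E A" "W \<noteq> {}"
  shows "nonzerodivisor_mod (linear_form W) (Idl (unit_gens A))"
proof (rule nonzerodivisor_mod_unit_gens[OF A])
  have WV: "W \<subseteq> V" and WA: "W \<inter> A = {}" using W link_vertices_sub[of A] by auto
  show "linear_form W \<in> carrier R" by (rule linear_form_closed[OF WV])
  fix F r assume F: "indep F" "A \<subseteq> F" and r: "r \<in> carrier R" and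
    zero: "\<And>F'. indep F' \<Longrightarrow> A \<subseteq> F' \<Longrightarrow> spec F' A (linear_form W) = 0 \<or> spec F' A r = 0"
  have nz: "spec F' A r = 0" if F': "indep F'" "A \<subseteq> F'" "v0 \<in> F' - A" for F' v0
  proof -
    have v0: "v0 \<in> W" "v0 \<in> V"
      using F' W by (auto simp: link_vertices_def independent_set_def)
    have "Poly_Mapping.lookup (spec F' A (linear_form W)) (exponent V {#v0#})
        = (\<Sum>v\<in>W. Poly_Mapping.lookup (evaluation_point V F' A v) (exponent V {#v0#}))"
      by (simp add: spec_linear_form[OF F'(1) WV] lookup_sum)
    also have "\<dots> = (\<Sum>v\<in>W. if v = v0 then 1 else 0)"
    proof (rule sum.cong)
      fix v assume v: "v \<in> W"
      then have "v \<in> V" "v \<notin> A" using WV WA by auto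
      then show "Poly_Mapping.lookup (evaluation_point V F' A v) (exponent V {#v0#}) = (if v = v0 then 1 else 0)"
        using F'(3) lookup_indeterminate[OF finite_V _ v0(2), of v] by (auto simp: evaluation_point_def)
    qed simp
    also have "\<dots> = 1" using v0 finite_subset[OF WV finite_V] by simp
    finally have "spec F' A (linear_form W) \<noteq> 0" by auto
    then show ?thesis using zero F' by blast
  qed
  show "spec F A r = 0"
  proof (cases "F = A")
    case False
    then show ?thesis using nz[OF F] F by blast
  next
    case True
    obtain v where v: "v \<in> W" using W by blast
    have F': "indep (insert v A)" using v W A indep_insert_link by blast
    have "spec (insert v A) A r = 0" by (rule nz[OF F', of v]) (use v WA in auto)
    moreover have "spec_ker (insert v A) A \<subseteq> spec_ker A A" by (rule spec_ker_mono[OF F']) auto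
    ultimately show ?thesis using True r by (auto simp: spec_ker_def)
  qed
qed

lemma gen_linear_form_zero:
  assumes "W \<subseteq> V" "v \<in> V" "\<And>w. w \<in> W \<Longrightarrow> (v, w) \<in> E"
  shows "gen v \<otimes> linear_form W = \<zero>"
proof -
  have "gen v \<otimes> linear_form W = finsum R (\<lambda>w. gen v \<otimes> gen w) W"
    unfolding linear_form_def
    by (rule finsum_rdistr[OF finite_subset[OF assms(1) finite_V] gen_closed[OF assms(2)] gens_Pi[OF assms(1)]])
  also have "\<dots> = finsum R (\<lambda>w. \<zero>) W"
    by (rule finsum_cong') (use assms(3) gen_edge in auto)
  finally show ?thesis by simp
qed

text \<open>
  It suffices to multiply by the generators of the maximal ideal. Those that do not vanish modulo the \<open>x\<^sub>a - 1\<close> are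
  the variables of the link: \<open>x\<^sub>v\<close> with \<open>v \<in> W1\<close> annihilates the part of the linear form over \<open>W2\<close>, and
  conversely.
\<close>
lemma linear_form_socle:
  assumes A: "indep A" and link: "link_vertices V E A = W1 \<union> W2" and edges: "W1 \<times> W2 \<subseteq> E"
    and i: "i \<in> spec_ker A A"
  shows "i \<otimes> linear_form W1 \<in> Idl (insert (linear_form (W1 \<union> W2)) (unit_gens A))"
proof -
  let ?w = "linear_form (W1 \<union> W2)" and ?u = "linear_form W1"
  have sub: "W1 \<union> W2 \<subseteq> V" "W1 \<subseteq> V" "W2 \<subseteq> V" "A \<subseteq> V"
    using link link_vertices_sub[of A] indep_sub[OF A] by auto
  note c = sub[THEN linear_form_closed]
  have G: "insert ?w (unit_gens A) \<subseteq> carrier R" using c unit_gens_closed[OF sub(4)] by simp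
  interpret K: ideal "Idl (insert ?w (unit_gens A))" R by (rule genideal_ideal[OF G])
  note GI = genideal_self[OF G]
  have disj: "W1 \<inter> W2 = {}" using edges irrefl_E by (auto simp: irrefl_def)
  have w: "?w = ?u \<oplus> linear_form W2"
    unfolding linear_form_def using finite_subset[OF _ finite_V] sub disj gens_Pi
    by (intro finsum_Un_disjoint) auto
  have "unit_gens A \<union> gen ` (V - A) \<subseteq> {a \<in> carrier R. a \<otimes> ?u \<in> Idl (insert ?w (unit_gens A))}"
  proof
    fix g assume g: "g \<in> unit_gens A \<union> gen ` (V - A)"
    then have gc: "g \<in> carrier R" using unit_gens_closed[OF sub(4)] gen_closed by auto
    have "g \<otimes> ?u \<in> Idl (insert ?w (unit_gens A))"
    proof (cases "g \<in> Idl (insert ?w (unit_gens A))")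
      case True
      then show ?thesis using c by (simp add: K.I_r_closed)
    next
      case False
      then obtain v where v: "v \<in> V - A" "g = gen v" using g GI by auto
      have "Idl (unit_gens A) \<subseteq> Idl (insert ?w (unit_gens A))" by (rule subset_Idl_subset[OF G]) auto
      then have "v \<in> link_vertices V E A"
        using neighbour_in_unit_ideal[OF _ sub(4), of _ v] False v by (auto simp: link_vertices_def)
      then consider "v \<in> W1" | "v \<in> W2" using link by auto
      then show ?thesis
      proof cases
        case 1
        have "gen v \<otimes> linear_form W2 = \<zero>" using 1 v edges sub by (intro gen_linear_form_zero) auto
        then have "g \<otimes> ?w = g \<otimes> ?u" unfolding w using v gc c by (simp add: r_distr)
        moreover have "g \<otimes> ?w \<in> Idl (insert ?w (unit_gens A))" using GI gc by (simp add: K.I_l_closed)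
        ultimately show ?thesis by simp
      next
        case 2
        have "gen v \<otimes> ?u = \<zero>"
          using 2 v edges sub symD[OF sym_E] by (intro gen_linear_form_zero) auto
        then show ?thesis using v by simp
      qed
    qed
    then show "g \<in> {a \<in> carrier R. a \<otimes> ?u \<in> Idl (insert ?w (unit_gens A))}" using gc by simp
  qed
  then have "Idl (unit_gens A \<union> gen ` (V - A)) \<subseteq> {a \<in> carrier R. a \<otimes> ?u \<in> Idl (insert ?w (unit_gens A))}"
    by (intro genideal_minimal colon_ideal K.is_ideal c)
  then show ?thesis using i spec_ker_eq_Idl[OF A subset_refl] by auto
qed

text \<open>
  Suppose \<open>u = w r\<close> modulo the \<open>x\<^sub>a - 1\<close>. On a face \<open>insert v1 A\<close> with \<open>v1 \<in> W1\<close> both \<open>u\<close> and \<open>w\<close> restrict to the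
  same indeterminate, so \<open>r\<close> restricts to \<open>1\<close>; on \<open>insert v2 A\<close> with \<open>v2 \<in> W2\<close> only \<open>w\<close> survives, and \<open>r\<close>
  restricts to \<open>0\<close>. The two values disagree at the point \<open>A\<close>, which lies on both faces.
\<close>
lemma linear_form_part_not_in_ideal:
  assumes A: "indep A" and link: "link_vertices V E A = W1 \<union> W2" and disj: "W1 \<inter> W2 = {}"
    and ne: "W1 \<noteq> {}" "W2 \<noteq> {}"
  shows "linear_form W1 \<notin> Idl (insert (linear_form (W1 \<union> W2)) (unit_gens A))"
proof
  let ?w = "linear_form (W1 \<union> W2)" and ?u = "linear_form W1"
  assume u: "?u \<in> Idl (insert ?w (unit_gens A))"
  have sub: "W1 \<union> W2 \<subseteq> V" "W1 \<subseteq> V" "W2 \<subseteq> V" "A \<subseteq> V"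
    using link link_vertices_sub[of A] indep_sub[OF A] by auto
  note c = sub[THEN linear_form_closed]
  obtain k r where k: "k \<in> Idl (unit_gens A)" and r: "r \<in> carrier R" and eq: "?u = k \<oplus> ?w \<otimes> r"
    using u Idl_insert[OF c(1) unit_gens_closed[OF sub(4)]] by auto
  have at_vertex: "(if v \<in> W1 then indeterminate V v else 0) = indeterminate V v * spec (insert v A) A r"
    if v: "v \<in> W1 \<union> W2" for v
  proof -
    have F: "indep (insert v A)" using v link A indep_insert_link by blast
    have vA: "v \<notin> A" "W1 \<inter> A = {}" "W2 \<inter> A = {}" using v link link_vertices_sub[of A] by auto
    have val: "spec (insert v A) A (linear_form W) = (if v \<in> W then indeterminate V v else 0)"
      if W: "W \<subseteq> W1 \<union> W2" for W
    proof -
      have WV: "W \<subseteq> V" using W sub by blast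
      have "spec (insert v A) A (linear_form W) = (\<Sum>x\<in>W. if x = v then indeterminate V v else 0)"
        unfolding spec_linear_form[OF F WV]
        by (rule sum.cong) (use W vA in \<open>auto simp: evaluation_point_def\<close>)
      then show ?thesis using finite_subset[OF WV finite_V] by simp
    qed
    have "Idl (unit_gens A) \<subseteq> spec_ker (insert v A) A"
      by (intro genideal_minimal spec_ker_ideal F unit_gens_sub_spec_ker) auto
    then have k0: "k \<in> carrier R" "spec (insert v A) A k = 0" using k by (auto simp: spec_ker_def)
    have "spec (insert v A) A ?u = spec (insert v A) A k + spec (insert v A) A ?w * spec (insert v A) A r"
      unfolding eq using F k0 c r by (simp add: spec_add spec_mult)
    then show ?thesis using val[of W1] val[of "W1 \<union> W2"] v k0 by simp
  qed
  obtain v1 v2 where v: "v1 \<in> W1" "v2 \<in> W2" "v2 \<notin> W1" using ne disj by blast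
  have F: "indep (insert v1 A)" "indep (insert v2 A)" using v link A indep_insert_link by blast+
  have "spec (insert v1 A) A r = 1" using at_vertex[of v1] v indeterminate_neq_0[of V v1] by simp
  then have "r \<oplus> \<one> \<in> spec_ker (insert v1 A) A"
    using r F f2_poly_add_self[of 1] by (simp add: spec_ker_def spec_add spec_one)
  moreover have "spec_ker (insert v1 A) A \<subseteq> spec_ker A A" by (rule spec_ker_mono[OF F(1)]) auto
  ultimately have "r \<oplus> \<one> \<in> spec_ker A A" by blast
  then have 1: "spec A A r + 1 = 0" using r A by (simp add: spec_ker_def spec_add spec_one)
  have "spec (insert v2 A) A r = 0" using at_vertex[of v2] v indeterminate_neq_0[of V v2] by simp
  moreover have "spec_ker (insert v2 A) A \<subseteq> spec_ker A A" by (rule spec_ker_mono[OF F(2)]) auto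
  ultimately have "spec A A r = 0" using r by (auto simp: spec_ker_def)
  then show False using 1 by simp
qed

text \<open>
  The link of the face \<open>A\<close> would be disconnected, of positive dimension because of the nonadjacent vertices
  \<open>i\<close> and \<open>j\<close>. The first \<open>card A + 1\<close> entries of a regular sequence of length \<open>card A + 2\<close> in the maximal
  ideal leave no socle, whereas the sequence built from \<open>A\<close> and the link has the same length and leaves
  the socle element \<open>linear_form W1\<close>.
\<close>
theorem cohen_macaulay_link_connected:
  assumes CM: "cohen_macaulay_ring R"
    and A: "indep A" and link: "link_vertices V E A = W1 \<union> W2" and edges: "W1 \<times> W2 \<subseteq> E"
    and ne: "W1 \<noteq> {}" and ij: "i \<in> W2" "j \<in> W2" "i \<noteq> j" "(i, j) \<notin> E"
  shows False
proof -
  let ?w = "linear_form (W1 \<union> W2)"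
  have noeth: "noetherian_ring R" and eq: "depth R (spec_ker A A) = height R (spec_ker A A)"
    using CM spec_ker_maximal[OF A] by (auto simp: cohen_macaulay_ring_def)
  have sub: "W1 \<union> W2 \<subseteq> V" "A \<subseteq> V" "W1 \<union> W2 \<subseteq> V - A"
    using link link_vertices_sub[of A] indep_sub[OF A] by auto
  have wc: "?w \<in> carrier R" by (rule linear_form_closed[OF sub(1)])
  have finA: "finite A" by (rule finite_subset[OF sub(2) finite_V])
  then obtain as where as: "set as = A" "distinct as" using finite_distinct_list by blast
  \<comment> \<open>one entry fewer than the length of the chain of primes used below\<close>
  define xs where "xs = map (\<lambda>a. gen a \<oplus> \<one>) as @ [?w]"
  have set_xs: "set xs = insert ?w (unit_gens A)" by (auto simp: xs_def unit_gens_def as)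
  have len_xs: "length xs = card A + 1" using as distinct_card[of as] by (simp add: xs_def)
  have reg_xs: "regular_mod {} xs"
    unfolding xs_def regular_mod_snoc
    using unit_gens_regular[of as] linear_form_regular[OF A link[symmetric]] ne as A
    by (simp add: unit_gens_def)
  have xs_I: "set xs \<subseteq> spec_ker A A"
  proof -
    have "spec A A ?w = 0"
      unfolding spec_linear_form[OF A sub(1)]
      by (rule sum.neutral) (use sub in \<open>auto simp: evaluation_point_def\<close>)
    then have "?w \<in> spec_ker A A" unfolding spec_ker_def using wc by blast
    then show ?thesis using unit_gens_sub_spec_ker[OF A, of A A] by (simp add: set_xs)
  qed
  have iA: "indep (insert i (insert j A))"
  proof -
    have "indep (insert i A)" "indep (insert j A)"
      using ij(1,2) link by (auto intro!: indep_insert_link A)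
    moreover have "(j, i) \<notin> E" using ij(4) symD[OF sym_E] by blast
    ultimately show ?thesis using ij(4) unfolding independent_set_def by blast
  qed
  have "enat (2 + card A) \<le> depth R (spec_ker A A)"
  proof -
    have "i \<notin> A" "j \<notin> A" using ij(1,2) sub(3) by auto
    then show ?thesis
      unfolding eq by (rule prime_chain_le_height[OF prime_chain_to_maximal[OF iA ij(3)]])
  qed
  from le_depth_imp_regular_sequence[OF this] obtain ys
    where ys: "length ys = 2 + card A" "set ys \<subseteq> spec_ker A A" "set ys \<subseteq> carrier R"
      "\<forall>i<2 + card A. \<forall>a\<in>carrier R.
        ys ! i \<otimes> a \<in> Idl (set (take i ys)) \<longrightarrow> a \<in> Idl (set (take i ys))"
    by (elim exE conjE)
  have "regular_mod {} ys"
    unfolding regular_mod_def nonzerodivisor_mod_def using ys(1,4) by simp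
  moreover obtain ys' y where y: "ys = ys' @ [y]" using ys(1) by (cases ys rule: rev_cases) auto
  ultimately have "regular_mod {} ys'" "nonzerodivisor_mod y (Idl (set ys'))"
    by (simp_all add: regular_mod_snoc)
  moreover have y_I: "y \<in> spec_ker A A" "set ys' \<subseteq> spec_ker A A" "length ys' = card A + 1" using ys y by auto
  moreover have "socle_free (spec_ker A A) ({} \<union> set ys')"
    using \<open>nonzerodivisor_mod y (Idl (set ys'))\<close> y_I(1)
    unfolding socle_free_def nonzerodivisor_mod_def by simp
  ultimately have "socle_free (spec_ker A A) ({} \<union> set xs)"
    using len_xs reg_xs xs_I by (intro socle_free_regular_mod[OF noeth spec_ker_ideal[OF A], of "{}" xs ys']) auto
  moreover have "linear_form W1 \<in> carrier R" using sub by (intro linear_form_closed) auto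
  ultimately have "linear_form W1 \<in> Idl (set xs)"
    using linear_form_socle[OF A link edges] by (simp add: socle_free_def set_xs)
  moreover have "W1 \<inter> W2 = {}" using edges irrefl_E by (auto simp: irrefl_def)
  ultimately show False
    using linear_form_part_not_in_ideal[OF A link _ ne] ij by (auto simp: set_xs)
qed

end

section \<open>Evaluation of polynomials\<close>

lemma finite_submultisets: "finite {a. a \<subseteq># m}"
proof (induction m)
  case (add x m)
  have "{a. a \<subseteq># add_mset x m} \<subseteq> {a. a \<subseteq># m} \<union> add_mset x ` {a. a \<subseteq># m}"
  proof
    fix a assume a: "a \<in> {a. a \<subseteq># add_mset x m}"
    show "a \<in> {a. a \<subseteq># m} \<union> add_mset x ` {a. a \<subseteq># m}"
    proof (cases "x \<in># a")
      case True
      then obtain b where b: "a = add_mset x b" by (metis multi_member_split)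
      then have "b \<subseteq># m" using a by simp
      then show ?thesis using b by blast
    next
      case False
      have "count a y \<le> count m y" for y
      proof (cases "y = x")
        case True
        then show ?thesis using False by (simp add: not_in_iff)
      next
        case ne: False
        have "count a y \<le> count (add_mset x m) y"
          by (rule mset_subset_eq_count) (use a in simp)
        then show ?thesis using ne by simp
      qed
      then show ?thesis by (simp add: subseteq_mset_def)
    qed
  qed
  then show ?case using add finite_subset by blast
qed simp

lemma mset_remove_eq_iff: "v \<in># n \<and> n - {#v#} = m \<longleftrightarrow> n = add_mset v m"
  by (auto dest!: multi_member_split)

definition support :: "('k, 'b) ring_scheme \<Rightarrow> ('v multiset \<Rightarrow> 'k) \<Rightarrow> 'v multiset set" where
  "support K p = {m. p m \<noteq> \<zero>\<^bsub>K\<^esub>}"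

definition monomial :: "('k, 'b) ring_scheme \<Rightarrow> 'v multiset \<Rightarrow> 'v multiset \<Rightarrow> 'k" where
  "monomial K m = (\<lambda>n. if n = m then \<one>\<^bsub>K\<^esub> else \<zero>\<^bsub>K\<^esub>)"

text \<open>
  Injectivity of the coefficient map is what makes the polynomial ring a subring of a known
  commutative ring (\<open>mpoly_cring\<close>).
\<close>
locale coefficient_hom = K?: cring K for K :: "('k, 'b) ring_scheme" (structure) +
  fixes c :: "'k \<Rightarrow> 'd :: comm_ring_1"
  assumes c_one: "c \<one> = 1"
    and c_add: "\<And>a b. a \<in> carrier K \<Longrightarrow> b \<in> carrier K \<Longrightarrow> c (a \<oplus> b) = c a + c b"
    and c_mult: "\<And>a b. a \<in> carrier K \<Longrightarrow> b \<in> carrier K \<Longrightarrow> c (a \<otimes> b) = c a * c b"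
    and c_inj: "inj_on c (carrier K)"

text \<open>
  Two coefficient maps are composed, so that the same coefficients can be evaluated both in \<open>'d\<close> and in a
  polynomial ring over \<open>'d\<close>.
\<close>
definition (in coefficient_hom) poly_eval ::
    "('v multiset \<Rightarrow> 'e :: comm_ring_1) \<Rightarrow> ('d \<Rightarrow> 'e) \<Rightarrow> ('v multiset \<Rightarrow> 'k) \<Rightarrow> 'e" where
  "poly_eval \<mu> e p = (\<Sum>m\<in>support K p. e (c (p m)) * \<mu> m)"

context cring
begin

lemma mpoly_carrier:
  fixes V :: "'v set"
  shows "carrier (mpoly_ring R V) =
     {p. (\<forall>m. p m \<in> carrier R) \<and> finite (support R p) \<and> (\<forall>m\<in>support R p. set_mset m \<subseteq> V)}"
proof (intro equalityI subsetI)
  fix p assume "p \<in> carrier (mpoly_ring R V)"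
  then have "p \<in> indexed_pset V (carrier R)" by (simp add: mpoly_ring_def)
  then show "p \<in> {p. (\<forall>m. p m \<in> carrier R) \<and> finite (support R p) \<and> (\<forall>m\<in>support R p. set_mset m \<subseteq> V)}"
  proof induction
    case (indexed_const k)
    have sub: "support R (indexed_const k :: 'v multiset \<Rightarrow> 'a) \<subseteq> {{#}}"
      by (auto simp: support_def indexed_const_def)
    have "finite (support R (indexed_const k :: 'v multiset \<Rightarrow> 'a))"
      by (rule finite_subset[OF sub]) simp
    moreover have "indexed_const k m \<in> carrier R" for m :: "'v multiset"
      using indexed_const by (simp add: indexed_const_def)
    moreover have "set_mset m \<subseteq> V" if "m \<in> support R (indexed_const k)" for m
      using sub that by auto
    ultimately show ?case by simp
  next
    case (indexed_padd P Q)
    have P: "\<forall>m. P m \<in> carrier R" "finite (support R P)" "\<forall>m\<in>support R P. set_mset m \<subseteq> V"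
      and Q: "\<forall>m. Q m \<in> carrier R" "finite (support R Q)" "\<forall>m\<in>support R Q. set_mset m \<subseteq> V"
      using indexed_padd.IH by simp_all
    have sub: "support R (indexed_padd P Q) \<subseteq> support R P \<union> support R Q"
      by (auto simp: support_def indexed_padd_def)
    have "finite (support R (indexed_padd P Q))" by (rule finite_subset[OF sub]) (simp add: P Q)
    moreover have "indexed_padd P Q m \<in> carrier R" for m using P Q by (simp add: indexed_padd_def)
    moreover have "set_mset m \<subseteq> V" if "m \<in> support R (indexed_padd P Q)" for m
      using subsetD[OF sub that] P(3) Q(3) by blast
    ultimately show ?case by simp
  next
    case (indexed_pmult P i)
    have sub: "support R (indexed_pmult P i) \<subseteq> add_mset i ` support R P"
    proof
      fix m assume "m \<in> support R (indexed_pmult P i)"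
      then have "i \<in># m" "P (m - {#i#}) \<noteq> \<zero>"
        by (auto simp: support_def indexed_pmult_def split: if_splits)
      then show "m \<in> add_mset i ` support R P"
        by (intro image_eqI[of _ _ "m - {#i#}"]) (auto simp: support_def)
    qed
    have P: "\<forall>m. P m \<in> carrier R" "finite (support R P)" "\<forall>m\<in>support R P. set_mset m \<subseteq> V"
      using indexed_pmult.IH by simp_all
    have "finite (support R (indexed_pmult P i))" by (rule finite_subset[OF sub]) (simp add: P)
    moreover have "indexed_pmult P i m \<in> carrier R" for m using P by (simp add: indexed_pmult_def)
    moreover have "set_mset m \<subseteq> V" if m: "m \<in> support R (indexed_pmult P i)" for m
    proof -
      obtain n where "n \<in> support R P" "m = add_mset i n" using subsetD[OF sub m] by blast
      then show ?thesis using P(3) indexed_pmult.hyps(2) by simp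
    qed
    ultimately show ?case by simp
  qed
next
  have scaled: "(\<lambda>n. if n = m then k else \<zero>) \<in> indexed_pset V (carrier R)"
    if "k \<in> carrier R" "set_mset m \<subseteq> V" for k m
    using that(2)
  proof (induction m)
    case empty
    then show ?case using indexed_pset.indexed_const[OF that(1), of V] by (simp add: indexed_const_def)
  next
    case (add v m)
    then have "indexed_pmult (\<lambda>n. if n = m then k else \<zero>) v \<in> indexed_pset V (carrier R)"
      by (intro indexed_pset.indexed_pmult) auto
    moreover have "indexed_pmult (\<lambda>n. if n = m then k else \<zero>) v
        = (\<lambda>n. if n = add_mset v m then k else \<zero>)"
    proof
      fix n
      have "v \<in># n \<and> n - {#v#} = m \<longleftrightarrow> n = add_mset v m"
        by (rule mset_remove_eq_iff)
      then show "indexed_pmult (\<lambda>n. if n = m then k else \<zero>) v n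
          = (if n = add_mset v m then k else \<zero>)" by (auto simp: indexed_pmult_def)
    qed
    ultimately show ?case by simp
  qed
  have build: "p \<in> indexed_pset V (carrier R)"
    if "finite M" "support R p \<subseteq> M" "\<forall>m. p m \<in> carrier R" "\<forall>m\<in>M. set_mset m \<subseteq> V" for p M
    using that
  proof (induction M arbitrary: p rule: finite_induct)
    case empty
    then have "p = indexed_const \<zero>" by (auto simp: support_def indexed_const_def)
    then show ?case by (auto intro: indexed_pset.indexed_const)
  next
    case (insert m M)
    have "p(m := \<zero>) \<in> indexed_pset V (carrier R)"
    proof (rule insert.IH)
      show "support R (p(m := \<zero>)) \<subseteq> M" using insert.prems(1) by (auto simp: support_def)
    qed (use insert.prems in auto)
    moreover have "(\<lambda>n. if n = m then p m else \<zero>) \<in> indexed_pset V (carrier R)"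
      using insert.prems by (intro scaled) auto
    ultimately have "indexed_padd (p(m := \<zero>)) (\<lambda>n. if n = m then p m else \<zero>) \<in> indexed_pset V (carrier R)"
      by (rule indexed_pset.indexed_padd)
    moreover have "indexed_padd (p(m := \<zero>)) (\<lambda>n. if n = m then p m else \<zero>) = p"
      using insert.prems(2) by (auto simp: indexed_padd_def fun_eq_iff)
    ultimately show ?case by simp
  qed
  show "p \<in> carrier (mpoly_ring R V)"
    if "p \<in> {p. (\<forall>m. p m \<in> carrier R) \<and> finite (support R p) \<and> (\<forall>m\<in>support R p. set_mset m \<subseteq> V)}" for p
    using build[of "support R p" p] that by (simp add: mpoly_ring_def)
qed

lemma mpoly_mult_support:
  assumes p: "\<forall>m. p m \<in> carrier R" and q: "\<forall>m. q m \<in> carrier R"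
  shows "support R (p \<otimes>\<^bsub>mpoly_ring R V\<^esub> q) \<subseteq> (\<lambda>(a, b). a + b) ` (support R p \<times> support R q)"
proof
  fix m assume m: "m \<in> support R (p \<otimes>\<^bsub>mpoly_ring R V\<^esub> q)"
  show "m \<in> (\<lambda>(a, b). a + b) ` (support R p \<times> support R q)"
  proof (rule ccontr)
    assume no: "m \<notin> (\<lambda>(a, b). a + b) ` (support R p \<times> support R q)"
    have "p a \<otimes> q (m - a) = \<zero>" if a: "a \<subseteq># m" for a
    proof -
      have "(a, m - a) \<notin> support R p \<times> support R q"
      proof
        assume "(a, m - a) \<in> support R p \<times> support R q"
        then have "(\<lambda>(a, b). a + b) (a, m - a) \<in> (\<lambda>(a, b). a + b) ` (support R p \<times> support R q)"
          by (rule imageI)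
        then show False using no a by simp
      qed
      then show ?thesis using p q by (auto simp: support_def)
    qed
    then have "(\<Oplus>a\<in>{a. a \<subseteq># m}. p a \<otimes> q (m - a)) = (\<Oplus>a\<in>{a. a \<subseteq># m}. \<zero>)"
      by (intro finsum_cong') simp_all
    then have "(p \<otimes>\<^bsub>mpoly_ring R V\<^esub> q) m = \<zero>" by (simp add: mpoly_ring_def)
    then show False using m by (simp add: support_def)
  qed
qed

lemma mpoly_mult_closed:
  assumes "p \<in> carrier (mpoly_ring R V)" "q \<in> carrier (mpoly_ring R V)"
  shows "p \<otimes>\<^bsub>mpoly_ring R V\<^esub> q \<in> carrier (mpoly_ring R V)"
proof -
  have p: "\<forall>m. p m \<in> carrier R" "finite (support R p)" "\<forall>m\<in>support R p. set_mset m \<subseteq> V"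
    and q: "\<forall>m. q m \<in> carrier R" "finite (support R q)" "\<forall>m\<in>support R q. set_mset m \<subseteq> V"
    using assms by (auto simp: mpoly_carrier)
  note sub = mpoly_mult_support[OF p(1) q(1), of V]
  have "(p \<otimes>\<^bsub>mpoly_ring R V\<^esub> q) m \<in> carrier R" for m
    unfolding mpoly_ring_def using p q by (auto intro!: finsum_closed)
  moreover have "finite (support R (p \<otimes>\<^bsub>mpoly_ring R V\<^esub> q))"
    by (rule finite_subset[OF sub]) (simp add: p q)
  moreover have "set_mset m \<subseteq> V" if m: "m \<in> support R (p \<otimes>\<^bsub>mpoly_ring R V\<^esub> q)" for m
  proof -
    obtain a b where "m = a + b" "a \<in> support R p" "b \<in> support R q"
      using subsetD[OF sub m] by auto
    then show ?thesis using p(3) q(3) by simp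
  qed
  ultimately show ?thesis by (simp add: mpoly_carrier)
qed

lemma mpoly_add_closed:
  assumes "p \<in> carrier (mpoly_ring R V)" "q \<in> carrier (mpoly_ring R V)"
  shows "p \<oplus>\<^bsub>mpoly_ring R V\<^esub> q \<in> carrier (mpoly_ring R V)"
  using assms by (auto simp: mpoly_ring_def intro: indexed_pset.indexed_padd)

lemma mpoly_one_zero_closed:
  "\<one>\<^bsub>mpoly_ring R V\<^esub> \<in> carrier (mpoly_ring R V)" "\<zero>\<^bsub>mpoly_ring R V\<^esub> \<in> carrier (mpoly_ring R V)"
  by (auto simp: mpoly_ring_def intro: indexed_pset.indexed_const)

lemma mpoly_add_apply: "(p \<oplus>\<^bsub>mpoly_ring R V\<^esub> q) m = p m \<oplus> q m"
  by (simp add: mpoly_ring_def indexed_padd_def)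

lemma mpoly_one_eq: "\<one>\<^bsub>mpoly_ring R V\<^esub> = monomial R {#}"
  by (auto simp: mpoly_ring_def monomial_def indexed_const_def)

lemma mpoly_zero_apply: "\<zero>\<^bsub>mpoly_ring R V\<^esub> m = \<zero>"
  by (simp add: mpoly_ring_def indexed_const_def)

lemma monomial_closed: "set_mset m \<subseteq> V \<Longrightarrow> monomial R m \<in> carrier (mpoly_ring R V)"
proof -
  assume m: "set_mset m \<subseteq> V"
  have "support R (monomial R m) \<subseteq> {m}" by (auto simp: support_def monomial_def)
  then have "finite (support R (monomial R m))" "\<forall>n\<in>support R (monomial R m). set_mset n \<subseteq> V"
    using m finite_subset[of _ "{m}"] by blast+
  then show ?thesis by (simp add: mpoly_carrier monomial_def)
qed

lemma indexed_var_eq_monomial: "indexed_var v = monomial R {#v#}"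
proof
  fix n :: "'c multiset"
  have "v \<in># n \<and> n - {#v#} = {#} \<longleftrightarrow> n = {#v#}"
    by (rule mset_remove_eq_iff)
  then show "indexed_var v n = monomial R {#v#} n"
    by (auto simp: indexed_var_def indexed_pmult_def indexed_const_def monomial_def)
qed

lemma indexed_pmult_eq_mult:
  assumes p: "\<forall>m. p m \<in> carrier R"
  shows "indexed_pmult p v = p \<otimes>\<^bsub>mpoly_ring R V\<^esub> monomial R {#v#}"
proof
  fix m
  have summand: "p a \<otimes> monomial R {#v#} (m - a)
      = (if v \<in># m \<and> a = m - {#v#} then p a else \<zero>)" if a: "a \<subseteq># m" for a
  proof -
    have "m - a = {#v#} \<longleftrightarrow> v \<in># m \<and> a = m - {#v#}"
    proof
      assume "m - a = {#v#}"
      then have "m = a + {#v#}" using a subset_mset.add_diff_inverse[of a m] by simp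
      then show "v \<in># m \<and> a = m - {#v#}" by simp
    next
      assume "v \<in># m \<and> a = m - {#v#}"
      then have "m = a + {#v#}" by simp
      then show "m - a = {#v#}" by simp
    qed
    then show ?thesis using p by (simp add: monomial_def)
  qed
  have "(p \<otimes>\<^bsub>mpoly_ring R V\<^esub> monomial R {#v#}) m
      = (\<Oplus>a\<in>{a. a \<subseteq># m}. p a \<otimes> monomial R {#v#} (m - a))" by (simp add: mpoly_ring_def)
  also have "\<dots> = (\<Oplus>a\<in>{a. a \<subseteq># m}. if v \<in># m \<and> a = m - {#v#} then p a else \<zero>)"
    by (rule finsum_cong') (use summand p in auto)
  also have "\<dots> = indexed_pmult p v m"
  proof (cases "v \<in># m")
    case True
    have "(\<Oplus>a\<in>{a. a \<subseteq># m}. if v \<in># m \<and> a = m - {#v#} then p a else \<zero>)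
        = (\<Oplus>a\<in>{a. a \<subseteq># m}. if m - {#v#} = a then p a else \<zero>)"
      by (rule finsum_cong') (use True p in auto)
    also have "\<dots> = p (m - {#v#})"
      by (rule finsum_singleton) (use p finite_submultisets in auto)
    finally show ?thesis using True by (simp add: indexed_pmult_def)
  next
    case False
    then show ?thesis by (simp add: indexed_pmult_def)
  qed
  finally show "indexed_pmult p v m = (p \<otimes>\<^bsub>mpoly_ring R V\<^esub> monomial R {#v#}) m" by simp
qed

end

lemma cring_pullback:
  fixes S (structure) and \<phi> :: "'a \<Rightarrow> 'e :: comm_ring_1"
  assumes inj: "inj_on \<phi> (carrier S)"
    and closed: "\<And>x y. x \<in> carrier S \<Longrightarrow> y \<in> carrier S \<Longrightarrow> x \<oplus> y \<in> carrier S"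
      "\<And>x y. x \<in> carrier S \<Longrightarrow> y \<in> carrier S \<Longrightarrow> x \<otimes> y \<in> carrier S"
      "\<zero> \<in> carrier S" "\<one> \<in> carrier S"
    and hom: "\<And>x y. x \<in> carrier S \<Longrightarrow> y \<in> carrier S \<Longrightarrow> \<phi> (x \<oplus> y) = \<phi> x + \<phi> y"
      "\<And>x y. x \<in> carrier S \<Longrightarrow> y \<in> carrier S \<Longrightarrow> \<phi> (x \<otimes> y) = \<phi> x * \<phi> y"
      "\<phi> \<zero> = 0" "\<phi> \<one> = 1"
    and neg: "\<And>x. x \<in> carrier S \<Longrightarrow> \<exists>y\<in>carrier S. \<phi> y + \<phi> x = 0"
  shows "cring S"
proof (rule cringI)
  have eqI: "x = y" if "x \<in> carrier S" "y \<in> carrier S" "\<phi> x = \<phi> y" for x y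
    using inj that by (simp add: inj_on_def)
  show "abelian_group S"
  proof (rule abelian_groupI)
    fix x assume x: "x \<in> carrier S"
    then obtain y where y: "y \<in> carrier S" "\<phi> y + \<phi> x = 0" using neg by blast
    have "y \<oplus> x = \<zero>" by (rule eqI) (use x y closed hom in auto)
    then show "\<exists>y\<in>carrier S. y \<oplus> x = \<zero>" using y by blast
  qed (auto intro!: eqI simp: closed hom algebra_simps)
  show "comm_monoid S"
    by (rule comm_monoidI) (auto intro!: eqI simp: closed hom algebra_simps)
  show "(x \<oplus> y) \<otimes> z = x \<otimes> z \<oplus> y \<otimes> z" if "x \<in> carrier S" "y \<in> carrier S" "z \<in> carrier S" for x y z
    by (rule eqI) (use that in \<open>auto simp: closed hom algebra_simps\<close>)
qed

context coefficient_hom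
begin

lemma c_zero: "c \<zero> = 0"
  using c_add[of \<zero> \<zero>] by simp

lemma c_finsum:
  assumes "finite A" "f \<in> A \<rightarrow> carrier K"
  shows "c (finsum K f A) = (\<Sum>a\<in>A. c (f a))"
  using assms by (induction A rule: finite_induct) (auto simp: c_zero c_add finsum_insert Pi_iff)

context
  fixes \<mu> :: "'v multiset \<Rightarrow> 'e :: comm_ring_1" and e :: "'d \<Rightarrow> 'e"
  assumes \<mu>_empty: "\<mu> {#} = 1" and \<mu>_add: "\<And>m n. \<mu> (m + n) = \<mu> m * \<mu> n"
    and e_one: "e 1 = 1" and e_add: "\<And>x y. e (x + y) = e x + e y"
    and e_mult: "\<And>x y. e (x * y) = e x * e y"
begin

lemma e_zero: "e 0 = 0"
  using e_add[of 0 0] by simp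

lemma e_sum: "e (sum f A) = (\<Sum>a\<in>A. e (f a))"
  by (induction A rule: infinite_finite_induct) (auto simp: e_zero e_add)

lemma poly_eval_superset:
  assumes "finite M" "support K p \<subseteq> M"
  shows "poly_eval \<mu> e p = (\<Sum>m\<in>M. e (c (p m)) * \<mu> m)"
  unfolding poly_eval_def
  by (rule sum.mono_neutral_left) (use assms in \<open>auto simp: support_def c_zero e_zero\<close>)

lemma poly_eval_monomial: "poly_eval \<mu> e (monomial K m) = \<mu> m"
proof -
  have "poly_eval \<mu> e (monomial K m) = (\<Sum>n\<in>{m}. e (c (monomial K m n)) * \<mu> n)"
    by (rule poly_eval_superset) (auto simp: support_def monomial_def)
  then show ?thesis by (simp add: monomial_def c_one e_one)
qed

lemma poly_eval_zero: "poly_eval \<mu> e \<zero>\<^bsub>mpoly_ring K V\<^esub> = 0"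
proof -
  have "support K \<zero>\<^bsub>mpoly_ring K V\<^esub> = {}" by (simp add: support_def mpoly_zero_apply)
  then show ?thesis by (simp add: poly_eval_def)
qed

lemma poly_eval_add:
  assumes "p \<in> carrier (mpoly_ring K V)" "q \<in> carrier (mpoly_ring K V)"
  shows "poly_eval \<mu> e (p \<oplus>\<^bsub>mpoly_ring K V\<^esub> q) = poly_eval \<mu> e p + poly_eval \<mu> e q"
proof -
  let ?M = "support K p \<union> support K q"
  have pq: "\<forall>m. p m \<in> carrier K" "\<forall>m. q m \<in> carrier K" and fin: "finite ?M"
    using assms by (auto simp: mpoly_carrier)
  have sub: "support K (p \<oplus>\<^bsub>mpoly_ring K V\<^esub> q) \<subseteq> ?M"
    by (auto simp: support_def mpoly_add_apply)
  have "poly_eval \<mu> e (p \<oplus>\<^bsub>mpoly_ring K V\<^esub> q) = (\<Sum>m\<in>?M. e (c (p m \<oplus> q m)) * \<mu> m)"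
    using poly_eval_superset[OF fin sub] by (simp add: mpoly_add_apply)
  also have "\<dots> = (\<Sum>m\<in>?M. e (c (p m)) * \<mu> m) + (\<Sum>m\<in>?M. e (c (q m)) * \<mu> m)"
    using pq by (simp add: c_add e_add distrib_right sum.distrib)
  also have "\<dots> = poly_eval \<mu> e p + poly_eval \<mu> e q"
    using poly_eval_superset[OF fin, of p] poly_eval_superset[OF fin, of q] by simp
  finally show ?thesis .
qed

lemma poly_eval_mult:
  assumes "p \<in> carrier (mpoly_ring K V)" "q \<in> carrier (mpoly_ring K V)"
  shows "poly_eval \<mu> e (p \<otimes>\<^bsub>mpoly_ring K V\<^esub> q) = poly_eval \<mu> e p * poly_eval \<mu> e q"
proof -
  let ?P = "support K p" and ?Q = "support K q"
  let ?M = "(\<lambda>(a, b). a + b) ` (?P \<times> ?Q)"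
  have pq: "\<forall>m. p m \<in> carrier K" "\<forall>m. q m \<in> carrier K" and fin: "finite ?P" "finite ?Q"
    using assms by (auto simp: mpoly_carrier)
  have finM: "finite ?M" using fin by simp
  define g where "g = (\<lambda>(m, a). e (c (p a)) * e (c (q (m - a))) * \<mu> m)"
  have coeff: "e (c ((p \<otimes>\<^bsub>mpoly_ring K V\<^esub> q) m))
      = (\<Sum>a\<in>{a. a \<subseteq># m}. e (c (p a)) * e (c (q (m - a))))" for m
  proof -
    have "c ((p \<otimes>\<^bsub>mpoly_ring K V\<^esub> q) m) = (\<Sum>a\<in>{a. a \<subseteq># m}. c (p a \<otimes> q (m - a)))"
      unfolding mpoly_ring_def using pq finite_submultisets by (auto intro!: c_finsum)
    then show ?thesis using pq by (simp add: c_mult e_sum e_mult)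
  qed
  have "poly_eval \<mu> e (p \<otimes>\<^bsub>mpoly_ring K V\<^esub> q)
      = (\<Sum>m\<in>?M. e (c ((p \<otimes>\<^bsub>mpoly_ring K V\<^esub> q) m)) * \<mu> m)"
    by (rule poly_eval_superset[OF finM mpoly_mult_support[OF pq]])
  also have "\<dots> = (\<Sum>m\<in>?M. \<Sum>a\<in>{a. a \<subseteq># m}. g (m, a))"
    by (simp add: coeff sum_distrib_right g_def)
  also have "\<dots> = sum g (Sigma ?M (\<lambda>m. {a. a \<subseteq># m}))"
    using finM finite_submultisets by (subst sum.Sigma) auto
  also have "\<dots> = sum g ((\<lambda>(a, b). (a + b, a)) ` (?P \<times> ?Q))"
  proof (rule sum.mono_neutral_right)
    show "finite (Sigma ?M (\<lambda>m. {a. a \<subseteq># m}))" using finM finite_submultisets by auto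
    show "(\<lambda>(a, b). (a + b, a)) ` (?P \<times> ?Q) \<subseteq> Sigma ?M (\<lambda>m. {a. a \<subseteq># m})" by auto
    show "\<forall>x\<in>Sigma ?M (\<lambda>m. {a. a \<subseteq># m}) - (\<lambda>(a, b). (a + b, a)) ` (?P \<times> ?Q). g x = 0"
    proof
      fix x assume x: "x \<in> Sigma ?M (\<lambda>m. {a. a \<subseteq># m}) - (\<lambda>(a, b). (a + b, a)) ` (?P \<times> ?Q)"
      obtain m a where ma: "x = (m, a)" by (cases x)
      have "a \<subseteq># m" using x ma by auto
      then have "x = (\<lambda>(a, b). (a + b, a)) (a, m - a)" by (simp add: ma)
      then have "(a, m - a) \<notin> ?P \<times> ?Q" using x by blast
      then show "g x = 0" by (auto simp: ma g_def support_def c_zero e_zero)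
    qed
  qed
  also have "\<dots> = (\<Sum>(a, b)\<in>?P \<times> ?Q. (e (c (p a)) * \<mu> a) * (e (c (q b)) * \<mu> b))"
    by (subst sum.reindex) (auto simp: inj_on_def g_def \<mu>_add algebra_simps intro!: sum.cong)
  also have "\<dots> = poly_eval \<mu> e p * poly_eval \<mu> e q"
    by (simp add: poly_eval_def sum_product sum.cartesian_product)
  finally show ?thesis .
qed

end

text \<open>
  Sending a polynomial to the corresponding finitely supported function is an injective
  homomorphism into a monoid algebra.
\<close>
lemma mpoly_cring:
  fixes V :: "'v set"
  shows "cring (mpoly_ring K V)"
proof -
  define \<mu> :: "'v multiset \<Rightarrow> 'v multiset \<Rightarrow>\<^sub>0 'd" where "\<mu> m = Poly_Mapping.single m 1" for m
  define e :: "'d \<Rightarrow> 'v multiset \<Rightarrow>\<^sub>0 'd" where "e = Poly_Mapping.single 0"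
  define \<phi> where "\<phi> = poly_eval \<mu> e"
  have hyps: "\<mu> {#} = 1" "\<And>m n. \<mu> (m + n) = \<mu> m * \<mu> n" "e 1 = 1"
    "\<And>x y. e (x + y) = e x + e y" "\<And>x y. e (x * y) = e x * e y"
    by (simp_all add: \<mu>_def e_def mult_single single_add flip: single_one)
  have coeff: "Poly_Mapping.lookup (\<phi> p) m = c (p m)" if p: "p \<in> carrier (mpoly_ring K V)" for p m
  proof -
    have fin: "finite (insert m (support K p))" using p by (simp add: mpoly_carrier)
    have "\<phi> p = (\<Sum>n\<in>insert m (support K p). Poly_Mapping.single n (c (p n)))"
      unfolding \<phi>_def poly_eval_superset[OF hyps fin subset_insertI]
      by (simp add: e_def \<mu>_def mult_single)
    then have "Poly_Mapping.lookup (\<phi> p) m = (\<Sum>n\<in>insert m (support K p). if n = m then c (p n) else 0)"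
      by (simp add: lookup_sum lookup_single when_def)
    then show ?thesis using fin by simp
  qed
  show ?thesis
  proof (rule cring_pullback[of \<phi>])
    show "inj_on \<phi> (carrier (mpoly_ring K V))"
    proof (rule inj_onI, rule ext)
      fix p q m assume "p \<in> carrier (mpoly_ring K V)" "q \<in> carrier (mpoly_ring K V)" "\<phi> p = \<phi> q"
      then have "c (p m) = c (q m)" "p m \<in> carrier K" "q m \<in> carrier K"
        using coeff[of p m] coeff[of q m] by (simp_all add: mpoly_carrier)
      then show "p m = q m" using c_inj by (simp add: inj_on_def)
    qed
    show "\<phi> \<zero>\<^bsub>mpoly_ring K V\<^esub> = 0" unfolding \<phi>_def by (rule poly_eval_zero[OF hyps])
    show "\<phi> \<one>\<^bsub>mpoly_ring K V\<^esub> = 1"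
      unfolding \<phi>_def mpoly_one_eq poly_eval_monomial[OF hyps] by (rule hyps)
    fix p assume p: "p \<in> carrier (mpoly_ring K V)"
    define q where "q = (\<lambda>m. \<ominus> p m)"
    have pc: "\<forall>m. p m \<in> carrier K" using p by (simp add: mpoly_carrier)
    have "support K q \<subseteq> support K p" by (auto simp: support_def q_def)
    then have q: "q \<in> carrier (mpoly_ring K V)"
      using p pc finite_subset[of "support K q" "support K p"] unfolding mpoly_carrier
      by (auto simp: q_def)
    have "\<phi> q + \<phi> p = 0"
    proof (rule poly_mapping_eqI)
      fix m
      have "c (q m) + c (p m) = c (q m \<oplus> p m)" using pc by (simp add: c_add q_def)
      also have "\<dots> = 0" using pc by (simp add: q_def l_neg c_zero)
      finally show "Poly_Mapping.lookup (\<phi> q + \<phi> p) m = Poly_Mapping.lookup 0 m"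
        by (simp add: lookup_add coeff p q)
    qed
    then show "\<exists>q\<in>carrier (mpoly_ring K V). \<phi> q + \<phi> p = 0" using q by blast
    fix q assume q: "q \<in> carrier (mpoly_ring K V)"
    show "\<phi> (p \<oplus>\<^bsub>mpoly_ring K V\<^esub> q) = \<phi> p + \<phi> q"
      unfolding \<phi>_def by (rule poly_eval_add[OF hyps p q])
    show "\<phi> (p \<otimes>\<^bsub>mpoly_ring K V\<^esub> q) = \<phi> p * \<phi> q"
      unfolding \<phi>_def by (rule poly_eval_mult[OF hyps p q])
    show "p \<oplus>\<^bsub>mpoly_ring K V\<^esub> q \<in> carrier (mpoly_ring K V)" by (rule mpoly_add_closed[OF p q])
    show "p \<otimes>\<^bsub>mpoly_ring K V\<^esub> q \<in> carrier (mpoly_ring K V)" by (rule mpoly_mult_closed[OF p q])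
  qed (rule mpoly_one_zero_closed)+
qed

end

section \<open>The edge ring of a graph\<close>

definition two_element_field :: "'k \<Rightarrow> 'k \<Rightarrow> 'k ring" where
  "two_element_field z e =
     \<lparr>carrier = {z, e}, monoid.mult = (\<lambda>a b. if a = e \<and> b = e then e else z), one = e,
      zero = z, add = (\<lambda>a b. if a = b then z else e)\<rparr>"

lemma two_element_field:
  assumes "z \<noteq> e" shows "field (two_element_field z e)"
proof -
  let ?K = "two_element_field z e"
  define \<phi> :: "'a \<Rightarrow> bit" where "\<phi> k = (if k = e then 1 else 0)" for k
  interpret cring ?K
    by (rule cring_pullback[of \<phi>])
      (use assms in \<open>auto simp: two_element_field_def \<phi>_def inj_on_def\<close>)
  show ?thesis
  proof (rule cring_fieldI)
    show "Units ?K = carrier ?K - {\<zero>\<^bsub>?K\<^esub>}"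
      using assms by (auto simp: Units_def two_element_field_def)
  qed
qed

text \<open>
  An assignment \<open>\<alpha>\<close> that respects the edge relations makes the evaluation of polynomials vanish on the edge ideal, so
  that it can be read off from an arbitrary representative of a coset.
\<close>
theorem edge_ring_quotient:
  fixes G :: "'v pair_pre_digraph" and z e :: 'k
  assumes G: "pair_graph G" and ze: "z \<noteq> e"
  defines "K \<equiv> two_element_field z e"
  shows "\<exists>mon ev. edge_ring (mpoly_ring K (pverts G) Quot edge_ideal K G) (pverts G) (parcs G) mon ev"
proof -
  interpret G: pair_graph G by fact
  interpret K: field K unfolding K_def by (rule two_element_field[OF ze])
  have K_simps: "carrier K = {z, e}" "\<one>\<^bsub>K\<^esub> = e" "\<zero>\<^bsub>K\<^esub> = z" "e \<oplus>\<^bsub>K\<^esub> e = z"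
    by (simp_all add: K_def two_element_field_def)
  define c :: "'k \<Rightarrow> f2_poly" where "c k = (if k = e then 1 else 0)" for k
  interpret c: coefficient_hom K c
    by unfold_locales
      (use ze f2_poly_add_self[of 1] in \<open>auto simp: K_def two_element_field_def c_def inj_on_def\<close>)
  define V where "V = pverts G"
  define S where "S = mpoly_ring K V"
  define I where "I = edge_ideal K G"
  define R where "R = S Quot I"
  interpret S: cring S unfolding S_def by (rule c.mpoly_cring)
  define gens where "gens = {monomial K {#u#} \<otimes>\<^bsub>S\<^esub> monomial K {#v#} | u v. (u, v) \<in> parcs G}"
  have EV: "u \<in> V" "v \<in> V" if "(u, v) \<in> parcs G" for u v
    using G.wellformed'[OF that] by (auto simp: V_def)
  have mono_S: "monomial K m \<in> carrier S" if "set_mset m \<subseteq> V" for m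
    unfolding S_def by (rule K.monomial_closed[OF that])
  have gens_S: "gens \<subseteq> carrier S" using EV mono_S by (auto simp: gens_def)
  have I_eq: "I = genideal S gens"
    by (simp add: I_def edge_ideal_def gens_def S_def V_def K.indexed_var_eq_monomial)
  interpret I: ideal I S unfolding I_eq by (rule S.genideal_ideal[OF gens_S])
  interpret R: cring R unfolding R_def by (rule I.quotient_is_cring[OF S.is_cring])
  define \<pi> where "\<pi> p = I +>\<^bsub>S\<^esub> p" for p
  have \<pi>_hom: "\<pi> \<in> ring_hom S R" unfolding \<pi>_def R_def by (rule I.rcos_ring_hom)
  note \<pi>_simps = ring_hom_closed[OF \<pi>_hom] ring_hom_mult[OF \<pi>_hom] ring_hom_add[OF \<pi>_hom] ring_hom_one[OF \<pi>_hom]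
  have carrier_R: "carrier R = \<pi> ` carrier S"
    by (auto simp: R_def FactRing_def A_RCOSETS_def RCOSETS_def \<pi>_def a_r_coset_def)
  have \<pi>_zero: "\<pi> p = \<zero>\<^bsub>R\<^esub>" if "p \<in> I" for p
    using S.a_rcos_zero[OF I.is_ideal that] by (simp add: \<pi>_def R_def FactRing_def)
  define mon where "mon m = \<pi> (monomial K m)" for m
  define \<mu> where "\<mu> \<alpha> m = (\<Prod>v\<in>#m. \<alpha> v)" for \<alpha> :: "'v \<Rightarrow> f2_poly" and m
  define i :: "f2_poly \<Rightarrow> f2_poly" where "i x = x" for x
  define value_of where "value_of \<alpha> = c.poly_eval (\<mu> \<alpha>) i" for \<alpha>
  have \<mu>_hom: "\<mu> \<alpha> {#} = 1" "\<mu> \<alpha> (m + n) = \<mu> \<alpha> m * \<mu> \<alpha> n" for \<alpha> m n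
    by (simp_all add: \<mu>_def)
  have i_hom: "i 1 = 1" "i (x + y) = i x + i y" "i (x * y) = i x * i y" for x y
    by (simp_all add: i_def)
  have val_add: "value_of \<alpha> (p \<oplus>\<^bsub>S\<^esub> q) = value_of \<alpha> p + value_of \<alpha> q"
    and val_mult: "value_of \<alpha> (p \<otimes>\<^bsub>S\<^esub> q) = value_of \<alpha> p * value_of \<alpha> q"
    if "p \<in> carrier S" "q \<in> carrier S" for \<alpha> p q
    using that c.poly_eval_add[OF \<mu>_hom[of \<alpha>] i_hom, of p V q] c.poly_eval_mult[OF \<mu>_hom[of \<alpha>] i_hom, of p V q]
    by (simp_all add: value_of_def S_def)
  have val_mono: "value_of \<alpha> (monomial K m) = (\<Prod>v\<in>#m. \<alpha> v)" for \<alpha> m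
    unfolding value_of_def c.poly_eval_monomial[OF \<mu>_hom[of \<alpha>] i_hom] by (rule \<mu>_def)
  have val_zero: "value_of \<alpha> \<zero>\<^bsub>S\<^esub> = 0" for \<alpha>
    unfolding value_of_def S_def by (rule c.poly_eval_zero[OF \<mu>_hom[of \<alpha>] i_hom])
  have one_S: "\<one>\<^bsub>S\<^esub> = monomial K {#}" unfolding S_def by (rule K.mpoly_one_eq)
  define ev where "ev \<alpha> r = value_of \<alpha> (SOME p. p \<in> carrier S \<and> \<pi> p = r)" for \<alpha> r
  have ev_\<pi>: "ev \<alpha> (\<pi> p) = value_of \<alpha> p"
    if \<alpha>: "\<forall>(u, v)\<in>parcs G. \<alpha> u * \<alpha> v = 0" and p: "p \<in> carrier S" for \<alpha> p
  proof -
    have "ideal {p \<in> carrier S. value_of \<alpha> p = 0} S"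
    proof (rule idealI)
      show "subgroup {p \<in> carrier S. value_of \<alpha> p = 0} (add_monoid S)"
      proof (rule S.add.subgroupI)
        show "{p \<in> carrier S. value_of \<alpha> p = 0} \<noteq> {}" using val_zero S.zero_closed by blast
        fix p assume p: "p \<in> {p \<in> carrier S. value_of \<alpha> p = 0}"
        then have "value_of \<alpha> (\<ominus>\<^bsub>S\<^esub> p) = value_of \<alpha> (\<ominus>\<^bsub>S\<^esub> p \<oplus>\<^bsub>S\<^esub> p)" by (simp add: val_add)
        also have "\<dots> = 0" using p by (simp add: S.l_neg val_zero)
        finally show "\<ominus>\<^bsub>S\<^esub> p \<in> {p \<in> carrier S. value_of \<alpha> p = 0}" using p by simp
        fix q assume "q \<in> {p \<in> carrier S. value_of \<alpha> p = 0}"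
        then show "p \<oplus>\<^bsub>S\<^esub> q \<in> {p \<in> carrier S. value_of \<alpha> p = 0}" using p by (simp add: val_add)
      qed auto
    qed (use S.ring_axioms in \<open>auto simp: val_mult\<close>)
    moreover have "gens \<subseteq> {p \<in> carrier S. value_of \<alpha> p = 0}"
    proof
      fix g assume "g \<in> gens"
      then obtain u v where uv: "(u, v) \<in> parcs G" "g = monomial K {#u#} \<otimes>\<^bsub>S\<^esub> monomial K {#v#}"
        by (auto simp: gens_def)
      then have "value_of \<alpha> g = \<alpha> u * \<alpha> v" using EV[OF uv(1)] by (simp add: val_mult mono_S val_mono)
      then show "g \<in> {p \<in> carrier S. value_of \<alpha> p = 0}" using \<alpha> uv gens_S \<open>g \<in> gens\<close> by auto
    qed
    ultimately have kernel: "I \<subseteq> {p \<in> carrier S. value_of \<alpha> p = 0}"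
      unfolding I_eq by (rule S.genideal_minimal)
    define q where "q = (SOME q. q \<in> carrier S \<and> \<pi> q = \<pi> p)"
    have q: "q \<in> carrier S" "\<pi> q = \<pi> p"
      using someI[of "\<lambda>q. q \<in> carrier S \<and> \<pi> q = \<pi> p" p] p unfolding q_def by auto
    have "q \<ominus>\<^bsub>S\<^esub> p \<in> I"
      using S.quotient_eq_iff_same_a_r_cos[OF I.is_ideal q(1) p] q(2) by (simp add: \<pi>_def)
    then have d: "q \<ominus>\<^bsub>S\<^esub> p \<in> carrier S" "value_of \<alpha> (q \<ominus>\<^bsub>S\<^esub> p) = 0" using kernel by auto
    have "q = (q \<ominus>\<^bsub>S\<^esub> p) \<oplus>\<^bsub>S\<^esub> p" using q p by (simp add: a_minus_def S.a_assoc S.l_neg)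
    then have "value_of \<alpha> q = value_of \<alpha> (q \<ominus>\<^bsub>S\<^esub> p) + value_of \<alpha> p" using val_add[OF d(1) p] by metis
    then show ?thesis using d by (simp add: ev_def q_def)
  qed
  have monomial_add: "monomial K m \<otimes>\<^bsub>S\<^esub> monomial K n = monomial K (m + n)" if "set_mset m \<subseteq> V" "set_mset n \<subseteq> V" for m n
    using that(2)
  proof (induction n)
    case empty
    then show ?case using mono_S[OF that(1)] by (simp flip: one_S)
  next
    case (add v n)
    have mult_var: "monomial K (add_mset v k) = monomial K k \<otimes>\<^bsub>S\<^esub> monomial K {#v#}" for k
    proof -
      have "monomial K (add_mset v k) = K.indexed_pmult (monomial K k) v"
      proof
        fix l
        show "monomial K (add_mset v k) l = K.indexed_pmult (monomial K k) v l"
          using mset_remove_eq_iff[of v l k] by (auto simp: monomial_def K.indexed_pmult_def)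
      qed
      also have "\<dots> = monomial K k \<otimes>\<^bsub>S\<^esub> monomial K {#v#}"
        unfolding S_def by (rule K.indexed_pmult_eq_mult) (simp add: monomial_def)
      finally show ?thesis .
    qed
    have c: "monomial K m \<in> carrier S" "monomial K n \<in> carrier S" "monomial K {#v#} \<in> carrier S"
      using that(1) add.prems by (auto intro!: mono_S)
    have "monomial K m \<otimes>\<^bsub>S\<^esub> monomial K (add_mset v n)
        = (monomial K m \<otimes>\<^bsub>S\<^esub> monomial K n) \<otimes>\<^bsub>S\<^esub> monomial K {#v#}"
      unfolding mult_var[of n] using c by (simp add: S.m_assoc)
    also have "\<dots> = monomial K (m + n) \<otimes>\<^bsub>S\<^esub> monomial K {#v#}" using add by simp
    also have "\<dots> = monomial K (m + add_mset v n)" using mult_var[of "m + n"] by simp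
    finally show ?case .
  qed
  have "edge_ring R V (parcs G) mon ev"
  proof (unfold_locales)
    show "finite V" unfolding V_def by (rule G.pair_finite_verts)
    show "sym (parcs G)" using G.pair_sym_arcs by (simp add: symmetric_def)
    show "irrefl (parcs G)" using G.pair_no_loops by (fastforce simp: irrefl_def)
    show "parcs G \<subseteq> V \<times> V" using EV by auto
    show "mon m \<in> carrier R" if "set_mset m \<subseteq> V" for m
      unfolding mon_def by (rule \<pi>_simps(1)[OF mono_S[OF that]])
    show "mon {#} = \<one>\<^bsub>R\<^esub>" unfolding mon_def one_S[symmetric] by (rule \<pi>_simps)
    show "mon (m + n) = mon m \<otimes>\<^bsub>R\<^esub> mon n" if "set_mset m \<subseteq> V" "set_mset n \<subseteq> V" for m n
      using that by (simp add: mon_def \<pi>_simps mono_S flip: monomial_add)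
    show "mon {#u, v#} = \<zero>\<^bsub>R\<^esub>" if uv: "(u, v) \<in> parcs G" for u v
    proof -
      have "monomial K {#u, v#} = monomial K {#u#} \<otimes>\<^bsub>S\<^esub> monomial K {#v#}"
        using monomial_add[of "{#u#}" "{#v#}"] EV[OF uv] by (simp add: add_mset_commute)
      then have "monomial K {#u, v#} \<in> gens" using uv by (auto simp: gens_def)
      then have "monomial K {#u, v#} \<in> I" unfolding I_eq using S.genideal_self[OF gens_S] by blast
      then show ?thesis unfolding mon_def by (rule \<pi>_zero)
    qed
    show "\<one>\<^bsub>R\<^esub> \<oplus>\<^bsub>R\<^esub> \<one>\<^bsub>R\<^esub> = \<zero>\<^bsub>R\<^esub>"
    proof -
      have "\<one>\<^bsub>S\<^esub> \<oplus>\<^bsub>S\<^esub> \<one>\<^bsub>S\<^esub> = \<zero>\<^bsub>S\<^esub>"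
      proof
        fix m
        show "(\<one>\<^bsub>S\<^esub> \<oplus>\<^bsub>S\<^esub> \<one>\<^bsub>S\<^esub>) m = \<zero>\<^bsub>S\<^esub> m"
          unfolding S_def K.mpoly_add_apply K.mpoly_zero_apply K.mpoly_one_eq
          using K_simps by (auto simp: monomial_def)
      qed
      then have "\<pi> \<one>\<^bsub>S\<^esub> \<oplus>\<^bsub>R\<^esub> \<pi> \<one>\<^bsub>S\<^esub> = \<pi> \<zero>\<^bsub>S\<^esub>"
        using \<pi>_simps(3)[of "\<one>\<^bsub>S\<^esub>" "\<one>\<^bsub>S\<^esub>"] by simp
      moreover have "\<pi> \<zero>\<^bsub>S\<^esub> = \<zero>\<^bsub>R\<^esub>" by (rule \<pi>_zero) simp
      ultimately show ?thesis by (simp add: \<pi>_simps)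
    qed
    show "A = carrier R"
      if A: "A \<subseteq> carrier R" "\<zero>\<^bsub>R\<^esub> \<in> A" "\<one>\<^bsub>R\<^esub> \<in> A" "\<And>a b. a \<in> A \<Longrightarrow> b \<in> A \<Longrightarrow> a \<oplus>\<^bsub>R\<^esub> b \<in> A"
        "\<And>a v. a \<in> A \<Longrightarrow> v \<in> V \<Longrightarrow> a \<otimes>\<^bsub>R\<^esub> mon {#v#} \<in> A" for A
    proof -
      have "\<pi> p \<in> A" if "p \<in> carrier S" for p
      proof -
        have "p \<in> K.indexed_pset V (carrier K)" using that by (simp add: S_def mpoly_ring_def)
        then show ?thesis
        proof induction
          case (indexed_const k)
          have "K.indexed_const e = \<one>\<^bsub>S\<^esub>" "K.indexed_const z = \<zero>\<^bsub>S\<^esub>"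
            by (simp_all add: S_def mpoly_ring_def K_simps)
          then show ?case using indexed_const K_simps A(2,3) \<pi>_zero[OF I.zero_closed] \<pi>_simps(4) by auto
        next
          case (indexed_padd P Q)
          then have "P \<in> carrier S" "Q \<in> carrier S" "K.indexed_padd P Q = P \<oplus>\<^bsub>S\<^esub> Q"
            by (simp_all add: S_def mpoly_ring_def)
          then show ?case using indexed_padd.IH A(4) by (simp add: \<pi>_simps)
        next
          case (indexed_pmult P i)
          have P: "P \<in> carrier S" using indexed_pmult.hyps by (simp add: S_def mpoly_ring_def)
          then have "\<forall>m. P m \<in> carrier K" by (simp add: S_def K.mpoly_carrier)
          then have "K.indexed_pmult P i = P \<otimes>\<^bsub>S\<^esub> monomial K {#i#}"
            unfolding S_def by (rule K.indexed_pmult_eq_mult)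
          moreover have "monomial K {#i#} \<in> carrier S" using indexed_pmult.hyps by (intro mono_S) simp
          ultimately show ?case
            using P indexed_pmult A(5)[of "\<pi> P" i] by (simp add: \<pi>_simps mon_def)
        qed
      qed
      then have "carrier R \<subseteq> A" unfolding carrier_R by (rule image_subsetI)
      then show ?thesis by (rule subset_antisym[OF A(1)])
    qed
    fix \<alpha> :: "'v \<Rightarrow> f2_poly" assume \<alpha>: "\<forall>(u, v)\<in>parcs G. \<alpha> u * \<alpha> v = 0"
    note ev = ev_\<pi>[OF \<alpha>]
    have "ev \<alpha> (\<pi> \<one>\<^bsub>S\<^esub>) = 1" unfolding ev[OF S.one_closed] unfolding one_S val_mono by simp
    then show "ev \<alpha> \<one>\<^bsub>R\<^esub> = 1" by (simp add: \<pi>_simps)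
    show "ev \<alpha> (mon {#v#}) = \<alpha> v" if "v \<in> V" for v
      using that by (simp add: mon_def ev mono_S val_mono)
    fix a b assume "a \<in> carrier R" "b \<in> carrier R"
    then have "a \<in> \<pi> ` carrier S" "b \<in> \<pi> ` carrier S" by (simp_all only: carrier_R)
    then obtain p q where pq: "p \<in> carrier S" "q \<in> carrier S" "a = \<pi> p" "b = \<pi> q"
      by (elim imageE)
    have "ev \<alpha> (\<pi> (p \<oplus>\<^bsub>S\<^esub> q)) = value_of \<alpha> (p \<oplus>\<^bsub>S\<^esub> q)" using pq by (intro ev) simp
    then show "ev \<alpha> (a \<oplus>\<^bsub>R\<^esub> b) = ev \<alpha> a + ev \<alpha> b"
      using pq by (simp add: \<pi>_simps val_add ev)
    have "ev \<alpha> (\<pi> (p \<otimes>\<^bsub>S\<^esub> q)) = value_of \<alpha> (p \<otimes>\<^bsub>S\<^esub> q)" using pq by (intro ev) simp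
    then show "ev \<alpha> (a \<otimes>\<^bsub>R\<^esub> b) = ev \<alpha> a * ev \<alpha> b"
      using pq by (simp add: \<pi>_simps val_mult ev)
  qed
  then show ?thesis unfolding R_def S_def I_def V_def by blast
qed

section \<open>Orientations of the complement\<close>

lemma connected_imp_cut_arc:
  assumes G: "pair_graph G" and conn: "Digraph_Component.connected (with_proj G)"
    and S: "S \<subseteq> pverts G" "S \<noteq> {}" "S \<noteq> pverts G"
  shows "\<exists>x\<in>S. \<exists>y\<in>pverts G - S. (x, y) \<in> parcs G"
proof (rule ccontr)
  assume no: "\<not> ?thesis"
  interpret G: pair_graph G by fact
  have "Digraph_Component.strongly_connected (with_proj G)"
    by (rule G.symmetric_connected_imp_strongly_connected[OF G.pair_sym_arcs conn])
  moreover obtain u v where uv: "u \<in> S" "v \<in> pverts G" "v \<notin> S" using S by blast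
  ultimately have "(u, v) \<in> rtrancl_on (pverts G) (parcs G)"
    using S by (auto simp: strongly_connected_def reachable_def)
  then have "(u, v) \<in> (parcs G)\<^sup>*" by (rule rtrancl_on_rtranclI)
  then have "v \<in> S"
  proof induction
    case base
    show ?case by (rule uv)
  next
    case (step x y)
    then show ?case using no G.in_arcsD2[of x y] by blast
  qed
  then show False using uv by simp
qed

text \<open>
  Two vertices are nonadjacent iff their positions in the two words are ordered in the same way, and the product
  order on pairs of positions is a partial order.
\<close>
lemma permutation_graph_complement_comparability:
  assumes "permutation_graph G"
  shows "comparability_graph (complement_graph G)"
proof -
  obtain n p1 p2 f where p: "p1 permutes {1..n}" and f: "bij_betw f {1..n} (pverts G)"
    and arcs: "parcs G = map_prod f f ` parcs (perm_graph n p1 p2)"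
    using assms unfolding permutation_graph_def by blast
  define q1 where "q1 = inv_into {1..n} p1"
  define q2 where "q2 = inv_into {1..n} p2"
  have inj: "inj_on q1 {1..n}"
    using inj_on_inv_into[of "{1..n}" p1 "{1..n}"] permutes_image[OF p] by (simp add: q1_def)
  define g where "g = inv_into {1..n} f"
  have g: "g x \<in> {1..n}" "f (g x) = x" if "x \<in> pverts G" for x
    using that inv_into_into[of x f "{1..n}"] f_inv_into_f[of x f "{1..n}"] bij_betw_imp_surj_on[OF f]
    unfolding g_def by simp_all
  have gf: "g (f i) = i" if "i \<in> {1..n}" for i
    using that f unfolding g_def bij_betw_def by simp
  have fV: "f i \<in> pverts G" if "i \<in> {1..n}" for i using that f bij_betwE by blast
  have arc_iff: "(x, y) \<in> parcs G \<longleftrightarrow>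
      (q1 (g x) < q1 (g y) \<and> q2 (g y) < q2 (g x) \<or> q1 (g y) < q1 (g x) \<and> q2 (g x) < q2 (g y))"
    if xy: "x \<in> pverts G" "y \<in> pverts G" for x y
  proof -
    have "(x, y) \<in> parcs G \<longleftrightarrow> (g x, g y) \<in> parcs (perm_graph n p1 p2)"
    proof
      assume "(x, y) \<in> parcs G"
      then obtain i j where ij: "(i, j) \<in> parcs (perm_graph n p1 p2)" "x = f i" "y = f j"
        unfolding arcs by auto
      then have "i \<in> {1..n}" "j \<in> {1..n}" by (auto simp: perm_graph_def)
      then show "(g x, g y) \<in> parcs (perm_graph n p1 p2)" using ij by (simp add: gf)
    next
      assume "(g x, g y) \<in> parcs (perm_graph n p1 p2)"
      then have "map_prod f f (g x, g y) \<in> parcs G" unfolding arcs by (rule imageI)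
      then show "(x, y) \<in> parcs G" using g xy by simp
    qed
    then show ?thesis using g(1)[OF xy(1)] g(1)[OF xy(2)] by (simp add: perm_graph_def q1_def q2_def)
  qed
  have g_inj: "x = y" if "x \<in> pverts G" "y \<in> pverts G" "q1 (g x) = q1 (g y)" for x y
    using that g inj by (metis inj_onD)
  define P where "P = {(x, y). x \<in> pverts G \<and> y \<in> pverts G \<and> q1 (g x) \<le> q1 (g y) \<and> q2 (g x) \<le> q2 (g y)}"
  have Field_P: "Field P = pverts G" by (auto simp: P_def Field_def)
  have "Partial_order P"
    unfolding partial_order_on_def preorder_on_def Field_P
  proof (intro conjI)
    show "P \<subseteq> pverts G \<times> pverts G" by (auto simp: P_def)
    show "refl_on (pverts G) P" by (auto simp: P_def refl_on_def)
    show "trans P" by (auto simp: P_def trans_def)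
    show "antisym P"
    proof (rule antisymI)
      fix x y assume "(x, y) \<in> P" "(y, x) \<in> P"
      then have "x \<in> pverts G" "y \<in> pverts G" "q1 (g x) = q1 (g y)" by (auto simp: P_def)
      then show "x = y" using g_inj by blast
    qed
  qed
  moreover have "complement_graph G = comp_graph P"
  proof -
    have "(x, y) \<notin> parcs G \<longleftrightarrow> (x, y) \<in> P \<or> (y, x) \<in> P" if "x \<in> pverts G" "y \<in> pverts G" for x y
      using that by (auto simp: arc_iff P_def)
    then have "parcs (complement_graph G) = parcs (comp_graph P)"
      by (auto simp: complement_graph_def comp_graph_def P_def)
    then show ?thesis by (simp add: complement_graph_def comp_graph_def Field_P)
  qed
  ultimately show ?thesis unfolding comparability_graph_def by blast
qed

text \<open>
  A two-element field can be placed on any two elements of \<open>'k\<close>, so the Cohen--Macaulay property is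
  available over it.
\<close>
lemma cohen_macaulay_graph_modules:
  fixes G :: "'v pair_pre_digraph"
  assumes G: "pair_graph G" and conn: "Digraph_Component.connected (with_proj G)"
    and inf: "infinite (UNIV :: 'k set)" and CM: "cohen_macaulay_graph TYPE('k) G"
    and M: "graph_module (pverts G) (parcs G) M" "M \<noteq> pverts G"
    and xy: "x \<in> M" "y \<in> M" "x \<noteq> y"
  shows "(x, y) \<in> parcs G"
proof (rule ccontr)
  assume nonadj: "(x, y) \<notin> parcs G"
  interpret G: pair_graph G by fact
  obtain z :: 'k where True by blast
  obtain e :: 'k where "z \<noteq> e"
    using inf finite.emptyI finite_insert[of z "{}"] by (metis UNIV_eq_I singleton_iff)
  define K where "K = two_element_field z e"
  obtain mon ev where "edge_ring (mpoly_ring K (pverts G) Quot edge_ideal K G) (pverts G) (parcs G) mon ev"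
    using edge_ring_quotient[OF G \<open>z \<noteq> e\<close>] unfolding K_def by blast
  then interpret R: edge_ring "mpoly_ring K (pverts G) Quot edge_ideal K G" "pverts G" "parcs G" mon ev .
  have "cohen_macaulay_over K G"
    using CM two_element_field[OF \<open>z \<noteq> e\<close>] by (simp add: cohen_macaulay_graph_def K_def)
  then have CM_R: "cohen_macaulay_ring (mpoly_ring K (pverts G) Quot edge_ideal K G)"
    by (simp add: cohen_macaulay_over_def)
  have "M \<subseteq> pverts G" "M \<noteq> {}" using M xy by (auto simp: graph_module_def)
  then obtain u w where u: "u \<in> M" and w: "w \<in> pverts G - M" "(u, w) \<in> parcs G"
    using connected_imp_cut_arc[OF G conn _ _ M(2)] by blast
  then have "(w, u) \<in> parcs G" using R.sym_E by (meson symD)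
  then obtain A W1 W2 where "independent_set (pverts G) (parcs G) A"
    "link_vertices (pverts G) (parcs G) A = W1 \<union> W2" "W1 \<noteq> {}" "M \<subseteq> W2" "W1 \<times> W2 \<subseteq> parcs G"
    using module_disconnects_link[OF R.finite_V R.sym_E R.irrefl_E M(1) u w(1)] by blast
  then show False
    using R.cohen_macaulay_link_connected[OF CM_R, of A W1 W2 x y] xy nonadj by blast
qed

theorem corollary4p1:
  fixes G :: "'v pair_pre_digraph"
  assumes "pair_graph G"
    and "Digraph_Component.connected (with_proj G)"
    and "permutation_graph G"
    and "infinite (UNIV :: 'k set)"
    and "cohen_macaulay_graph TYPE('k) G"
  shows "UPO (complement_graph G)"
  unfolding UPO_def
proof (intro conjI allI impI)
  show "comparability_graph (complement_graph G)"
    by (rule permutation_graph_complement_comparability[OF assms(3)])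
  fix P Q
  assume PQ: "Partial_order P \<and> Partial_order Q \<and> complement_graph G = comp_graph P \<and>
    complement_graph G = comp_graph Q"
  interpret G: pair_graph G by (rule assms(1))
  have field: "Field T = pverts G" and comp: "\<And>x y. x \<in> pverts G \<Longrightarrow> y \<in> pverts G \<Longrightarrow> x \<noteq> y \<Longrightarrow>
      (x, y) \<in> T \<or> (y, x) \<in> T \<longleftrightarrow> (x, y) \<notin> parcs G"
    if T: "complement_graph G = comp_graph T" for T
  proof -
    have "pverts (complement_graph G) = pverts (comp_graph T)"
      and arcs: "parcs (complement_graph G) = parcs (comp_graph T)" using T by simp_all
    then show "Field T = pverts G" by (simp add: complement_graph_def comp_graph_def)
    fix x y assume xy: "x \<in> pverts G" "y \<in> pverts G" "x \<noteq> y"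
    have "(x, y) \<in> parcs (complement_graph G) \<longleftrightarrow> (x, y) \<in> parcs (comp_graph T)" using arcs by simp
    then show "(x, y) \<in> T \<or> (y, x) \<in> T \<longleftrightarrow> (x, y) \<notin> parcs G"
      using xy by (simp add: complement_graph_def comp_graph_def)
  qed
  show "P = Q \<or> P = Q\<inverse>"
  proof (rule ccontr)
    assume "\<not> (P = Q \<or> P = Q\<inverse>)"
    then have ne: "P \<noteq> Q" "P \<noteq> Q\<inverse>" by auto
    have P: "Partial_order P" "complement_graph G = comp_graph P"
      and Q: "Partial_order Q" "complement_graph G = comp_graph Q" using PQ by auto
    have "sym (parcs G)" using G.pair_sym_arcs by (simp add: symmetric_def)
    then obtain M x y where "graph_module (pverts G) (parcs G) M" "M \<noteq> pverts G"
      "x \<in> M" "y \<in> M" "x \<noteq> y" "(x, y) \<notin> parcs G"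
      using two_orientations_module[OF G.pair_finite_verts connected_imp_cut_arc[OF assms(1,2)] _
          P(1) field[OF P(2)] Q(1) field[OF Q(2)] comp[OF P(2)] comp[OF Q(2)] ne] by blast
    then show False using cohen_macaulay_graph_modules[OF assms(1,2,4,5)] by blast
  qed
qed

end
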